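(* Let $(M,\omega)$ be a symplectic manifold of dimension $2n$ and let $0\leq s\leq n-1$. Then the following statements are equivalent: (i) $(M,\omega)$ is $s$-Lefschetz. (ii) $H^{k}_{\rm hr}(M,\omega)=H^k(M)$ for every $k\leq s+2$, and $H^{2n-k}_{\rm hr}(M,\omega)=H^{2n-k}(M)$ for every $k\leq s$. (iii) $H^{2n-k}_{\rm hr}(M,\omega)=H^{2n-k}(M)$ for every $k\leq s$.
   Context: $H^*(M)$ denotes real de Rham cohomology. $(M,\omega)$ is $s$-Lefschetz, $0\leq s\leq n-1$, if the map $L^{n-k}\colon H^k(M)\to H^{2n-k}(M)$, $L^{n-k}[\alpha]=[\alpha\wedge\omega^{n-k}]$, is onto for all $k\leq s$. Let $\natural(X)=\iota_X\omega$ be the isomorphism from vector fields to $1$-forms, extended to an isomorphism of algebras from multivector fields to forms. Put $G=-\natural^{-1}(\omega)$ (the bivector field dual to $\omega$) and let the Koszul differential be $\delta=[\iota_G,d]\colon\Omega^k(M)\to\Omega^{k-1}(M)$. A form $\alpha$ is symplectically harmonic if $d\alpha=\delta\alpha=0$. $H^k_{\rm hr}(M,\omega)\subset H^k(M)$ is the subspace of classes containing at least one symplectically harmonic $k$-form. *)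

theory Defs
  imports "HOL-Analysis.Analysis"
begin

section \<open>Smooth manifolds\<close>

text \<open>On an open set \<open>S\<close>, \<^term>\<open>Ck_on k S f\<close> says that \<open>f\<close> is of class \<open>C\<^sup>k\<close>: all
  iterated directional derivatives of order at most \<open>k\<close> exist and are continuous.\<close>

primrec Ck_on ::
  "nat \<Rightarrow> 'e::euclidean_space set \<Rightarrow> ('e \<Rightarrow> 'f::euclidean_space) \<Rightarrow> bool" where
  "Ck_on 0 S f \<longleftrightarrow> continuous_on S f"
| "Ck_on (Suc k) S f \<longleftrightarrow> (\<forall>x\<in>S. f differentiable at x) \<and>
     (\<forall>v. Ck_on k S (\<lambda>x. frechet_derivative f (at x) v))"

definition smooth_on :: "'e::euclidean_space set \<Rightarrow> ('e \<Rightarrow> 'f::euclidean_space) \<Rightarrow> bool" where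
  "smooth_on S f \<longleftrightarrow> (\<forall>k. Ck_on k S f)"

text \<open>A chart is a pair \<open>(U, \<phi>)\<close>; the values of \<open>\<phi>\<close> outside \<open>U\<close> are irrelevant.\<close>

type_synonym ('a, 'e) chart = "'a set \<times> ('a \<Rightarrow> 'e)"

definition chart_image :: "('a, 'e) chart \<Rightarrow> 'e set" where
  "chart_image c = snd c ` fst c"

definition is_chart :: "'a topology \<Rightarrow> ('a, 'e::euclidean_space) chart \<Rightarrow> bool" where
  "is_chart M c \<longleftrightarrow> openin M (fst c) \<and> open (chart_image c) \<and>
     homeomorphic_map (subtopology M (fst c)) (top_of_set (chart_image c)) (snd c)"

definition overlap :: "('a, 'e) chart \<Rightarrow> ('a, 'e) chart \<Rightarrow> 'e set" where
  "overlap c c' = snd c ` (fst c \<inter> fst c')"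

definition transition :: "('a, 'e) chart \<Rightarrow> ('a, 'e) chart \<Rightarrow> 'e \<Rightarrow> 'e" where
  "transition c c' = snd c' \<circ> inv_into (fst c) (snd c)"

text \<open>The smooth structure is given by an arbitrary (not necessarily maximal) smooth atlas \<open>A\<close>.
  The dimension of the manifold is \<open>DIM('e)\<close>.\<close>

definition smooth_manifold ::
  "'a topology \<Rightarrow> ('a, 'e::euclidean_space) chart set \<Rightarrow> bool" where
  "smooth_manifold M A \<longleftrightarrow> Hausdorff_space M \<and> second_countable M \<and>
     (\<forall>c\<in>A. is_chart M c) \<and> (\<Union>c\<in>A. fst c) = topspace M \<and>
     (\<forall>c\<in>A. \<forall>c'\<in>A. smooth_on (overlap c c') (transition c c'))"


section \<open>Multilinear algebra\<close>

text \<open>Elements of the \<open>k\<close>-th exterior power of the dual of \<open>'v\<close>: alternating \<open>k\<close>-linear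
  functions, encoded as functions on lists that vanish on lists of length other than \<open>k\<close>.\<close>

definition alternating_form :: "nat \<Rightarrow> ('v::real_vector list \<Rightarrow> real) \<Rightarrow> bool" where
  "alternating_form k f \<longleftrightarrow>
     (\<forall>vs. length vs \<noteq> k \<longrightarrow> f vs = 0) \<and>
     (\<forall>vs i. length vs = k \<and> i < k \<longrightarrow> linear (\<lambda>v. f (vs[i := v]))) \<and>
     (\<forall>vs. length vs = k \<and> \<not> distinct vs \<longrightarrow> f vs = 0)"

text \<open>The sum over subsets \<open>I\<close> is the sum over shuffles: the arguments in the positions \<open>I\<close> go
  to \<open>f\<close>, the others to \<open>g\<close>. No factorials occur, so that
  \<open>(f\<^sub>1 \<and> \<dots> \<and> f\<^sub>k)(v\<^sub>1, \<dots>, v\<^sub>k) = det (f\<^sub>i v\<^sub>j)\<close> for 1-forms.\<close>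

definition shuffle_sign :: "nat \<Rightarrow> nat set \<Rightarrow> real" where
  "shuffle_sign m I = (- 1) ^ card {(i, j). i \<in> I \<and> j \<in> {..<m} - I \<and> j < i}"

definition wedge_alt ::
  "('v list \<Rightarrow> real) \<Rightarrow> ('v list \<Rightarrow> real) \<Rightarrow> 'v list \<Rightarrow> real" where
  "wedge_alt f g vs = (\<Sum>I\<in>Pow {..<length vs}.
     shuffle_sign (length vs) I * f (nths vs I) * g (nths vs (- I)))"

text \<open>The map \<open>X \<mapsto> \<iota>\<^sub>X w\<close> for a 2-form \<open>w\<close> on a vector space. Covectors are elements of
  \<^typ>\<open>'e \<Rightarrow>\<^sub>L real\<close>, so that a \<open>k\<close>-vector on \<open>'e\<close> is an alternating \<open>k\<close>-form in covectors.\<close>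

definition flat :: "('e::euclidean_space list \<Rightarrow> real) \<Rightarrow> 'e \<Rightarrow> ('e \<Rightarrow>\<^sub>L real)" where
  "flat w X = Blinfun (\<lambda>u. w [X, u])"

text \<open>Its extension to an algebra homomorphism from multivectors to forms. It sends
  \<open>P = X\<^sub>1 \<and> \<dots> \<and> X\<^sub>k\<close> to the form with value
  \<open>det (w(X\<^sub>i, v\<^sub>j)) = (-1)\<^sup>k det ((flat w v\<^sub>j) X\<^sub>i) = (-1)\<^sup>k P(flat w v\<^sub>1, \<dots>, flat w v\<^sub>k)\<close> at
  \<open>(v\<^sub>1, \<dots>, v\<^sub>k)\<close>.\<close>

definition flat_ext ::
  "('e::euclidean_space list \<Rightarrow> real) \<Rightarrow> (('e \<Rightarrow>\<^sub>L real) list \<Rightarrow> real) \<Rightarrow> 'e list \<Rightarrow> real" where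
  "flat_ext w P vs = (- 1) ^ length vs * P (map (flat w) vs)"

text \<open>Contraction with a bivector \<open>P = \<Sum>\<^bsub>b<c\<^esub> P(b*, c*) b \<and> c\<close>, where \<open>b*\<close> is the dual basis
  vector of \<open>b\<close>, with the convention \<open>\<iota>\<^bsub>X \<and> Y\<^esub> f = f(X, Y, \<dots>)\<close>.\<close>

definition contract2 ::
  "(('e::euclidean_space \<Rightarrow>\<^sub>L real) list \<Rightarrow> real) \<Rightarrow> ('e list \<Rightarrow> real) \<Rightarrow> 'e list \<Rightarrow> real" where
  "contract2 P f vs = (1 / 2) * (\<Sum>b\<in>Basis. \<Sum>c\<in>Basis.
     P [blinfun_inner_left b, blinfun_inner_left c] * f (b # c # vs))"


section \<open>Differential forms and de Rham cohomology\<close>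

text \<open>A differential form on \<open>M\<close> is a family of forms on the images of the charts that agree
  under pullback along the transition maps. The local form in the chart \<open>c\<close> is \<open>\<alpha> c\<close>, with value
  \<open>\<alpha> c x\<close> at \<open>x\<close>; for extensionality, \<open>\<alpha> c x\<close> is zero unless \<open>c\<close> belongs to the atlas and
  \<open>x\<close> to the image of \<open>c\<close>.\<close>

type_synonym ('a, 'e) form = "('a, 'e) chart \<Rightarrow> 'e \<Rightarrow> 'e list \<Rightarrow> real"

definition in_domain :: "('a, 'e) chart set \<Rightarrow> ('a, 'e) chart \<Rightarrow> 'e \<Rightarrow> bool" where
  "in_domain A c x \<longleftrightarrow> c \<in> A \<and> x \<in> chart_image c"

definition forms :: "('a, 'e::euclidean_space) chart set \<Rightarrow> nat \<Rightarrow> ('a, 'e) form set" where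
  "forms A k = {\<alpha>.
     (\<forall>c x vs. \<not> in_domain A c x \<longrightarrow> \<alpha> c x vs = 0) \<and>
     (\<forall>c x. in_domain A c x \<longrightarrow> alternating_form k (\<alpha> c x)) \<and>
     (\<forall>c\<in>A. \<forall>vs. smooth_on (chart_image c) (\<lambda>x. \<alpha> c x vs)) \<and>
     (\<forall>c\<in>A. \<forall>c'\<in>A. \<forall>x\<in>overlap c c'. \<forall>vs.
        \<alpha> c x vs = \<alpha> c' (transition c c' x)
          (map (frechet_derivative (transition c c') (at x)) vs))}"

definition zero_form :: "('a, 'e) form" where
  "zero_form = (\<lambda>c x vs. 0)"

definition diff_form :: "('a, 'e) form \<Rightarrow> ('a, 'e) form \<Rightarrow> ('a, 'e) form" where
  "diff_form \<alpha> \<beta> = (\<lambda>c x vs. \<alpha> c x vs - \<beta> c x vs)"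

definition wedge :: "('a, 'e) form \<Rightarrow> ('a, 'e) form \<Rightarrow> ('a, 'e) form" where
  "wedge \<alpha> \<beta> = (\<lambda>c x. wedge_alt (\<alpha> c x) (\<beta> c x))"

definition unit_form :: "('a, 'e) chart set \<Rightarrow> ('a, 'e) form" where
  "unit_form A = (\<lambda>c x vs. if in_domain A c x \<and> vs = [] then 1 else 0)"

primrec wedge_power ::
  "('a, 'e) chart set \<Rightarrow> ('a, 'e) form \<Rightarrow> nat \<Rightarrow> ('a, 'e) form" where
  "wedge_power A \<alpha> 0 = unit_form A"
| "wedge_power A \<alpha> (Suc j) = wedge (wedge_power A \<alpha> j) \<alpha>"

text \<open>\<open>(d\<alpha>)(v\<^sub>0, \<dots>, v\<^sub>k) = \<Sum>\<^sub>i (-1)\<^sup>i D\<^bsub>v\<^sub>i\<^esub> (\<alpha>(v\<^sub>0, \<dots>, omit v\<^sub>i, \<dots>, v\<^sub>k))\<close> for constant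
  vectors \<open>v\<^sub>i\<close>, in each chart.\<close>

definition ext_d ::
  "('a, 'e::euclidean_space) chart set \<Rightarrow> ('a, 'e) form \<Rightarrow> ('a, 'e) form" where
  "ext_d A \<alpha> = (\<lambda>c x vs. if in_domain A c x
     then \<Sum>i<length vs. (- 1) ^ i *
       frechet_derivative (\<lambda>y. \<alpha> c y (take i vs @ drop (Suc i) vs)) (at x) (vs ! i)
     else 0)"

definition closed_forms :: "('a, 'e::euclidean_space) chart set \<Rightarrow> nat \<Rightarrow> ('a, 'e) form set" where
  "closed_forms A k = {\<alpha> \<in> forms A k. ext_d A \<alpha> = zero_form}"

primrec exact_forms :: "('a, 'e::euclidean_space) chart set \<Rightarrow> nat \<Rightarrow> ('a, 'e) form set" where
  "exact_forms A 0 = {zero_form}"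
| "exact_forms A (Suc k) = ext_d A ` forms A k"

definition cohomologous ::
  "('a, 'e::euclidean_space) chart set \<Rightarrow> nat \<Rightarrow> (('a, 'e) form \<times> ('a, 'e) form) set" where
  "cohomologous A k = {(\<alpha>, \<beta>). \<alpha> \<in> closed_forms A k \<and> \<beta> \<in> closed_forms A k \<and>
     diff_form \<alpha> \<beta> \<in> exact_forms A k}"

definition de_Rham :: "('a, 'e::euclidean_space) chart set \<Rightarrow> nat \<Rightarrow> ('a, 'e) form set set" where
  "de_Rham A k = closed_forms A k // cohomologous A k"

definition de_Rham_class ::
  "('a, 'e::euclidean_space) chart set \<Rightarrow> nat \<Rightarrow> ('a, 'e) form \<Rightarrow> ('a, 'e) form set" where
  "de_Rham_class A k \<alpha> = cohomologous A k `` {\<alpha>}"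


section \<open>Symplectic manifolds\<close>

definition nondegenerate ::
  "('a, 'e::euclidean_space) chart set \<Rightarrow> ('a, 'e) form \<Rightarrow> bool" where
  "nondegenerate A \<omega> \<longleftrightarrow>
     (\<forall>c x u. in_domain A c x \<and> (\<forall>v. \<omega> c x [u, v] = 0) \<longrightarrow> u = 0)"

definition symplectic_manifold ::
  "'a topology \<Rightarrow> ('a, 'e::euclidean_space) chart set \<Rightarrow> ('a, 'e) form \<Rightarrow> bool" where
  "symplectic_manifold M A \<omega> \<longleftrightarrow>
     smooth_manifold M A \<and> \<omega> \<in> closed_forms A 2 \<and> nondegenerate A \<omega>"

text \<open>The map \<open>L\<^bsup>n-k\<^esup>\<close> from degree \<open>k\<close> to degree \<open>2n - k\<close> on cohomology. As usual for maps
  between quotients, it is the union of the classes \<open>[\<alpha> \<and> \<omega>\<^bsup>n-k\<^esup>]\<close> over the representatives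
  \<open>\<alpha>\<close> of the argument; these classes coincide since \<open>\<omega>\<close> is closed.\<close>

definition Lefschetz_map ::
  "('a, 'e::euclidean_space) chart set \<Rightarrow> ('a, 'e) form \<Rightarrow> nat \<Rightarrow> nat \<Rightarrow>
     ('a, 'e) form set \<Rightarrow> ('a, 'e) form set" where
  "Lefschetz_map A \<omega> n k C =
     (\<Union>\<alpha>\<in>C. de_Rham_class A (2 * n - k) (wedge \<alpha> (wedge_power A \<omega> (n - k))))"

definition Lefschetz ::
  "('a, 'e::euclidean_space) chart set \<Rightarrow> ('a, 'e) form \<Rightarrow> nat \<Rightarrow> nat \<Rightarrow> bool" where
  "Lefschetz A \<omega> n s \<longleftrightarrow>
     (\<forall>k\<le>s. Lefschetz_map A \<omega> n k ` de_Rham A k = de_Rham A (2 * n - k))"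

text \<open>The bivector field \<open>G = - flat\<^sup>-\<^sup>1(\<omega>)\<close>.\<close>

definition dual_bivector ::
  "('a, 'e::euclidean_space) form \<Rightarrow> ('a, 'e) chart \<Rightarrow> 'e \<Rightarrow> ('e \<Rightarrow>\<^sub>L real) list \<Rightarrow> real" where
  "dual_bivector \<omega> c x \<zeta>s =
     - inv_into {P. alternating_form 2 P} (flat_ext (\<omega> c x)) (\<omega> c x) \<zeta>s"

definition contract_G ::
  "('a, 'e::euclidean_space) form \<Rightarrow> ('a, 'e) form \<Rightarrow> ('a, 'e) form" where
  "contract_G \<omega> \<alpha> = (\<lambda>c x. contract2 (dual_bivector \<omega> c x) (\<alpha> c x))"

definition koszul_d ::
  "('a, 'e::euclidean_space) chart set \<Rightarrow> ('a, 'e) form \<Rightarrow> ('a, 'e) form \<Rightarrow> ('a, 'e) form" where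
  "koszul_d A \<omega> \<alpha> = diff_form (contract_G \<omega> (ext_d A \<alpha>)) (ext_d A (contract_G \<omega> \<alpha>))"

definition harmonic ::
  "('a, 'e::euclidean_space) chart set \<Rightarrow> ('a, 'e) form \<Rightarrow> ('a, 'e) form \<Rightarrow> bool" where
  "harmonic A \<omega> \<alpha> \<longleftrightarrow> ext_d A \<alpha> = zero_form \<and> koszul_d A \<omega> \<alpha> = zero_form"

definition de_Rham_hr ::
  "('a, 'e::euclidean_space) chart set \<Rightarrow> ('a, 'e) form \<Rightarrow> nat \<Rightarrow> ('a, 'e) form set set" where
  "de_Rham_hr A \<omega> k = {C \<in> de_Rham A k. \<exists>\<alpha>\<in>C. harmonic A \<omega> \<alpha>}"

end

theory Submission
  imports Defs "HOL-Library.Function_Algebras"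
begin

text \<open>
  Write \<open>L \<alpha> = \<alpha> \<and> \<omega>\<close> and \<open>\<Lambda> = - \<iota>\<^sub>G\<close>. Since \<open>\<delta> = [\<iota>\<^sub>G, d]\<close>, a form \<open>\<alpha>\<close> is harmonic iff
  \<open>d \<alpha> = 0\<close> and \<open>d (\<Lambda> \<alpha>) = 0\<close>. The theorem follows from four facts about the graded space of forms:
  \<open>d\<^sup>2 = 0\<close>; \<open>d L = L d\<close> because \<open>\<omega>\<close> is closed; \<open>\<Lambda> L - L \<Lambda> = n - k\<close> on \<open>k\<close>-forms; and forms of
  degree above \<open>2n\<close> vanish.

  The commutation relation makes \<open>L\<^bsup>n-k\<^esup>\<close> a bijection from \<open>k\<close>-forms to \<open>(2n-k)\<close>-forms for \<open>k \<le> n\<close>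
  (\<open>L_pow_inj\<close>, \<open>L_pow_surj\<close>) and makes a \<open>k\<close>-form killed by \<open>L\<^bsup>n-k+1\<^esup>\<close> primitive, that is, killed
  by \<open>\<Lambda>\<close> (\<open>primitive_Lam\<close>). The preimage is produced by an expression in \<open>L\<close> and \<open>\<Lambda>\<close>, so it is again
  a smooth form on the manifold and no pointwise inverse has to be glued.

  (iii) implies (i): if \<open>L\<^bsup>n-k\<^esup> \<alpha>\<close> is harmonic then \<open>\<alpha>\<close> is closed. Indeed \<open>d \<alpha>\<close> is killed by \<open>L\<^bsup>n-k\<^esup>\<close>, and
  \<open>d \<Lambda> L\<^bsup>n-k\<^esup> \<alpha> = 0\<close> expands to \<open>L\<^bsup>n-k\<^esup> d \<Lambda> \<alpha> + (n-k) L\<^bsup>n-k-1\<^esup> d \<alpha> = 0\<close>. Applying \<open>L\<close> once more and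
  using injectivity gives \<open>d \<Lambda> \<alpha> = 0\<close>, and then \<open>d \<alpha> = 0\<close> (\<open>harmonic_high_descends\<close>). So every
  class that has a harmonic representative is in the image of the Lefschetz map.

  (i) implies (ii): by induction on \<open>k \<le> s + 2\<close> every class \<open>[a]\<close> of degree \<open>k\<close> has a harmonic
  representative. Surjectivity of the Lefschetz map in degree \<open>k - 2\<close> yields \<open>b\<close>, harmonic by
  induction, such that \<open>L\<^bsup>n-k+1\<^esup> (a - L b)\<close> is exact, say equal to \<open>d L\<^bsup>n-k+1\<^esup> c\<close>. Then \<open>a - L b - d c\<close> is
  closed and primitive, hence harmonic, and so is \<open>L b\<close>
  (\<open>harmonic_representable_low\<close>). In degree \<open>2n - k\<close> one applies \<open>L\<^bsup>n-k\<^esup>\<close> to a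
  harmonic representative of a preimage under the Lefschetz map.

  What remains is to establish the four facts, and that \<open>L\<close>, \<open>\<Lambda>\<close> and \<open>d\<close> map forms to forms. The
  identities between alternating forms and the properties of \<open>d\<close> are proved by induction on the
  argument list: the wedge product is an antiderivation for \<open>\<iota>\<^sub>v\<close>, and \<open>\<iota>\<^sub>v d = D\<^sub>v - d \<iota>\<^sub>v\<close> for a constant
  vector \<open>v\<close>. The commutation relation reduces to the fact that \<open>\<Sum>\<^sub>b b* \<and> \<iota>\<^sub>b\<close> multiplies a \<open>k\<close>-form
  by \<open>k\<close> (\<open>Euler_identity\<close>, \<open>matrix_contract_wedge_commutator\<close>). Smoothness of \<open>\<Lambda> \<alpha>\<close> is smoothness
  of an inverse matrix, and compatibility of \<open>d\<close> with the transition maps rests on the symmetry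
  of second derivatives (\<open>local_d_natural\<close>).
\<close>

section \<open>Real-valued functions as a vector space\<close>

instantiation "fun" :: (type, scaleR) scaleR
begin
definition scaleR_fun_def: "r *\<^sub>R f = (\<lambda>x. r *\<^sub>R f x)"
instance ..
end

lemma scaleR_fun_apply [simp]: "(r *\<^sub>R f) x = r *\<^sub>R f x"
  by (simp add: scaleR_fun_def)

instance "fun" :: (type, real_vector) real_vector
  by standard (simp_all add: fun_eq_iff scaleR_add_right scaleR_add_left)

lemma sum_fun_apply: "(\<Sum>i\<in>I. f i) x = (\<Sum>i\<in>I. f i x)"
  by (induction I rule: infinite_finite_induct) simp_all

section \<open>Lefschetz decomposition in a graded module\<close>

text \<open>The raising operator \<open>L\<close>, the lowering operator \<open>\<Lambda>\<close> and the degree generate an action of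
  \<open>sl\<^sub>2\<close>: on \<open>V k\<close> the commutator \<open>[\<Lambda>, L]\<close> is the scalar \<open>n - k\<close>. Working with the subspaces
  \<open>V k\<close> of one vector space allows \<open>V k\<close> to be the space of all smooth \<open>k\<close>-forms.\<close>

locale lefschetz_module =
  fixes V :: "nat \<Rightarrow> 'v::real_vector set" and L \<Lambda> :: "'v \<Rightarrow> 'v" and n :: nat
  assumes subspace_V: "subspace (V k)"
    and linear_L: "linear L" and linear_Lam: "linear \<Lambda>"
    and L_V: "x \<in> V k \<Longrightarrow> L x \<in> V (k + 2)"
    and Lam_V: "x \<in> V (k + 2) \<Longrightarrow> \<Lambda> x \<in> V k"
    and Lam_low: "x \<in> V k \<Longrightarrow> k < 2 \<Longrightarrow> \<Lambda> x = 0"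
    and V_top: "x \<in> V k \<Longrightarrow> 2 * n < k \<Longrightarrow> x = 0"
    and Lam_L: "x \<in> V k \<Longrightarrow> \<Lambda> (L x) = L (\<Lambda> x) + (real n - real k) *\<^sub>R x"
begin

lemmas L_simps = linear_add[OF linear_L] linear_diff[OF linear_L] linear_scale[OF linear_L]
  linear_0[OF linear_L]

lemmas Lam_simps = linear_add[OF linear_Lam] linear_diff[OF linear_Lam] linear_scale[OF linear_Lam]
  linear_0[OF linear_Lam]

lemma linear_L_pow: "linear (L ^^ m)"
proof (induction m)
  case 0
  show ?case by (simp add: linear_id[unfolded id_def] id_def)
next
  case (Suc m)
  then show ?case using linear_compose[OF Suc linear_L] by (simp add: o_def)
qed

lemma linear_Lam_pow: "linear (\<Lambda> ^^ m)"
proof (induction m)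
  case 0
  show ?case by (simp add: linear_id[unfolded id_def] id_def)
next
  case (Suc m)
  then show ?case using linear_compose[OF Suc linear_Lam] by (simp add: o_def)
qed

lemmas L_pow_simps = linear_add[OF linear_L_pow] linear_diff[OF linear_L_pow]
  linear_scale[OF linear_L_pow] linear_0[OF linear_L_pow]

lemmas Lam_pow_simps = linear_scale[OF linear_Lam_pow] linear_0[OF linear_Lam_pow]

lemma L_pow_V: "x \<in> V k \<Longrightarrow> (L ^^ m) x \<in> V (k + 2 * m)"
proof (induction m)
  case (Suc m)
  from L_V[OF Suc.IH[OF Suc.prems]] show ?case by simp
qed simp

lemma Lam_pow_V: "x \<in> V (k + 2 * m) \<Longrightarrow> (\<Lambda> ^^ m) x \<in> V k"
proof (induction m arbitrary: k)
  case (Suc m)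
  have "(\<Lambda> ^^ m) x \<in> V (k + 2)" using Suc.prems by (intro Suc.IH) simp
  then show ?case using Lam_V by simp
qed simp

lemma L_pow_eq_0_mono: "(L ^^ m) x = 0 \<Longrightarrow> m \<le> m' \<Longrightarrow> (L ^^ m') x = 0"
  by (metis L_pow_simps(4) add.commute comp_apply funpow_add le_Suc_ex)

text \<open>Moving \<open>\<Lambda>\<close> through \<open>m + 1\<close> factors \<open>L\<close> picks up the scalars \<open>n - k - 2i\<close> for \<open>i = 0, \<dots>, m\<close>, whose
  sum is \<open>(m + 1) (n - k - m)\<close>.\<close>

lemma Lam_L_pow:
  assumes x: "x \<in> V k"
  shows "\<Lambda> ((L ^^ Suc m) x) =
    (L ^^ Suc m) (\<Lambda> x) + ((real m + 1) * (real n - real k - real m)) *\<^sub>R (L ^^ m) x"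
proof (induction m)
  case 0
  show ?case using Lam_L[OF x] by simp
next
  case (Suc m)
  have "\<Lambda> ((L ^^ Suc (Suc m)) x) = L (\<Lambda> ((L ^^ Suc m) x)) +
      (real n - real (k + 2 * Suc m)) *\<^sub>R (L ^^ Suc m) x"
    using Lam_L[OF L_pow_V[OF x, of "Suc m"]] by simp
  also have "\<dots> = (L ^^ Suc (Suc m)) (\<Lambda> x) +
      ((real m + 1) * (real n - real k - real m)) *\<^sub>R (L ^^ Suc m) x +
      (real n - real (k + 2 * Suc m)) *\<^sub>R (L ^^ Suc m) x"
    unfolding Suc.IH by (simp add: L_simps)
  also have "\<dots> = (L ^^ Suc (Suc m)) (\<Lambda> x) +
      ((real m + 1) * (real n - real k - real m) + (real n - real (k + 2 * Suc m))) *\<^sub>R (L ^^ Suc m) x"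
    by (simp only: scaleR_add_left add.assoc)
  also have "(real m + 1) * (real n - real k - real m) + (real n - real (k + 2 * Suc m)) =
     (real (Suc m) + 1) * (real n - real k - real (Suc m))"
    by (simp add: algebra_simps)
  finally show ?case .
qed

text \<open>The mirror image of the preceding formula, with \<open>L\<close> moved through the powers of \<open>\<Lambda>\<close>. As \<open>L x = 0\<close>,
  only the scalar term remains.\<close>

lemma L_Lam_pow:
  assumes x: "x \<in> V (n + p)" and Lx: "L x = 0" and m: "m < p"
  shows "L ((\<Lambda> ^^ Suc m) x) = ((real m + 1) * (real p - real m)) *\<^sub>R (\<Lambda> ^^ m) x"
  using m
proof (induction m)
  case 0
  show ?case using Lam_L[OF x] by (simp add: Lx Lam_simps eq_neg_iff_add_eq_0[symmetric])
next
  case (Suc m)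
  define y where "y = (\<Lambda> ^^ Suc m) x"
  have y: "\<Lambda> (L y) = L (\<Lambda> y) + (real n - (real n + real p - 2 * real (Suc m))) *\<^sub>R y"
  \<comment> \<open>If the degree would become negative, the power of \<open>\<Lambda>\<close> vanishes and there is nothing to commute.\<close>
  proof (cases "2 * Suc m \<le> n + p")
    case True
    then have "n + p - 2 * Suc m + 2 * Suc m = n + p" by (rule le_add_diff_inverse2)
    then have "y \<in> V (n + p - 2 * Suc m)"
      unfolding y_def using x by (intro Lam_pow_V) (simp only:)
    from Lam_L[OF this] True show ?thesis by (simp add: of_nat_diff)
  next
    case False
    have "(\<Lambda> ^^ Suc m) x = 0"
    proof -
      define q where "q = (n + p) div 2"
      define r where "r = (n + p) mod 2"
      have qr: "n + p = r + 2 * q" "r < 2" by (auto simp: q_def r_def)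
      have "(\<Lambda> ^^ q) x \<in> V r" using x unfolding qr by (rule Lam_pow_V)
      then have "(\<Lambda> ^^ Suc q) x = 0" using Lam_low qr(2) by simp
      moreover have "Suc q \<le> Suc m" using False qr by auto
      ultimately show ?thesis
        by (metis Lam_pow_simps(2) comp_apply funpow_add add.commute le_Suc_ex)
    qed
    then show ?thesis by (simp add: y_def L_simps Lam_simps)
  qed
  have "L y = ((real m + 1) * (real p - real m)) *\<^sub>R (\<Lambda> ^^ m) x"
    unfolding y_def using Suc by simp
  then have "\<Lambda> (L y) = ((real m + 1) * (real p - real m)) *\<^sub>R y"
    by (simp add: y_def Lam_simps)
  then have "L (\<Lambda> y) = ((real m + 1) * (real p - real m)) *\<^sub>R y -
      (real n - (real n + real p - 2 * real (Suc m))) *\<^sub>R y"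
    using y by (simp only: eq_diff_eq)
  also have "\<dots> = ((real m + 1) * (real p - real m) + (real p - 2 * real (Suc m))) *\<^sub>R y"
    by (simp add: scaleR_diff_left[symmetric])
  also have "(real m + 1) * (real p - real m) + (real p - 2 * real (Suc m)) =
    (real (Suc m) + 1) * (real p - real (Suc m))"
    by (simp add: algebra_simps)
  finally show ?case by (simp add: y_def)
qed

text \<open>By induction \<open>\<Lambda> x = 0\<close>, since \<open>\<Lambda> x\<close> has degree \<open>k - 2\<close> and is annihilated by a power of \<open>L\<close> in the
  range of the induction hypothesis. For primitive \<open>x\<close> the commutator formula reads
  \<open>\<Lambda> L\<^bsup>m+1\<^esup> x = (m + 1) (n - k - m) L\<^bsup>m\<^esup> x\<close> with a nonzero scalar as long as \<open>m < n - k\<close>, so the factors \<open>L\<close> can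
  be removed one at a time.\<close>

lemma L_pow_inj:
  assumes "x \<in> V k" "k \<le> n" "m + k \<le> n" "(L ^^ m) x = 0"
  shows "x = 0"
  using assms
proof (induction k arbitrary: x m rule: less_induct)
  case (less k)
  have "\<Lambda> x = 0"
  proof (cases "k < 2")
    case True
    then show ?thesis using Lam_low less.prems(1) by blast
  next
    case False
    then have k: "k = (k - 2) + 2" by simp
    have 0: "(L ^^ (n - k)) x = 0"
      using less.prems by (intro L_pow_eq_0_mono[of m x "n - k"]) auto
    have "(L ^^ Suc (n - k)) (\<Lambda> x) = 0"
      using Lam_L_pow[OF less.prems(1), of "n - k"] 0 less.prems(2)
      by (simp add: Lam_simps L_simps of_nat_diff)
    then have "(L ^^ Suc (Suc (n - k))) (\<Lambda> x) = 0" by (simp add: L_simps)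
    moreover have "\<Lambda> x \<in> V (k - 2)" using less.prems(1) Lam_V k by metis
    ultimately show ?thesis
      using less.IH[of "k - 2" "\<Lambda> x" "Suc (Suc (n - k))"] False less.prems(2) by auto
  qed
  from less.prems(3,4) show ?case
  proof (induction m)
    case (Suc m)
    have "0 = ((real m + 1) * (real n - real k - real m)) *\<^sub>R (L ^^ m) x"
      using Lam_L_pow[OF less.prems(1), of m] Suc.prems(2) \<open>\<Lambda> x = 0\<close>
      by (simp add: Lam_simps L_pow_simps L_simps)
    moreover have "(real m + 1) * (real n - real k - real m) \<noteq> 0" using Suc.prems(1) by auto
    ultimately have "(L ^^ m) x = 0" by (metis scaleR_eq_0_iff)
    then show ?case using Suc by simp
  qed simp
qed

text \<open>Applying \<open>\<Lambda>\<close> to \<open>L\<^bsup>n-k+1\<^esup> x = 0\<close> produces no correction term, because its coefficient vanishes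
  exactly for this exponent. So \<open>L\<^bsup>n-k+1\<^esup> \<Lambda> x = 0\<close>, and \<open>L\<close> is injective that far on degree \<open>k - 2\<close>.\<close>

lemma primitive_Lam:
  assumes "x \<in> V k" "k \<le> n + 1" "(L ^^ (n + 1 - k)) x = 0"
  shows "\<Lambda> x = 0"
proof (cases "k < 2 \<or> k = n + 1")
  case True
  then show ?thesis using Lam_low assms Lam_simps(4) by auto
next
  case False
  then have k: "k = (k - 2) + 2" "k \<le> n" using assms(2) by auto
  have "n + 1 - k = Suc (n - k)" using k by simp
  then have "(L ^^ Suc (n - k)) (\<Lambda> x) = 0"
    using Lam_L_pow[OF assms(1), of "n - k"] assms(3) k(2) by (simp add: Lam_simps of_nat_diff)
  then show ?thesis
    using L_pow_inj[of "\<Lambda> x" "k - 2" "Suc (n - k)"] Lam_V[of x "k - 2"] assms(1) k by auto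
qed

text \<open>By induction on the degree \<open>n - p\<close> of the preimage, some \<open>z\<close> satisfies \<open>L (L\<^sup>p z) = L y\<close>, so that \<open>g = y - L\<^sup>p z\<close> is
  annihilated by \<open>L\<close>; and on such \<open>g\<close> the operator \<open>L\<^sup>p \<Lambda>\<^sup>p\<close> is multiplication by \<open>(p!)\<^sup>2\<close>.\<close>

lemma L_pow_surj:
  assumes "y \<in> V (n + p)" "p \<le> n"
  obtains x where "x \<in> V (n - p)" "(L ^^ p) x = y"
proof -
  have "\<exists>x\<in>V (n - p). (L ^^ p) x = y"
    using assms
  proof (induction "n - p" arbitrary: p y rule: less_induct)
    case less
    have LyV: "L y \<in> V (n + (p + 2))" using L_V[OF less.prems(1)] by (simp add: add.assoc)
    \<comment> \<open>A preimage of \<open>L y\<close> under \<open>L\<^bsup>p+2\<^esup>\<close> exists by induction, unless \<open>L y\<close> vanishes by having degree above \<open>2n\<close>.\<close>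
    obtain z where z: "z \<in> V (n - p)" "L ((L ^^ p) z) = L y"
    proof (cases "p + 2 \<le> n")
      case True
      then have "n - (p + 2) < n - p" by simp
      from less.hyps[OF this LyV True] obtain h
        where h: "h \<in> V (n - (p + 2))" "(L ^^ (p + 2)) h = L y" by blast
      have "L h \<in> V (n - p)" using L_V[OF h(1)] True by (simp add: Suc_diff_Suc numeral_2_eq_2)
      moreover have "L ((L ^^ p) (L h)) = L y"
        using h(2) by (simp add: funpow_swap1)
      ultimately show ?thesis using that by blast
    next
      case False
      then have "L y = 0" using V_top[OF LyV] less.prems(2) by simp
      then show ?thesis
        using that[of 0] subspace_0[OF subspace_V] by (simp add: L_pow_simps L_simps)
    qed
    define g where "g = y - (L ^^ p) z"
    have "n - p + 2 * p = n + p" using less.prems(2) by simp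
    then have "(L ^^ p) z \<in> V (n + p)" using L_pow_V[OF z(1), of p] by (simp only:)
    then have g: "g \<in> V (n + p)" "L g = 0"
      using subspace_diff[OF subspace_V less.prems(1)] z by (auto simp: g_def L_simps)
    \<comment> \<open>The scalar is the product of \<open>i (p - i + 1)\<close> for \<open>1 \<le> i \<le> q\<close>.\<close>
    have "\<exists>c. c \<noteq> 0 \<and> (L ^^ q) ((\<Lambda> ^^ q) g) = c *\<^sub>R g" if "q \<le> p" for q
      using that
    proof (induction q)
      case 0
      show ?case by (rule exI[of _ 1]) simp
    next
      case (Suc q)
      then obtain c where c: "c \<noteq> 0" "(L ^^ q) ((\<Lambda> ^^ q) g) = c *\<^sub>R g" by auto
      have "(L ^^ Suc q) ((\<Lambda> ^^ Suc q) g) = (L ^^ q) (L ((\<Lambda> ^^ Suc q) g))"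
        by (simp add: funpow_swap1)
      also have "L ((\<Lambda> ^^ Suc q) g) = ((real q + 1) * (real p - real q)) *\<^sub>R (\<Lambda> ^^ q) g"
        using L_Lam_pow[OF g] Suc.prems by simp
      finally have "(L ^^ Suc q) ((\<Lambda> ^^ Suc q) g) = ((real q + 1) * (real p - real q) * c) *\<^sub>R g"
        by (simp add: L_pow_simps c(2))
      moreover have "(real q + 1) * (real p - real q) * c \<noteq> 0" using Suc.prems c(1) by auto
      ultimately show ?case by blast
    qed
    then obtain c where c: "c \<noteq> 0" "(L ^^ p) ((\<Lambda> ^^ p) g) = c *\<^sub>R g" by blast
    have "(\<Lambda> ^^ p) g \<in> V (n - p)" using g(1) \<open>n - p + 2 * p = n + p\<close> by (intro Lam_pow_V) (simp only:)
    then have "z + (1 / c) *\<^sub>R (\<Lambda> ^^ p) g \<in> V (n - p)"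
      using z(1) subspace_V by (simp add: subspace_add subspace_scale)
    moreover have "(L ^^ p) (z + (1 / c) *\<^sub>R (\<Lambda> ^^ p) g) = y"
      using c by (simp add: L_pow_simps g_def)
    ultimately show ?case by blast
  qed
  then show thesis using that by blast
qed

end

section \<open>Harmonic representatives\<close>

text \<open>The de Rham differential does not commute with \<open>\<Lambda>\<close>; a cocycle \<open>y\<close> plays the role of a
  harmonic form when \<open>\<Lambda> y\<close> is again closed. Additivity of \<open>d\<close> is required on each \<open>V k\<close> only,
  since derivatives of non-differentiable functions are meaningless.\<close>

locale lefschetz_complex = lefschetz_module V L \<Lambda> n
  for V :: "nat \<Rightarrow> 'v::real_vector set" and L \<Lambda> :: "'v \<Rightarrow> 'v" and n :: nat +
  fixes d :: "'v \<Rightarrow> 'v"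
  assumes d_V: "x \<in> V k \<Longrightarrow> d x \<in> V (k + 1)"
    and d_add: "x \<in> V k \<Longrightarrow> y \<in> V k \<Longrightarrow> d (x + y) = d x + d y"
    and d_scale: "x \<in> V k \<Longrightarrow> d (r *\<^sub>R x) = r *\<^sub>R d x"
    and d_d: "x \<in> V k \<Longrightarrow> d (d x) = 0"
    and d_L: "x \<in> V k \<Longrightarrow> d (L x) = L (d x)"
begin

definition cocycles :: "nat \<Rightarrow> 'v set" where
  "cocycles k = {x \<in> V k. d x = 0}"

definition coboundaries :: "nat \<Rightarrow> 'v set" where
  "coboundaries k = (if k = 0 then {0} else d ` V (k - 1))"

definition harmonic_representable :: "nat \<Rightarrow> bool" where
  "harmonic_representable k \<longleftrightarrow> (\<forall>x\<in>cocycles k. \<exists>y\<in>cocycles k. x - y \<in> coboundaries k \<and> d (\<Lambda> y) = 0)"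

definition hard_Lefschetz_upto :: "nat \<Rightarrow> bool" where
  "hard_Lefschetz_upto s \<longleftrightarrow> (\<forall>k\<le>s. \<forall>y\<in>cocycles (2 * n - k). \<exists>x\<in>cocycles k.
     y - (L ^^ (n - k)) x \<in> coboundaries (2 * n - k))"

lemma d_0: "d 0 = 0"
proof -
  have "0 \<in> V 0" using subspace_0[OF subspace_V] .
  from d_scale[OF this, of 0] show ?thesis by simp
qed

lemma d_L_pow: "x \<in> V k \<Longrightarrow> d ((L ^^ m) x) = (L ^^ m) (d x)"
proof (induction m)
  case (Suc m)
  then show ?case using d_L[OF L_pow_V[OF Suc.prems, of m]] by simp
qed simp

lemma subspace_cocycles: "subspace (cocycles k)"
  unfolding cocycles_def using subspace_V[of k]
  by (auto simp: subspace_def d_0 d_add d_scale)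

lemma subspace_coboundaries: "subspace (coboundaries k)"
proof (cases k)
  case (Suc j)
  have "subspace (d ` V j)"
    unfolding subspace_def
  proof (intro conjI ballI allI)
    show "0 \<in> d ` V j" using d_0 subspace_0[OF subspace_V] by force
  next
    fix x y assume "x \<in> d ` V j" "y \<in> d ` V j"
    then obtain u v where uv: "u \<in> V j" "v \<in> V j" "x = d u" "y = d v" by blast
    then show "x + y \<in> d ` V j" using subspace_add[OF subspace_V] by (auto simp: d_add[symmetric])
  next
    fix c x assume "x \<in> d ` V j"
    then obtain u where "u \<in> V j" "x = d u" by blast
    then show "c *\<^sub>R x \<in> d ` V j" using subspace_scale[OF subspace_V] by (auto simp: d_scale[symmetric])
  qed
  then show ?thesis by (simp add: coboundaries_def Suc)
qed (simp add: coboundaries_def subspace_0 subspace_def)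

lemma coboundaries_cocycles: "coboundaries k \<subseteq> cocycles k"
proof (cases k)
  case (Suc j)
  then show ?thesis using d_V[of _ j] d_d by (auto simp: coboundaries_def cocycles_def)
qed (use subspace_0[OF subspace_cocycles] in \<open>auto simp: coboundaries_def\<close>)

lemma L_pow_cocycles: "x \<in> cocycles k \<Longrightarrow> (L ^^ m) x \<in> cocycles (k + 2 * m)"
  by (auto simp: cocycles_def L_pow_V d_L_pow L_pow_simps)

lemma L_pow_coboundaries: "x \<in> coboundaries k \<Longrightarrow> (L ^^ m) x \<in> coboundaries (k + 2 * m)"
proof (cases k)
  case (Suc j)
  assume "x \<in> coboundaries k"
  then obtain u where u: "u \<in> V j" "x = d u" by (auto simp: coboundaries_def Suc)
  then have "(L ^^ m) x = d ((L ^^ m) u)" by (simp add: d_L_pow)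
  moreover have "(L ^^ m) u \<in> V (k + 2 * m - 1)" using L_pow_V[OF u(1), of m] by (simp add: Suc)
  ultimately show ?thesis by (simp add: coboundaries_def Suc)
next
  case 0
  assume "x \<in> coboundaries k"
  then have "(L ^^ m) x = 0" using 0 by (simp add: coboundaries_def L_pow_simps)
  then show ?thesis using subspace_0[OF subspace_coboundaries] by simp
qed

text \<open>The derivative of the commutator formula; it measures how far \<open>L\<^bsup>m+1\<^esup> x\<close> is from being harmonic
  in terms of \<open>d (\<Lambda> x)\<close> and \<open>d x\<close>.\<close>

lemma d_Lam_L_pow:
  assumes x: "x \<in> V k"
  shows "d (\<Lambda> ((L ^^ Suc m) x)) =
    (L ^^ Suc m) (d (\<Lambda> x)) + ((real m + 1) * (real n - real k - real m)) *\<^sub>R (L ^^ m) (d x)"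
proof -
  have 1: "(L ^^ m) x \<in> V (k + 2 * m)" using x by (rule L_pow_V)
  have LxV: "\<Lambda> x \<in> V (k - 2)"
  proof (cases "k < 2")
    case True
    then show ?thesis using Lam_low[OF x] subspace_0[OF subspace_V] by simp
  next
    case False
    then have "k = k - 2 + 2" by simp
    then show ?thesis using Lam_V x by metis
  qed
  have 2: "(L ^^ Suc m) (\<Lambda> x) \<in> V (k + 2 * m)"
  proof (cases "k < 2")
    case True
    then show ?thesis
      using Lam_low[OF x] subspace_0[OF subspace_V] by (simp only: L_pow_simps)
  next
    case False
    then have "k - 2 + 2 * Suc m = k + 2 * m" by simp
    then show ?thesis using L_pow_V[OF LxV, of "Suc m"] by (simp only:)
  qed
  show ?thesis
    unfolding Lam_L_pow[OF x]
    by (simp only: d_add[OF 2 subspace_scale[OF subspace_V 1]] d_scale[OF 1] d_L_pow[OF x] d_L_pow[OF LxV])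
qed

lemma harmonic_L_pow:
  assumes x: "x \<in> cocycles k" and "d (\<Lambda> x) = 0"
  shows "d (\<Lambda> ((L ^^ m) x)) = 0"
proof (cases m)
  case (Suc j)
  then show ?thesis
    using d_Lam_L_pow[of x k j] assms by (simp add: cocycles_def L_pow_simps L_simps)
qed (use assms in simp)

text \<open>The Lefschetz decomposition in cohomology: modulo exact forms, a class of degree \<open>k\<close> is the sum of
  \<open>L b\<close> with \<open>b\<close> harmonic of degree \<open>k - 2\<close> and of a closed primitive form. Degrees up to \<open>s + 2\<close> are
  reached because the Lefschetz property is used in degree \<open>k - 2\<close>.\<close>

lemma harmonic_representable_low:
  assumes "hard_Lefschetz_upto s" "s + 1 \<le> n" "k \<le> s + 2"
  shows "harmonic_representable k"
  using assms(3)
proof (induction k rule: less_induct)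
  case (less k)
  show ?case
  proof (cases "k < 2")
    case True
    then show ?thesis
      unfolding harmonic_representable_def cocycles_def
      using Lam_low d_0 subspace_0[OF subspace_coboundaries, of k] by force
  next
    case False
    then obtain j where j: "k = j + 2" by (metis add.commute le_Suc_ex not_less)
    have jn: "j \<le> s" "j < n" using less.prems assms(2) j by auto
    show ?thesis
      unfolding harmonic_representable_def
    proof
      fix a assume a: "a \<in> cocycles k"
      have deg: "k + 2 * (n + 1 - k) = 2 * n - j" using jn j by simp
      have "(L ^^ (n + 1 - k)) a \<in> cocycles (2 * n - j)"
        using L_pow_cocycles[OF a, of "n + 1 - k"] deg by simp
      then obtain b where b: "b \<in> cocycles j"
        "(L ^^ (n + 1 - k)) a - (L ^^ (n - j)) b \<in> coboundaries (2 * n - j)"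
        using assms(1) jn unfolding hard_Lefschetz_upto_def by blast
      have "harmonic_representable j" using less.IH[of j] less.prems j by simp
      then obtain b' where b': "b' \<in> cocycles j" "b - b' \<in> coboundaries j" "d (\<Lambda> b') = 0"
        using b(1) unfolding harmonic_representable_def by blast
      have Lb': "L b' \<in> cocycles k" "d (\<Lambda> (L b')) = 0"
        using L_pow_cocycles[OF b'(1), of 1] harmonic_L_pow[OF b'(1,3), of 1] j by auto
      define a' where "a' = a - L b'"
      have a': "a' \<in> cocycles k" unfolding a'_def using a Lb' subspace_diff[OF subspace_cocycles] by blast
      have "n - j = Suc (n + 1 - k)" using jn j by simp
      have "(L ^^ (n + 1 - k)) a' = (L ^^ (n + 1 - k)) a - (L ^^ (n - j)) b'"
        by (simp add: a'_def L_pow_simps \<open>n - j = Suc (n + 1 - k)\<close> funpow_swap1)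
      also have "\<dots> = ((L ^^ (n + 1 - k)) a - (L ^^ (n - j)) b) + (L ^^ (n - j)) (b - b')"
        by (simp add: L_pow_simps)
      also have "\<dots> \<in> coboundaries (2 * n - j)"
      proof (rule subspace_add[OF subspace_coboundaries b(2)])
        have "j + 2 * (n - j) = 2 * n - j" using jn by simp
        then show "(L ^^ (n - j)) (b - b') \<in> coboundaries (2 * n - j)"
          using L_pow_coboundaries[OF b'(2), of "n - j"] by simp
      qed
      \<comment> \<open>An exact form \<open>d \<beta>\<close> of degree \<open>2n - k + 2\<close> has \<open>\<beta> = L\<^bsup>n-k+1\<^esup> \<gamma>\<close> with \<open>\<gamma>\<close> of degree \<open>k - 1\<close>.\<close>
      finally obtain \<beta> where \<beta>: "\<beta> \<in> V (2 * n - j - 1)" "(L ^^ (n + 1 - k)) a' = d \<beta>"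
        using jn by (auto simp: coboundaries_def split: if_splits)
      have *: "2 * n - j - 1 = n + (n + 1 - k)" "n - (n + 1 - k) = j + 1" using jn j by auto
      obtain \<gamma> where \<gamma>: "\<gamma> \<in> V (j + 1)" "(L ^^ (n + 1 - k)) \<gamma> = \<beta>"
        using L_pow_surj[of \<beta> "n + 1 - k"] \<beta>(1) * jn j by auto
      have d\<gamma>: "d \<gamma> \<in> coboundaries k" using \<gamma>(1) by (simp add: coboundaries_def j)
      have pr: "a' - d \<gamma> \<in> cocycles k"
        using subspace_diff[OF subspace_cocycles a'] d\<gamma> coboundaries_cocycles by blast
      have "(L ^^ (n + 1 - k)) (a' - d \<gamma>) = 0"
        using \<beta>(2) d_L_pow[OF \<gamma>(1), of "n + 1 - k"] \<gamma>(2) by (simp add: L_pow_simps)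
      then have "\<Lambda> (a' - d \<gamma>) = 0"
        using primitive_Lam[of "a' - d \<gamma>" k] pr jn j by (auto simp: cocycles_def)
      then have "d (\<Lambda> (L b' + (a' - d \<gamma>))) = 0"
        using Lb'(2) by (simp add: Lam_simps)
      moreover have "L b' + (a' - d \<gamma>) \<in> cocycles k" using subspace_add[OF subspace_cocycles Lb'(1) pr] .
      moreover have "a - (L b' + (a' - d \<gamma>)) \<in> coboundaries k" using d\<gamma> by (simp add: a'_def)
      ultimately show "\<exists>y\<in>cocycles k. a - y \<in> coboundaries k \<and> d (\<Lambda> y) = 0" by blast
    qed
  qed
qed

lemma harmonic_representable_high:
  assumes "hard_Lefschetz_upto s" "s + 1 \<le> n" "k \<le> s"
  shows "harmonic_representable (2 * n - k)"
  unfolding harmonic_representable_def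
proof
  fix y assume y: "y \<in> cocycles (2 * n - k)"
  then obtain x where x: "x \<in> cocycles k" "y - (L ^^ (n - k)) x \<in> coboundaries (2 * n - k)"
    using assms unfolding hard_Lefschetz_upto_def by blast
  obtain x' where x': "x' \<in> cocycles k" "x - x' \<in> coboundaries k" "d (\<Lambda> x') = 0"
    using harmonic_representable_low[of s k] assms x(1) unfolding harmonic_representable_def by auto
  have deg: "k + 2 * (n - k) = 2 * n - k" using assms by simp
  have "y - (L ^^ (n - k)) x' = (y - (L ^^ (n - k)) x) + (L ^^ (n - k)) (x - x')"
    by (simp add: L_pow_simps)
  also have "\<dots> \<in> coboundaries (2 * n - k)"
    using subspace_add[OF subspace_coboundaries x(2)] L_pow_coboundaries[OF x'(2), of "n - k"] deg by simp
  finally show "\<exists>z\<in>cocycles (2 * n - k). y - z \<in> coboundaries (2 * n - k) \<and> d (\<Lambda> z) = 0"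
    using harmonic_L_pow[OF x'(1,3)] L_pow_cocycles[OF x'(1), of "n - k"] deg by auto
qed

text \<open>Let \<open>y = L\<^bsup>m+1\<^esup> x\<close> with \<open>m + 1 = n - k\<close>. Harmonicity of \<open>y\<close> gives \<open>L\<^bsup>m+1\<^esup> d x = 0\<close> and
  \<open>L\<^bsup>m+1\<^esup> d \<Lambda> x + (m + 1) L\<^bsup>m\<^esup> d x = 0\<close>. Applying \<open>L\<close> to the second equation eliminates \<open>d x\<close>, so
  \<open>d \<Lambda> x = 0\<close> by injectivity in degree \<open>k - 1\<close>, and then \<open>d x = 0\<close> by injectivity in degree \<open>k + 1\<close>.\<close>

lemma harmonic_high_descends:
  assumes y: "y \<in> cocycles (2 * n - k)" "d (\<Lambda> y) = 0" and k: "k < n"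
  obtains x where "x \<in> cocycles k" "(L ^^ (n - k)) x = y"
proof -
  have "2 * n - k = n + (n - k)" "n - (n - k) = k" using k by auto
  then obtain x where x: "x \<in> V k" "(L ^^ (n - k)) x = y"
    using L_pow_surj[of y "n - k"] y(1) by (auto simp: cocycles_def)
  define m where "m = n - k - 1"
  have m: "n - k = Suc m" "real n - real k - real m = 1" "m + (k + 1) \<le> n"
    using k by (auto simp: m_def of_nat_diff)
  have dx: "d x \<in> V (k + 1)" using d_V x(1) .
  have top: "(L ^^ Suc m) (d x) = 0"
    using d_L_pow[OF x(1), of "Suc m"] x(2) y(1) m by (simp add: cocycles_def)
  have eq: "(L ^^ Suc m) (d (\<Lambda> x)) + (real m + 1) *\<^sub>R (L ^^ m) (d x) = 0"
    using d_Lam_L_pow[OF x(1), of m] x(2) y(2) m by simp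
  have "d (\<Lambda> x) = 0"
  proof (cases "k < 2")
    case True
    then show ?thesis using Lam_low[OF x(1)] d_0 by simp
  next
    case False
    then have "k = k - 2 + 2" by simp
    then have "\<Lambda> x \<in> V (k - 2)" using Lam_V x(1) by metis
    from d_V[OF this] have V: "d (\<Lambda> x) \<in> V (k - 1)" using False by (simp add: numeral_2_eq_2 Suc_diff_Suc)
    have "L ((L ^^ Suc m) (d (\<Lambda> x)) + (real m + 1) *\<^sub>R (L ^^ m) (d x)) = 0"
      unfolding eq by (rule L_simps(4))
    then have "(L ^^ Suc (Suc m)) (d (\<Lambda> x)) = 0"
      using top by (simp add: L_simps)
    then show ?thesis using L_pow_inj[OF V, of "Suc (Suc m)"] False m(3) by auto
  qed
  then have "(real m + 1) *\<^sub>R (L ^^ m) (d x) = 0" using eq by (simp add: L_pow_simps L_simps)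
  moreover have "real m + 1 \<noteq> 0" by linarith
  ultimately have "(L ^^ m) (d x) = 0" by (metis scaleR_eq_0_iff)
  then have "d x = 0" using L_pow_inj[OF dx, of m] m(3) by auto
  with x show thesis using that by (simp add: cocycles_def)
qed

lemma harmonic_representable_high_imp_Lefschetz:
  assumes "\<forall>k\<le>s. harmonic_representable (2 * n - k)" "s + 1 \<le> n"
  shows "hard_Lefschetz_upto s"
  unfolding hard_Lefschetz_upto_def
proof (intro allI impI ballI)
  fix k y assume "k \<le> s" and y: "y \<in> cocycles (2 * n - k)"
  then obtain z where z: "z \<in> cocycles (2 * n - k)" "y - z \<in> coboundaries (2 * n - k)" "d (\<Lambda> z) = 0"
    using assms(1) unfolding harmonic_representable_def by blast
  obtain x where "x \<in> cocycles k" "(L ^^ (n - k)) x = z"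
    using harmonic_high_descends[OF z(1,3)] \<open>k \<le> s\<close> assms(2) by auto
  with z(2) show "\<exists>x\<in>cocycles k. y - (L ^^ (n - k)) x \<in> coboundaries (2 * n - k)" by blast
qed

theorem Lefschetz_iff_harmonic_representable:
  assumes "s + 1 \<le> n"
  shows "hard_Lefschetz_upto s \<longleftrightarrow> (\<forall>k\<le>s + 2. harmonic_representable k) \<and> (\<forall>k\<le>s. harmonic_representable (2 * n - k))"
    and "hard_Lefschetz_upto s \<longleftrightarrow> (\<forall>k\<le>s. harmonic_representable (2 * n - k))"
  using harmonic_representable_low[OF _ assms] harmonic_representable_high[OF _ assms] harmonic_representable_high_imp_Lefschetz[OF _ assms] by blast+

end

section \<open>The exterior algebra\<close>

text \<open>The interior product with a vector.\<close>

definition ins :: "'v \<Rightarrow> ('v list \<Rightarrow> real) \<Rightarrow> 'v list \<Rightarrow> real" where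
  "ins v f vs = f (v # vs)"

text \<open>The grading involution. It records the sign that arises when a vector is moved past the
  arguments of \<open>f\<close>, without reference to a degree of \<open>f\<close>.\<close>

definition parity :: "('v list \<Rightarrow> real) \<Rightarrow> 'v list \<Rightarrow> real" where
  "parity f vs = (- 1) ^ length vs * f vs"

definition unit_alt :: "'v list \<Rightarrow> real" where
  "unit_alt vs = (if vs = [] then 1 else 0)"

lemma linear_ins: "linear (ins v)"
  by (rule linearI) (auto simp: ins_def fun_eq_iff)

lemma linear_parity: "linear parity"
  by (rule linearI) (auto simp: parity_def fun_eq_iff algebra_simps)

lemmas ins_simps [simp] = linear_add[OF linear_ins] linear_diff[OF linear_ins]
  linear_scale[OF linear_ins] linear_0[OF linear_ins] linear_neg[OF linear_ins]

lemmas parity_simps [simp] = linear_add[OF linear_parity] linear_diff[OF linear_parity]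
  linear_scale[OF linear_parity] linear_0[OF linear_parity] linear_neg[OF linear_parity]

lemma parity_parity [simp]: "parity (parity f) = f"
  by (auto simp: parity_def fun_eq_iff minus_one_power_iff)

lemma ins_parity [simp]: "ins v (parity f) = - parity (ins v f)"
  by (simp add: parity_def ins_def fun_eq_iff)

lemma list_fun_eqI:
  assumes "f [] = g []" "\<And>v. ins v f = ins v g"
  shows "f = g"
proof
  fix vs show "f vs = g vs"
    using assms by (cases vs) (auto simp: ins_def fun_eq_iff)
qed

text \<open>Prepending an argument that goes to the first factor creates no inversion; prepending one that
  goes to the second factor creates an inversion with each of the \<open>card J\<close> arguments of the first.\<close>

lemma shuffle_sign_insert:
  assumes J: "J \<subseteq> {..<m}"
  shows "shuffle_sign (Suc m) (insert 0 (Suc ` J)) = shuffle_sign m J"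
    and "shuffle_sign (Suc m) (Suc ` J) = (- 1) ^ card J * shuffle_sign m J"
proof -
  let ?S = "{(i, j). i \<in> J \<and> j \<in> {..<m} - J \<and> j < i}"
  let ?S' = "(\<lambda>(i, j). (Suc i, Suc j)) ` ?S"
  let ?A = "{(i, j). i \<in> insert 0 (Suc ` J) \<and> j \<in> {..<Suc m} - insert 0 (Suc ` J) \<and> j < i}"
  let ?C = "{(i, j). i \<in> Suc ` J \<and> j \<in> {..<Suc m} - Suc ` J \<and> j < i}"
  have fin: "finite J" using J finite_subset by blast
  have finS: "finite ?S"
    by (rule finite_subset[of _ "J \<times> {..<m}"]) (use fin in auto)
  have card: "card ?S' = card ?S"
    by (rule card_image) (auto simp: inj_on_def)
  have "?A = ?S'"
  proof
    show "?S' \<subseteq> ?A" by (auto simp: inj_image_mem_iff)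
    show "?A \<subseteq> ?S'"
    proof
      fix p assume p: "p \<in> ?A"
      then obtain i j where "p = (Suc i, Suc j)" "i \<in> J" "j < m" "j \<notin> J" "j < i"
        by (cases p; cases "fst p"; cases "snd p") (auto simp: inj_image_mem_iff)
      then show "p \<in> ?S'" by (intro image_eqI[of _ _ "(i, j)"]) auto
    qed
  qed
  then show "shuffle_sign (Suc m) (insert 0 (Suc ` J)) = shuffle_sign m J"
    using card unfolding shuffle_sign_def by simp
  have "?C = ?S' \<union> (\<lambda>i. (Suc i, 0)) ` J"
  proof
    show "?S' \<union> (\<lambda>i. (Suc i, 0)) ` J \<subseteq> ?C" by (auto simp: inj_image_mem_iff)
    show "?C \<subseteq> ?S' \<union> (\<lambda>i. (Suc i, 0)) ` J"
    proof
      fix p assume p: "p \<in> ?C"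
      then obtain i b where ib: "p = (Suc i, b)" "i \<in> J" by auto
      show "p \<in> ?S' \<union> (\<lambda>i. (Suc i, 0)) ` J"
      proof (cases b)
        case 0
        then show ?thesis using ib by simp
      next
        case (Suc j)
        then have "j < m" "j \<notin> J" "j < i" using p ib by auto
        then show ?thesis using ib Suc by (intro UnI1 image_eqI[of _ _ "(i, j)"]) auto
      qed
    qed
  qed
  moreover have "card (?S' \<union> (\<lambda>i. (Suc i, 0)) ` J) = card ?S' + card ((\<lambda>i. (Suc i, 0::nat)) ` J)"
    using fin finS by (intro card_Un_disjoint) auto
  moreover have "card ((\<lambda>i. (Suc i, 0::nat)) ` J) = card J"
    by (rule card_image) (simp add: inj_on_def)
  ultimately have "card ?C = card ?S + card J" using card by simp
  then show "shuffle_sign (Suc m) (Suc ` J) = (- 1) ^ card J * shuffle_sign m J"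
    unfolding shuffle_sign_def by (simp only: power_add mult.commute)
qed

lemma Pow_lessThan_Suc:
  "Pow {..<Suc m} = (\<lambda>J. insert 0 (Suc ` J)) ` Pow {..<m} \<union> (`) Suc ` Pow {..<m}"
proof -
  have "I \<in> (\<lambda>J. insert 0 (Suc ` J)) ` Pow {..<m} \<union> (`) Suc ` Pow {..<m}" if "I \<subseteq> {..<Suc m}" for I
  proof -
    define J where "J = {j. Suc j \<in> I}"
    have "J \<in> Pow {..<m}" using that by (auto simp: J_def)
    moreover have "I = (if 0 \<in> I then insert 0 (Suc ` J) else Suc ` J)"
    proof (rule set_eqI)
      fix a show "a \<in> I \<longleftrightarrow> a \<in> (if 0 \<in> I then insert 0 (Suc ` J) else Suc ` J)"
        by (cases a) (auto simp: J_def)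
    qed
    ultimately have "\<exists>J\<in>Pow {..<m}. I = insert 0 (Suc ` J) \<or> I = Suc ` J" by metis
    then show ?thesis by blast
  qed
  moreover have "insert 0 (Suc ` J) \<subseteq> {..<Suc m}" "Suc ` J \<subseteq> {..<Suc m}" if "J \<subseteq> {..<m}" for J
    using that by auto
  ultimately show ?thesis by blast
qed

lemma wedge_alt_Nil: "wedge_alt f g [] = f [] * g []"
  by (simp add: wedge_alt_def shuffle_sign_def)

text \<open>The subsets of positions in \<open>v # vs\<close> split according to whether they contain the position of \<open>v\<close>.\<close>

lemma wedge_alt_Cons:
  "wedge_alt f g (v # vs) = wedge_alt (ins v f) g vs + wedge_alt (parity f) (ins v g) vs"
proof -
  define m where "m = length vs"
  have inj: "inj_on (\<lambda>J. insert 0 (Suc ` J)) (Pow {..<m})" "inj_on ((`) Suc) (Pow {..<m})"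
    by (rule inj_on_inverseI[where g = "\<lambda>I. {j. Suc j \<in> I}"], simp add: inj_image_mem_iff)+
  have disj: "(\<lambda>J. insert 0 (Suc ` J)) ` Pow {..<m} \<inter> (`) Suc ` Pow {..<m} = {}"
  proof -
    have "insert 0 (Suc ` J) \<noteq> Suc ` K" for J K by (metis Zero_not_Suc imageE insertI1)
    then show ?thesis by blast
  qed
  let ?F = "\<lambda>I. shuffle_sign (Suc m) I * f (nths (v # vs) I) * g (nths (v # vs) (- I))"
  have len: "length (nths vs J) = card J" if "J \<in> Pow {..<m}" for J
  proof -
    have "{i. i < length vs \<and> i \<in> J} = J" using that by (auto simp: m_def)
    then show ?thesis by (simp add: length_nths)
  qed
  have "wedge_alt f g (v # vs) = sum ?F (Pow {..<Suc m})"
    by (simp add: wedge_alt_def m_def)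
  also have "\<dots> = sum ?F ((\<lambda>J. insert 0 (Suc ` J)) ` Pow {..<m}) + sum ?F ((`) Suc ` Pow {..<m})"
    unfolding Pow_lessThan_Suc using disj by (intro sum.union_disjoint) auto
  also have "\<dots> = (\<Sum>J\<in>Pow {..<m}. ?F (insert 0 (Suc ` J))) + (\<Sum>J\<in>Pow {..<m}. ?F (Suc ` J))"
    by (simp add: sum.reindex[OF inj(1)] sum.reindex[OF inj(2)])
  also have "(\<Sum>J\<in>Pow {..<m}. ?F (insert 0 (Suc ` J))) = wedge_alt (ins v f) g vs"
    unfolding wedge_alt_def m_def[symmetric]
    by (intro sum.cong refl)
      (auto simp: shuffle_sign_insert nths_Cons ins_def image_iff Compl_eq[symmetric])
  also have "(\<Sum>J\<in>Pow {..<m}. ?F (Suc ` J)) = wedge_alt (parity f) (ins v g) vs"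
    unfolding wedge_alt_def m_def[symmetric]
  proof (intro sum.cong refl)
    fix J assume J: "J \<in> Pow {..<m}"
    then show "?F (Suc ` J) = shuffle_sign m J * parity f (nths vs J) * ins v g (nths vs (- J))"
      using len[OF J]
      by (auto simp: shuffle_sign_insert nths_Cons ins_def image_iff parity_def Compl_eq[symmetric])
  qed
  finally show ?thesis .
qed

text \<open>The interior product is an antiderivation. This recursion characterises the wedge product and
  drives all inductions on argument lists below; it holds for arbitrary functions on lists.\<close>

lemma ins_wedge_alt: "ins v (wedge_alt f g) = wedge_alt (ins v f) g + wedge_alt (parity f) (ins v g)"
  by (simp add: fun_eq_iff ins_def[of v "wedge_alt f g"] wedge_alt_Cons)

lemma linear_wedge_left: "linear (\<lambda>f. wedge_alt f g)"
  by (rule linearI) (auto simp: wedge_alt_def fun_eq_iff algebra_simps sum.distrib sum_distrib_left)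

lemma linear_wedge_right: "linear (wedge_alt f)"
  by (rule linearI) (auto simp: wedge_alt_def fun_eq_iff algebra_simps sum.distrib sum_distrib_left)

lemmas wedge_alt_simps [simp] =
  linear_add[OF linear_wedge_left] linear_diff[OF linear_wedge_left] linear_0[OF linear_wedge_left]
  linear_scale[OF linear_wedge_left] linear_neg[OF linear_wedge_left]
  linear_add[OF linear_wedge_right] linear_diff[OF linear_wedge_right] linear_0[OF linear_wedge_right]
  linear_scale[OF linear_wedge_right] linear_neg[OF linear_wedge_right]

lemma parity_wedge_alt: "parity (wedge_alt f g) = wedge_alt (parity f) (parity g)"
proof
  fix vs show "parity (wedge_alt f g) vs = wedge_alt (parity f) (parity g) vs"
  proof (induction vs arbitrary: f g)
    case Nil
    show ?case by (simp add: parity_def wedge_alt_Nil)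
  next
    case (Cons v vs)
    have "parity (wedge_alt f g) (v # vs) = - parity (ins v (wedge_alt f g)) vs"
      by (simp add: parity_def ins_def)
    then show ?case by (simp add: ins_wedge_alt wedge_alt_Cons Cons.IH)
  qed
qed

text \<open>Applying \<open>\<iota>\<^sub>v\<close> to either side gives the same three terms, to each of which the induction hypothesis
  applies.\<close>

lemma wedge_alt_assoc: "wedge_alt f (wedge_alt g h) = wedge_alt (wedge_alt f g) h"
proof
  fix vs show "wedge_alt f (wedge_alt g h) vs = wedge_alt (wedge_alt f g) h vs"
  proof (induction vs arbitrary: f g h)
    case (Cons v vs)
    then show ?case by (simp add: ins_wedge_alt wedge_alt_Cons parity_wedge_alt)
  qed (simp add: wedge_alt_Nil)
qed

lemma ins_unit_alt [simp]: "ins v unit_alt = 0"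
  by (auto simp: ins_def unit_alt_def fun_eq_iff)

lemma parity_unit_alt [simp]: "parity unit_alt = unit_alt"
  by (auto simp: parity_def unit_alt_def fun_eq_iff)

lemma wedge_alt_unit: "wedge_alt f unit_alt = f"
proof
  fix vs show "wedge_alt f unit_alt vs = f vs"
    by (induction vs arbitrary: f) (simp_all add: wedge_alt_Nil wedge_alt_Cons unit_alt_def[of "[]"], simp add: ins_def)
qed

lemma wedge_alt_map: "wedge_alt f g (map h vs) = wedge_alt (\<lambda>us. f (map h us)) (\<lambda>us. g (map h us)) vs"
  by (simp add: wedge_alt_def nths_map)

lemma alternating_formD:
  assumes "alternating_form k f"
  shows "length vs \<noteq> k \<Longrightarrow> f vs = 0"
    and "length vs = k \<Longrightarrow> i < k \<Longrightarrow> linear (\<lambda>v. f (vs[i := v]))"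
    and "\<not> distinct vs \<Longrightarrow> f vs = 0"
  using assms by (auto simp: alternating_form_def)

lemma alternating_form_swap:
  assumes f: "alternating_form k f"
  shows "f (u # v # vs) = - f (v # u # vs)"
proof (cases "k = Suc (Suc (length vs))")
  case True
  have l0: "linear (\<lambda>x. f (x # b # vs))" and l1: "linear (\<lambda>x. f (b # x # vs))" for b
    using alternating_formD(2)[OF f, of "b # b # vs" 0] alternating_formD(2)[OF f, of "b # b # vs" 1] True
    by auto
  have z: "f (x # x # vs) = 0" for x using alternating_formD(3)[OF f] by simp
  have "f ((u + v) # (u + v) # vs) =
      f (u # u # vs) + f (v # u # vs) + (f (u # v # vs) + f (v # v # vs))"
    by (simp only: linear_add[OF l0] linear_add[OF l1])
  then show ?thesis unfolding z by linarith
qed (use alternating_formD(1)[OF f] in auto)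

lemma alternating_form_ins:
  assumes "alternating_form (Suc k) f"
  shows "alternating_form k (ins v f)"
  unfolding alternating_form_def ins_def
proof (intro conjI allI impI)
  fix vs :: "'a list" and i assume "length vs = k \<and> i < k"
  then show "linear (\<lambda>u. f (v # vs[i := u]))"
    using alternating_formD(2)[OF assms, of "v # vs" "Suc i"] by simp
qed (use alternating_formD(1,3)[OF assms] in auto)

lemma alternating_form_linear_hd:
  assumes "alternating_form k f"
  shows "linear (\<lambda>v. f (v # vs))"
proof (cases "k = Suc (length vs)")
  case True
  then show ?thesis using alternating_formD(2)[OF assms, of "0 # vs" 0] by simp
qed (use alternating_formD(1)[OF assms] in \<open>auto intro!: linearI\<close>)

text \<open>Vanishing on lists that start with a repeated vector implies, by polarisation, antisymmetry in the
  first two arguments. A later repetition can thereby be moved behind the head, where it is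
  handled by the alternating form \<open>\<iota>\<^sub>w f\<close>.\<close>

lemma alternating_form_SucI:
  assumes nil: "f [] = 0" and alt: "\<And>v. alternating_form k (ins v f)"
    and lin: "\<And>vs. linear (\<lambda>v. f (v # vs))" and twice: "\<And>v. ins v (ins v f) = 0"
  shows "alternating_form (Suc k) f"
  unfolding alternating_form_def
proof (intro conjI allI impI)
  fix vs :: "'a list" assume "length vs \<noteq> Suc k"
  then show "f vs = 0"
    using nil alternating_formD(1)[OF alt] by (cases vs) (auto simp: ins_def)
next
  fix vs :: "'a list" and i assume A: "length vs = Suc k \<and> i < Suc k"
  then obtain w ws where vs: "vs = w # ws" by (cases vs) auto
  show "linear (\<lambda>v. f (vs[i := v]))"
  proof (cases i)
    case 0
    then show ?thesis using lin by (simp add: vs)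
  next
    case (Suc j)
    then show ?thesis using alternating_formD(2)[OF alt, of ws j w] A by (simp add: vs ins_def)
  qed
next
  fix vs :: "'a list" assume A: "length vs = Suc k \<and> \<not> distinct vs"
  then obtain v us where vs: "vs = v # us" by (cases vs) auto
  show "f vs = 0"
  proof (cases "distinct us")
    case False
    then show ?thesis using alternating_formD(3)[OF alt, of us v] by (simp add: vs ins_def)
  next
    case True
    then have "v \<in> set us" using A vs by simp
    then obtain w ws where us: "us = w # ws" by (cases us) auto
    have z: "f (x # x # ws) = 0" for x using twice[of x] by (auto simp: ins_def fun_eq_iff)
    have l1: "linear (\<lambda>x. f (b # x # ws))" for b
      using alternating_form_linear_hd[OF alt, of b ws] by (simp add: ins_def)
    have "f ((v + w) # (v + w) # ws) =
        f (v # v # ws) + f (w # v # ws) + (f (v # w # ws) + f (w # w # ws))"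
      by (simp only: linear_add[OF lin] linear_add[OF l1])
    then have sw: "f (v # w # ws) = - f (w # v # ws)" unfolding z by linarith
    show ?thesis
    proof (cases "v = w")
      case False
      then have "\<not> distinct (v # ws)" using \<open>v \<in> set us\<close> us by simp
      then have "ins w f (v # ws) = 0" using alternating_formD(3)[OF alt] by blast
      then show ?thesis using sw by (simp add: vs us ins_def)
    qed (use z vs us in simp)
  qed
qed

lemma alternating_form_twice:
  assumes "alternating_form k f"
  shows "ins v (ins v f) = 0" "ins u (ins v f) = - ins v (ins u f)"
proof -
  show "ins v (ins v f) = 0" using alternating_formD(3)[OF assms] by (simp add: ins_def fun_eq_iff)
  show "ins u (ins v f) = - ins v (ins u f)"
    using alternating_form_swap[OF assms, of v u] by (simp add: ins_def fun_eq_iff)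
qed

lemma alternating_form_0_iff: "alternating_form 0 f \<longleftrightarrow> (\<forall>v. ins v f = 0)"
proof
  assume A: "\<forall>v. ins v f = 0"
  have "f vs = 0" if "vs \<noteq> []" for vs
    using A that by (cases vs) (auto simp: ins_def fun_eq_iff)
  then show "alternating_form 0 f" by (auto simp: alternating_form_def)
qed (auto simp: alternating_form_def ins_def fun_eq_iff)

lemma linear_zero_fun: "linear (\<lambda>x. 0)"
  by (rule linearI) auto

lemma subspace_alternating: "subspace {f. alternating_form k f}"
  unfolding subspace_def alternating_form_def
  by (auto intro: linear_compose_add linear_zero_fun
      linear_compose_scale_right[where 'b = real, unfolded real_scaleR_def])

lemmas alternating_form_add = subspace_add[OF subspace_alternating, simplified]
lemmas alternating_form_diff = subspace_diff[OF subspace_alternating, simplified]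
lemmas alternating_form_scale = subspace_scale[OF subspace_alternating, simplified]
lemmas alternating_form_0 = subspace_0[OF subspace_alternating, simplified]
lemmas alternating_form_sum = subspace_sum[OF subspace_alternating, simplified]

lemma alternating_form_parity_eq: "alternating_form k f \<Longrightarrow> parity f = (- 1) ^ k *\<^sub>R f"
  by (auto simp: parity_def fun_eq_iff alternating_form_def)

lemma alternating_form_parity: "alternating_form k f \<Longrightarrow> alternating_form k (parity f)"
  by (metis alternating_form_parity_eq alternating_form_scale)

text \<open>By induction on the total degree, with \<open>\<iota>\<^sub>v \<iota>\<^sub>v (f \<and> g) = 0\<close> because the two mixed terms cancel.\<close>

lemma alternating_form_wedge:
  assumes "alternating_form p f" "alternating_form q g"
  shows "alternating_form (p + q) (wedge_alt f g)"
  using assms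
proof (induction "p + q" arbitrary: p q f g)
  case 0
  then show ?case by (auto simp: alternating_form_0_iff ins_wedge_alt)
next
  case (Suc k)
  have lf: "linear (\<lambda>v. f (v # us))" and lg: "linear (\<lambda>v. g (v # us))" for us
    using Suc.prems by (simp_all add: alternating_form_linear_hd)
  have lin: "linear (\<lambda>v. wedge_alt f g (v # vs))" for vs
    unfolding wedge_alt_Cons
    by (rule linearI)
      (simp_all add: wedge_alt_def ins_def linear_add[OF lf] linear_add[OF lg] linear_scale[OF lf]
        linear_scale[OF lg] sum.distrib sum_distrib_left ring_distribs mult.left_commute mult.commute)
  have a1: "alternating_form k (wedge_alt (ins v f) g)" for v
  proof (cases p)
    case 0
    then have "ins v f = 0" using Suc.prems(1) alternating_form_0_iff by blast
    then show ?thesis by (simp add: alternating_form_0)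
  next
    case (Suc p')
    then show ?thesis using Suc.hyps(1)[of p' q "ins v f" g] Suc.hyps(2) Suc.prems alternating_form_ins by auto
  qed
  have a2: "alternating_form k (wedge_alt (parity f) (ins v g))" for v
  proof (cases q)
    case 0
    then have "ins v g = 0" using Suc.prems(2) alternating_form_0_iff by blast
    then show ?thesis by (simp add: alternating_form_0)
  next
    case (Suc q')
    then show ?thesis
      using Suc.hyps(1)[of p q' "parity f" "ins v g"] Suc.hyps(2) Suc.prems(2)
        alternating_form_ins[of q' g v] alternating_form_parity[OF Suc.prems(1)] by auto
  qed
  have "f [] * g [] = 0"
    using Suc.hyps(2) alternating_formD(1)[OF Suc.prems(1), of "[]"] alternating_formD(1)[OF Suc.prems(2), of "[]"]
    by (cases p) auto
  then have "alternating_form (Suc k) (wedge_alt f g)"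
    by (intro alternating_form_SucI)
      (simp_all add: wedge_alt_Nil ins_wedge_alt alternating_form_add a1 a2 lin
        alternating_form_twice(1)[OF Suc.prems(1)] alternating_form_twice(1)[OF Suc.prems(2)])
  then show ?case by (simp add: Suc.hyps(2))
qed

lemma alternating_form_Basis_expand:
  fixes f :: "'v::euclidean_space list \<Rightarrow> real"
  assumes "alternating_form k f"
  shows "f (v # vs) = (\<Sum>b\<in>Basis. (v \<bullet> b) * f (b # vs))"
proof -
  have lin: "linear (\<lambda>v. f (v # vs))" using assms by (rule alternating_form_linear_hd)
  have "f (v # vs) = f ((\<Sum>b\<in>Basis. (v \<bullet> b) *\<^sub>R b) # vs)" by (simp add: euclidean_representation)
  also have "\<dots> = (\<Sum>b\<in>Basis. (v \<bullet> b) * f (b # vs))"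
    by (simp add: linear_sum[OF lin] linear_scale[OF lin])
  finally show ?thesis .
qed

lemma alternating_form_eq_0_Basis:
  fixes f :: "'v::euclidean_space list \<Rightarrow> real"
  assumes "alternating_form k f" "\<And>vs. set vs \<subseteq> Basis \<Longrightarrow> length vs = k \<Longrightarrow> f vs = 0"
  shows "f = 0"
  using assms
proof (induction k arbitrary: f)
  case 0
  then have "f vs = 0" for vs by (cases "vs = []") (auto simp: alternating_form_def)
  then show ?case by (simp add: fun_eq_iff)
next
  case (Suc k)
  have *: "ins b f = 0" if "b \<in> Basis" for b
    using Suc.prems(2) that by (intro Suc.IH alternating_form_ins Suc.prems(1)) (auto simp: ins_def)
  show ?case
  proof
    fix vs show "f vs = 0 vs"
    proof (cases vs)
      case Nil
      then show ?thesis using alternating_formD(1)[OF Suc.prems(1)] by simp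
    next
      case (Cons v us)
      have "f (b # us) = 0" if "b \<in> Basis" for b using *[OF that] by (auto simp: ins_def fun_eq_iff)
      then show ?thesis by (simp add: Cons alternating_form_Basis_expand[OF Suc.prems(1), of v us])
    qed
  qed
qed

lemma alternating_form_top:
  fixes f :: "'v::euclidean_space list \<Rightarrow> real"
  assumes "alternating_form k f" "DIM('v) < k"
  shows "f = 0"
proof (rule alternating_form_eq_0_Basis[OF assms(1)])
  fix vs :: "'v list" assume vs: "set vs \<subseteq> Basis" "length vs = k"
  have "card (set vs) \<le> DIM('v)" using vs(1) by (intro card_mono) auto
  then have "\<not> distinct vs" using vs(2) assms(2) distinct_card[of vs] by auto
  then show "f vs = 0" using alternating_formD(3)[OF assms(1)] by blast
qed

section \<open>Smooth functions on open sets\<close>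

lemma frechet_derivative_eqI:
  "(f has_derivative f') (at x) \<Longrightarrow> frechet_derivative f (at x) v = f' v"
  by (simp add: frechet_derivative_at[symmetric])

lemma frechet_derivative_cong_open:
  assumes "open S" "x \<in> S" "\<And>y. y \<in> S \<Longrightarrow> f y = g y"
  shows "frechet_derivative f (at x) = frechet_derivative g (at x)"
proof -
  have "(f has_derivative D) (at x) \<longleftrightarrow> (g has_derivative D) (at x)" for D
    using has_derivative_transform_within_open[OF _ assms(1,2)] assms(3) by metis
  then show ?thesis by (simp add: frechet_derivative_def)
qed

lemma differentiable_cong_open:
  assumes "open S" "x \<in> S" "\<And>y. y \<in> S \<Longrightarrow> f y = g y" "f differentiable at x"
  shows "g differentiable at x"
  using assms has_derivative_transform_within_open[OF _ assms(1,2)] unfolding differentiable_def by metis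

lemma Ck_on_cong:
  assumes "open S" "\<And>x. x \<in> S \<Longrightarrow> f x = g x" "Ck_on k S f"
  shows "Ck_on k S g"
  using assms(2,3)
proof (induction k arbitrary: f g)
  case 0
  then show ?case using continuous_on_cong[of S S f g] by simp
next
  case (Suc k)
  have "Ck_on k S (\<lambda>x. frechet_derivative g (at x) v)" for v
  proof (rule Suc.IH)
    show "Ck_on k S (\<lambda>x. frechet_derivative f (at x) v)" using Suc.prems(2) by simp
  qed (use frechet_derivative_cong_open[OF assms(1)] Suc.prems(1) in metis)
  moreover have "g differentiable at x" if "x \<in> S" for x
    using differentiable_cong_open[OF assms(1) that, of f g] Suc.prems that by simp
  ultimately show ?case by simp
qed

lemma Ck_on_Suc_imp: "Ck_on (Suc k) S f \<Longrightarrow> Ck_on k S f"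
proof (induction k arbitrary: f)
  case 0
  then show ?case
    by (auto intro!: continuous_at_imp_continuous_on differentiable_imp_continuous_within)
next
  case (Suc k)
  from Suc.prems show ?case using Suc.IH by (simp only: Ck_on.simps(2)) blast
qed

lemma Ck_on_const: "Ck_on k S (\<lambda>x. c)"
  by (induction k arbitrary: c) auto

lemma differentiable_has_derivative:
  "f differentiable at x \<Longrightarrow> (f has_derivative frechet_derivative f (at x)) (at x)"
  using frechet_derivative_works by blast

lemma Ck_on_bounded_linear:
  assumes "bounded_linear h" "open S" "Ck_on k S f"
  shows "Ck_on k S (\<lambda>x. h (f x))"
  using assms(3)
proof (induction k arbitrary: f)
  case 0
  then show ?case using bounded_linear.continuous_on[OF assms(1)] by simp
next
  case (Suc k)
  have D: "((\<lambda>x. h (f x)) has_derivative (\<lambda>v. h (frechet_derivative f (at x) v))) (at x)" if "x \<in> S" for x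
    using Suc.prems that by (intro bounded_linear.has_derivative[OF assms(1)] differentiable_has_derivative) simp
  have "Ck_on k S (\<lambda>x. frechet_derivative (\<lambda>x. h (f x)) (at x) v)" for v
    by (rule Ck_on_cong[OF assms(2) _ Suc.IH[of "\<lambda>x. frechet_derivative f (at x) v"]])
      (use frechet_derivative_eqI[OF D] Suc.prems in auto)
  then show ?case using D by (auto simp: differentiable_def)
qed

lemma Ck_on_add:
  assumes "open S" "Ck_on k S f" "Ck_on k S g"
  shows "Ck_on k S (\<lambda>x. f x + g x)"
  using assms(2,3)
proof (induction k arbitrary: f g)
  case 0
  then show ?case by (simp add: continuous_on_add)
next
  case (Suc k)
  have D: "((\<lambda>x. f x + g x) has_derivative
      (\<lambda>v. frechet_derivative f (at x) v + frechet_derivative g (at x) v)) (at x)" if "x \<in> S" for x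
    using Suc.prems that by (intro has_derivative_add differentiable_has_derivative) simp_all
  have "Ck_on k S (\<lambda>x. frechet_derivative (\<lambda>x. f x + g x) (at x) v)" for v
    by (rule Ck_on_cong[OF assms(1) _ Suc.IH[of "\<lambda>x. frechet_derivative f (at x) v" "\<lambda>x. frechet_derivative g (at x) v"]])
      (use frechet_derivative_eqI[OF D] Suc.prems in auto)
  then show ?case using D by (auto simp: differentiable_def)
qed

lemma Ck_on_mult:
  fixes f g :: "'e::euclidean_space \<Rightarrow> real"
  assumes "open S" "Ck_on k S f" "Ck_on k S g"
  shows "Ck_on k S (\<lambda>x. f x * g x)"
  using assms(2,3)
proof (induction k arbitrary: f g)
  case 0
  then show ?case by (simp add: continuous_on_mult)
next
  case (Suc k)
  have D: "((\<lambda>x. f x * g x) has_derivative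
      (\<lambda>v. f x * frechet_derivative g (at x) v + frechet_derivative f (at x) v * g x)) (at x)" if "x \<in> S" for x
    using Suc.prems that by (intro has_derivative_mult differentiable_has_derivative) simp_all
  have "Ck_on k S (\<lambda>x. f x * frechet_derivative g (at x) v + frechet_derivative f (at x) v * g x)" for v
    using Suc.prems by (intro Ck_on_add[OF assms(1)] Suc.IH Ck_on_Suc_imp[of k S f] Ck_on_Suc_imp[of k S g]) auto
  then have "Ck_on k S (\<lambda>x. frechet_derivative (\<lambda>x. f x * g x) (at x) v)" for v
    by (rule Ck_on_cong[OF assms(1), rotated]) (simp add: frechet_derivative_eqI[OF D])
  then show ?case using D by (auto simp: differentiable_def)
qed

lemma Ck_on_sum:
  assumes "open S" "\<And>i. i \<in> I \<Longrightarrow> Ck_on k S (f i)"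
  shows "Ck_on k S (\<lambda>x. \<Sum>i\<in>I. f i x)"
  using assms(2) by (induction I rule: infinite_finite_induct) (auto intro: Ck_on_const Ck_on_add[OF assms(1)])

lemma smooth_onD_differentiable: "smooth_on S f \<Longrightarrow> x \<in> S \<Longrightarrow> f differentiable at x"
  unfolding smooth_on_def using Ck_on.simps(2) by blast

lemma smooth_on_derivative: "smooth_on S f \<Longrightarrow> smooth_on S (\<lambda>x. frechet_derivative f (at x) v)"
  unfolding smooth_on_def using Ck_on.simps(2) by blast

lemma smooth_on_cong: "open S \<Longrightarrow> (\<And>x. x \<in> S \<Longrightarrow> f x = g x) \<Longrightarrow> smooth_on S f \<Longrightarrow> smooth_on S g"
  unfolding smooth_on_def using Ck_on_cong by blast

lemma smooth_on_const: "smooth_on S (\<lambda>x. c)"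
  unfolding smooth_on_def using Ck_on_const by blast

lemma smooth_on_bounded_linear:
  "bounded_linear h \<Longrightarrow> open S \<Longrightarrow> smooth_on S f \<Longrightarrow> smooth_on S (\<lambda>x. h (f x))"
  unfolding smooth_on_def using Ck_on_bounded_linear by blast

lemma smooth_on_add: "open S \<Longrightarrow> smooth_on S f \<Longrightarrow> smooth_on S g \<Longrightarrow> smooth_on S (\<lambda>x. f x + g x)"
  unfolding smooth_on_def using Ck_on_add by blast

lemma smooth_on_mult:
  fixes f g :: "'e::euclidean_space \<Rightarrow> real"
  shows "open S \<Longrightarrow> smooth_on S f \<Longrightarrow> smooth_on S g \<Longrightarrow> smooth_on S (\<lambda>x. f x * g x)"
  unfolding smooth_on_def using Ck_on_mult by blast

lemma smooth_on_sum:
  "open S \<Longrightarrow> (\<And>i. i \<in> I \<Longrightarrow> smooth_on S (f i)) \<Longrightarrow> smooth_on S (\<lambda>x. \<Sum>i\<in>I. f i x)"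
  unfolding smooth_on_def by (intro allI Ck_on_sum) auto

lemma smooth_on_continuous_on: "smooth_on S f \<Longrightarrow> continuous_on S f"
  unfolding smooth_on_def using Ck_on.simps(1) by blast

section \<open>Symmetry of second derivatives\<close>

lemma has_real_derivative_along_line:
  assumes "f differentiable at (x + s *\<^sub>R u)"
  shows "((\<lambda>s. f (x + s *\<^sub>R u)) has_real_derivative frechet_derivative f (at (x + s *\<^sub>R u)) u) (at s)"
proof -
  let ?D = "frechet_derivative f (at (x + s *\<^sub>R u))"
  have D: "(f has_derivative ?D) (at (x + s *\<^sub>R u))" using assms by (rule differentiable_has_derivative)
  have "((\<lambda>s. x + s *\<^sub>R u) has_derivative (\<lambda>h. h *\<^sub>R u)) (at s)"
    by (auto intro!: derivative_eq_intros)
  from has_derivative_compose[OF this D]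
  have "((\<lambda>s. f (x + s *\<^sub>R u)) has_derivative (\<lambda>h. ?D (h *\<^sub>R u))) (at s)" .
  moreover have "?D (h *\<^sub>R u) = ?D u * h" for h
    using linear_scale[OF has_derivative_linear[OF D]] by simp
  ultimately show ?thesis by (simp add: has_field_derivative_def)
qed

text \<open>The second difference of \<open>f\<close> over a small parallelogram is symmetric in \<open>u\<close> and \<open>v\<close>; two
  applications of the mean value theorem express it by \<open>D\<^sub>v D\<^sub>u f\<close> at an intermediate point.\<close>

lemma second_difference_mean_value:
  fixes f :: "'e::euclidean_space \<Rightarrow> real"
  assumes f: "\<And>y. y \<in> S \<Longrightarrow> f differentiable at y"
    and df: "\<And>y. y \<in> S \<Longrightarrow> (\<lambda>y. frechet_derivative f (at y) u) differentiable at y"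
    and S: "\<And>s t. 0 \<le> s \<Longrightarrow> s \<le> h \<Longrightarrow> 0 \<le> t \<Longrightarrow> t \<le> h \<Longrightarrow> x + s *\<^sub>R u + t *\<^sub>R v \<in> S" and h: "0 < h"
  shows "\<exists>s t. 0 < s \<and> s < h \<and> 0 < t \<and> t < h \<and>
    f (x + h *\<^sub>R u + h *\<^sub>R v) - f (x + h *\<^sub>R u) - (f (x + h *\<^sub>R v) - f x) =
      h * (h * frechet_derivative (\<lambda>y. frechet_derivative f (at y) u) (at (x + s *\<^sub>R u + t *\<^sub>R v)) v)"
proof -
  define Du where "Du y = frechet_derivative f (at y) u" for y
  define \<phi> where "\<phi> s = f ((x + h *\<^sub>R v) + s *\<^sub>R u) - f (x + s *\<^sub>R u)" for s
  have "DERIV \<phi> s :> Du ((x + h *\<^sub>R v) + s *\<^sub>R u) - Du (x + s *\<^sub>R u)" if "0 \<le> s" "s \<le> h" for s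
    unfolding \<phi>_def Du_def
    using S[of s h] S[of s 0] that h
    by (intro derivative_intros has_real_derivative_along_line f) (simp_all add: algebra_simps)
  from MVT2[OF h this] obtain s where s: "0 < s" "s < h"
    "\<phi> h - \<phi> 0 = (h - 0) * (Du ((x + h *\<^sub>R v) + s *\<^sub>R u) - Du (x + s *\<^sub>R u))" by blast
  have "DERIV (\<lambda>t. Du ((x + s *\<^sub>R u) + t *\<^sub>R v)) t :> frechet_derivative Du (at ((x + s *\<^sub>R u) + t *\<^sub>R v)) v"
    if "0 \<le> t" "t \<le> h" for t
    using S[of s t] that s df by (intro has_real_derivative_along_line) (simp add: Du_def[abs_def])
  from MVT2[OF h this] obtain t where t: "0 < t" "t < h"
    "Du ((x + s *\<^sub>R u) + h *\<^sub>R v) - Du ((x + s *\<^sub>R u) + 0 *\<^sub>R v) =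
      (h - 0) * frechet_derivative Du (at ((x + s *\<^sub>R u) + t *\<^sub>R v)) v" by blast
  have "\<phi> h - \<phi> 0 = h * (h * frechet_derivative Du (at (x + s *\<^sub>R u + t *\<^sub>R v)) v)"
    using s(3) t(3) by (simp add: add_ac)
  then show ?thesis using s t unfolding \<phi>_def Du_def[abs_def] by (intro exI[of _ s] exI[of _ t]) (simp add: add_ac)
qed

text \<open>Both mixed derivatives take a common value at points arbitrarily close to \<open>x\<close>, and both are
  continuous.\<close>

lemma symmetric_second_derivative_real:
  fixes f :: "'e::euclidean_space \<Rightarrow> real"
  assumes S: "open S" "x \<in> S" and f: "smooth_on S f"
  shows "frechet_derivative (\<lambda>y. frechet_derivative f (at y) u) (at x) v =
    frechet_derivative (\<lambda>y. frechet_derivative f (at y) v) (at x) u"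
proof -
  define A where "A y = frechet_derivative (\<lambda>y. frechet_derivative f (at y) u) (at y) v" for y
  define B where "B y = frechet_derivative (\<lambda>y. frechet_derivative f (at y) v) (at y) u" for y
  have contA: "isCont A x" and contB: "isCont B x"
    unfolding A_def[abs_def] B_def[abs_def] using S f
    by (auto intro!: continuous_on_interior[of S] smooth_on_continuous_on smooth_on_derivative
        simp: interior_open)
  have "\<bar>A x - B x\<bar> \<le> e" if e: "e > 0" for e
  proof -
    obtain r where r: "r > 0" "ball x r \<subseteq> S" using S openE by blast
    obtain r1 where r1: "r1 > 0" "\<And>y. dist y x < r1 \<Longrightarrow> dist (A y) (A x) < e / 2"
      using contA e unfolding continuous_at_eps_delta by (metis half_gt_zero)
    obtain r2 where r2: "r2 > 0" "\<And>y. dist y x < r2 \<Longrightarrow> dist (B y) (B x) < e / 2"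
      using contB e unfolding continuous_at_eps_delta by (metis half_gt_zero)
    define \<rho> where "\<rho> = min r (min r1 r2)"
    define K where "K = norm u + norm v + 1"
    \<comment> \<open>With this side length the whole parallelogram spanned by \<open>h u\<close> and \<open>h v\<close> lies in the ball of radius \<open>\<rho>\<close>.\<close>
    define h where "h = \<rho> / (2 * K)"
    have K: "K > 0" unfolding K_def by (smt (verit) norm_ge_zero)
    have \<rho>: "\<rho> > 0" using r r1 r2 by (simp add: \<rho>_def)
    have h: "h > 0" using K \<rho> by (simp add: h_def)
    have small: "dist (x + s *\<^sub>R u + t *\<^sub>R v) x < \<rho>" if "0 \<le> s" "s \<le> h" "0 \<le> t" "t \<le> h" for s t
    proof -
      have "dist (x + s *\<^sub>R u + t *\<^sub>R v) x = norm (s *\<^sub>R u + t *\<^sub>R v)" by (simp add: dist_norm add.assoc)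
      also have "\<dots> \<le> s * norm u + t * norm v"
        using norm_triangle_ineq[of "s *\<^sub>R u" "t *\<^sub>R v"] that by simp
      also have "\<dots> \<le> h * norm u + h * norm v"
        using that by (intro add_mono mult_right_mono) auto
      also have "\<dots> \<le> h * K" using h by (simp add: K_def algebra_simps)
      also have "\<dots> = \<rho> / 2" using K by (simp add: h_def)
      finally show ?thesis using \<rho> by simp
    qed
    have inS: "x + s *\<^sub>R u + t *\<^sub>R v \<in> S" if "0 \<le> s" "s \<le> h" "0 \<le> t" "t \<le> h" for s t
      using small[OF that] r(2) by (auto simp: \<rho>_def dist_commute mem_ball subset_iff)
    have dif: "\<And>y. y \<in> S \<Longrightarrow> f differentiable at y"
      "\<And>w y. y \<in> S \<Longrightarrow> (\<lambda>y. frechet_derivative f (at y) w) differentiable at y"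
      using f smooth_onD_differentiable smooth_on_derivative by blast+
    obtain s t where st: "0 < s" "s < h" "0 < t" "t < h"
      "f (x + h *\<^sub>R u + h *\<^sub>R v) - f (x + h *\<^sub>R u) - (f (x + h *\<^sub>R v) - f x) = h * (h * A (x + s *\<^sub>R u + t *\<^sub>R v))"
      using second_difference_mean_value[of S f u h x v, OF dif(1) dif(2) inS h] unfolding A_def by blast
    have inS': "x + s *\<^sub>R v + t *\<^sub>R u \<in> S" if "0 \<le> s" "s \<le> h" "0 \<le> t" "t \<le> h" for s t
      using inS[of t s] that by (simp add: add_ac)
    obtain s' t' where st': "0 < s'" "s' < h" "0 < t'" "t' < h"
      "f (x + h *\<^sub>R v + h *\<^sub>R u) - f (x + h *\<^sub>R v) - (f (x + h *\<^sub>R u) - f x) = h * (h * B (x + s' *\<^sub>R v + t' *\<^sub>R u))"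
      using second_difference_mean_value[of S f v h x u, OF dif(1) dif(2) inS' h] unfolding B_def by blast
    have "f (x + h *\<^sub>R v + h *\<^sub>R u) = f (x + h *\<^sub>R u + h *\<^sub>R v)" by (simp add: add_ac)
    then have "h * (h * A (x + s *\<^sub>R u + t *\<^sub>R v)) = h * (h * B (x + s' *\<^sub>R v + t' *\<^sub>R u))"
      using st(5) st'(5) by linarith
    then have eq: "A (x + s *\<^sub>R u + t *\<^sub>R v) = B (x + s' *\<^sub>R v + t' *\<^sub>R u)" using h by simp
    have "dist (A (x + s *\<^sub>R u + t *\<^sub>R v)) (A x) < e / 2"
      using small[of s t] st r1(2) by (auto simp: \<rho>_def)
    moreover have "dist (B (x + s' *\<^sub>R v + t' *\<^sub>R u)) (B x) < e / 2"
      using small[of t' s'] st' r2(2) by (auto simp: \<rho>_def add_ac)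
    ultimately show ?thesis using eq unfolding dist_real_def by linarith
  qed
  then have "\<bar>A x - B x\<bar> \<le> 0" by (rule field_le_epsilon) simp
  then show ?thesis by (simp add: A_def B_def)
qed

lemma frechet_derivative_inner:
  "f differentiable at x \<Longrightarrow> frechet_derivative (\<lambda>y. f y \<bullet> b) (at x) v = frechet_derivative f (at x) v \<bullet> b"
  by (intro frechet_derivative_eqI bounded_linear.has_derivative[OF bounded_linear_inner_left] differentiable_has_derivative)

lemma symmetric_second_derivative:
  fixes T :: "'e::euclidean_space \<Rightarrow> 'f::euclidean_space"
  assumes S: "open S" "x \<in> S" and T: "smooth_on S T"
  shows "frechet_derivative (\<lambda>y. frechet_derivative T (at y) u) (at x) v =
    frechet_derivative (\<lambda>y. frechet_derivative T (at y) v) (at x) u"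
proof (rule euclidean_eqI)
  fix b :: 'f assume "b \<in> Basis"
  have *: "frechet_derivative (\<lambda>y. frechet_derivative T (at y) u) (at x) v \<bullet> b =
    frechet_derivative (\<lambda>y. frechet_derivative (\<lambda>y. T y \<bullet> b) (at y) u) (at x) v" for u v
  proof -
    have "frechet_derivative (\<lambda>y. frechet_derivative T (at y) u) (at x) v \<bullet> b =
      frechet_derivative (\<lambda>y. frechet_derivative T (at y) u \<bullet> b) (at x) v"
      using smooth_onD_differentiable[OF smooth_on_derivative[OF T] S(2)]
      by (simp add: frechet_derivative_inner)
    also have "frechet_derivative (\<lambda>y. frechet_derivative T (at y) u \<bullet> b) (at x) =
        frechet_derivative (\<lambda>y. frechet_derivative (\<lambda>y. T y \<bullet> b) (at y) u) (at x)"
      using smooth_onD_differentiable[OF T]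
      by (intro frechet_derivative_cong_open[OF S]) (simp add: frechet_derivative_inner)
    finally show ?thesis .
  qed
  show "frechet_derivative (\<lambda>y. frechet_derivative T (at y) u) (at x) v \<bullet> b =
    frechet_derivative (\<lambda>y. frechet_derivative T (at y) v) (at x) u \<bullet> b"
    unfolding * by (intro symmetric_second_derivative_real[OF S]
      smooth_on_bounded_linear[OF bounded_linear_inner_left S(1) T])
qed

section \<open>Smoothness of the inverse matrix\<close>

text \<open>Where the second factor vanishes, the product rule requires only continuity of the first one.
  This breaks the circularity in differentiating an inverse matrix by means of the resolvent identity.\<close>

lemma has_derivative_mult_vanishing:
  fixes f g :: "'e::euclidean_space \<Rightarrow> real"
  assumes f: "(f \<longlongrightarrow> f x) (at x)" and g: "(g has_derivative g') (at x)" and "g x = 0"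
  shows "((\<lambda>y. f y * g y) has_derivative (\<lambda>h. f x * g' h)) (at x)"
proof -
  obtain K where K: "\<And>h. norm (g' h) \<le> norm h * K"
    using bounded_linear.bounded[OF has_derivative_bounded_linear[OF g]] by blast
  define q where "q y = norm (g y - g x - g' (y - x)) / norm (y - x)" for y
  have q: "(q \<longlongrightarrow> 0) (at x)" using g unfolding has_derivative_iff_norm q_def by blast
  have "((\<lambda>y. (f y - f x) * g y) has_derivative (\<lambda>h. 0)) (at x)"
    unfolding has_derivative_iff_norm
  proof (intro conjI)
    have "\<forall>\<^sub>F y in at x. norm (norm ((f y - f x) * g y - (f x - f x) * g x - 0) / norm (y - x)) \<le>
        \<bar>f y - f x\<bar> * (q y + K)"
      unfolding eventually_at_filter
    proof (intro always_eventually allI impI)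
      fix y assume "y \<noteq> x"
      have "\<bar>g y\<bar> \<le> norm (g y - g x - g' (y - x)) + norm (g' (y - x))"
        using assms(3) by (simp add: abs_le_iff) linarith
      also have "\<dots> \<le> q y * norm (y - x) + norm (y - x) * K"
        using K[of "y - x"] \<open>y \<noteq> x\<close> by (simp add: q_def)
      finally have "\<bar>g y\<bar> / norm (y - x) \<le> q y + K"
        using \<open>y \<noteq> x\<close> by (simp add: divide_le_eq ring_distribs mult.commute)
      then have "\<bar>f y - f x\<bar> * (\<bar>g y\<bar> / norm (y - x)) \<le> \<bar>f y - f x\<bar> * (q y + K)"
        by (rule mult_left_mono) simp
      then show "norm (norm ((f y - f x) * g y - (f x - f x) * g x - 0) / norm (y - x)) \<le>
        \<bar>f y - f x\<bar> * (q y + K)" by (simp add: abs_mult)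
    qed
    moreover have "((\<lambda>y. \<bar>f y - f x\<bar> * (q y + K)) \<longlongrightarrow> 0) (at x)"
      using tendsto_mult[OF tendsto_rabs[OF tendsto_diff[OF f tendsto_const[of "f x"]]]
            tendsto_add[OF q tendsto_const[of K]]] by simp
    ultimately show "((\<lambda>y. norm ((f y - f x) * g y - (f x - f x) * g x - 0) / norm (y - x)) \<longlongrightarrow> 0) (at x)"
      by (rule Lim_null_comparison)
  qed (rule bounded_linear_zero)
  moreover have "((\<lambda>y. f x * g y) has_derivative (\<lambda>h. f x * g' h)) (at x)"
    using g by (intro has_derivative_mult_right)
  ultimately have "((\<lambda>y. (f y - f x) * g y + f x * g y) has_derivative (\<lambda>h. 0 + f x * g' h)) (at x)"
    by (rule has_derivative_add)
  then show ?thesis by (simp add: algebra_simps)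
qed

locale inverse_matrix_family =
  fixes S :: "'e::euclidean_space set" and I :: "'i set" and w p :: "'i \<Rightarrow> 'i \<Rightarrow> 'e \<Rightarrow> real"
  assumes open_S: "open S" and fin: "finite I"
    and left_inverse: "\<And>x b d. x \<in> S \<Longrightarrow> b \<in> I \<Longrightarrow> d \<in> I \<Longrightarrow>
      (\<Sum>c\<in>I. p b c x * w c d x) = (if b = d then 1 else 0)"
    and right_inverse: "\<And>x b d. x \<in> S \<Longrightarrow> b \<in> I \<Longrightarrow> d \<in> I \<Longrightarrow>
      (\<Sum>c\<in>I. w b c x * p c d x) = (if b = d then 1 else 0)"
begin

text \<open>The expansion of \<open>P y - P x = P y (W x - W y) P x\<close> for inverse matrices \<open>P\<close> of \<open>W\<close>.\<close>

lemma resolvent_identity: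
  assumes "x \<in> S" "y \<in> S" "b \<in> I" "d \<in> I"
  shows "p b d y = p b d x + (\<Sum>c\<in>I. \<Sum>e\<in>I. p b c y * (w c e x - w c e y) * p e d x)"
proof -
  have 1: "(\<Sum>c\<in>I. \<Sum>e\<in>I. p b c y * w c e x * p e d x) = p b d y"
  proof -
    have "(\<Sum>c\<in>I. \<Sum>e\<in>I. p b c y * w c e x * p e d x) = (\<Sum>c\<in>I. p b c y * (\<Sum>e\<in>I. w c e x * p e d x))"
      by (simp add: sum_distrib_left mult.assoc)
    also have "\<dots> = (\<Sum>c\<in>I. if c = d then p b c y else 0)"
      using assms by (intro sum.cong) (simp_all add: right_inverse)
    also have "\<dots> = p b d y" using fin assms(4) by simp
    finally show ?thesis .
  qed
  have 2: "(\<Sum>c\<in>I. \<Sum>e\<in>I. p b c y * w c e y * p e d x) = p b d x"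
  proof -
    have "(\<Sum>c\<in>I. \<Sum>e\<in>I. p b c y * w c e y * p e d x) = (\<Sum>e\<in>I. \<Sum>c\<in>I. p b c y * w c e y * p e d x)"
      by (rule sum.swap)
    also have "\<dots> = (\<Sum>e\<in>I. (\<Sum>c\<in>I. p b c y * w c e y) * p e d x)"
      by (simp add: sum_distrib_right)
    also have "\<dots> = (\<Sum>e\<in>I. if e = b then p e d x else 0)"
      using assms by (intro sum.cong) (auto simp: left_inverse)
    also have "\<dots> = p b d x" using fin assms(3) by simp
    finally show ?thesis .
  qed
  show ?thesis by (simp add: ring_distribs sum_subtractf 1 2)
qed

text \<open>The resolvent identity bounds the size \<open>N y\<close> of the inverse by \<open>N x + N y (m N x \<epsilon> y)\<close>, where \<open>\<epsilon> y\<close>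
  is the distance of the matrices. Once \<open>m N x \<epsilon> y < 1/2\<close>, this gives \<open>N y \<le> 2 N x\<close>, and the
  resolvent identity then bounds the difference of the inverses by a multiple of \<open>\<epsilon> y\<close>.\<close>

lemma tendsto_inverse_matrix:
  assumes x: "x \<in> S" and bd: "b \<in> I" "d \<in> I"
    and w: "\<And>c e. c \<in> I \<Longrightarrow> e \<in> I \<Longrightarrow> (w c e \<longlongrightarrow> w c e x) (at x)"
  shows "(p b d \<longlongrightarrow> p b d x) (at x)"
proof -
  define N where "N y = (\<Sum>b\<in>I. \<Sum>d\<in>I. \<bar>p b d y\<bar>)" for y
  define \<epsilon> where "\<epsilon> y = (\<Sum>c\<in>I. \<Sum>e\<in>I. \<bar>w c e x - w c e y\<bar>)" for y
  define m where "m = real (card I) * real (card I)"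
  have N0: "0 \<le> N y" and \<epsilon>0: "0 \<le> \<epsilon> y" for y
    unfolding N_def \<epsilon>_def by (intro sum_nonneg; simp)+
  have pN: "\<bar>p b c y\<bar> \<le> N y" if "b \<in> I" "c \<in> I" for b c y
  proof -
    have "\<bar>p b c y\<bar> \<le> (\<Sum>d\<in>I. \<bar>p b d y\<bar>)" using fin that by (intro member_le_sum) auto
    also have "\<dots> \<le> N y" unfolding N_def using fin that
      by (intro member_le_sum[of b I "\<lambda>b. \<Sum>d\<in>I. \<bar>p b d y\<bar>"]) (auto intro: sum_nonneg)
    finally show ?thesis .
  qed
  have diff: "\<bar>p b d y - p b d x\<bar> \<le> N y * \<epsilon> y * N x" if "y \<in> S" "b \<in> I" "d \<in> I" for y b d
  proof -
    have "\<bar>p b d y - p b d x\<bar> = \<bar>\<Sum>c\<in>I. \<Sum>e\<in>I. p b c y * (w c e x - w c e y) * p e d x\<bar>"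
      using resolvent_identity[OF x that] by simp
    also have "\<dots> \<le> (\<Sum>c\<in>I. \<Sum>e\<in>I. N y * \<bar>w c e x - w c e y\<bar> * N x)"
    proof (intro order_trans[OF sum_abs] sum_mono)
      fix c e assume "c \<in> I" "e \<in> I"
      then show "\<bar>p b c y * (w c e x - w c e y) * p e d x\<bar> \<le> N y * \<bar>w c e x - w c e y\<bar> * N x"
        using pN[OF that(2)] pN[OF _ that(3)] N0 by (simp add: abs_mult mult_mono)
    qed
    also have "\<dots> = N y * \<epsilon> y * N x"
      by (simp add: \<epsilon>_def sum_distrib_left sum_distrib_right)
    finally show ?thesis .
  qed
  have "(\<epsilon> \<longlongrightarrow> (\<Sum>c\<in>I. \<Sum>e\<in>I. \<bar>w c e x - w c e x\<bar>)) (at x)"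
    unfolding \<epsilon>_def by (intro tendsto_intros w)
  then have \<epsilon>: "(\<epsilon> \<longlongrightarrow> 0) (at x)" by simp
  have near: "\<forall>\<^sub>F y in at x. y \<in> S" using open_S x eventually_at_in_open' by blast
  have "((\<lambda>y. m * N x * \<epsilon> y) \<longlongrightarrow> m * N x * 0) (at x)" by (intro tendsto_intros \<epsilon>)
  then have "\<forall>\<^sub>F y in at x. m * N x * \<epsilon> y < 1 / 2" by (intro order_tendstoD(2)) auto
  then have bound: "\<forall>\<^sub>F y in at x. N y \<le> 2 * N x"
    using near
  proof eventually_elim
    case (elim y)
    have "N y \<le> (\<Sum>b\<in>I. \<Sum>d\<in>I. \<bar>p b d x\<bar> + N y * \<epsilon> y * N x)"
      unfolding N_def[of y]
    proof (intro sum_mono)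
      fix b d assume "b \<in> I" "d \<in> I"
      from diff[OF elim(2) this] show "\<bar>p b d y\<bar> \<le> \<bar>p b d x\<bar> + (\<Sum>b\<in>I. \<Sum>d\<in>I. \<bar>p b d y\<bar>) * \<epsilon> y * N x"
        unfolding N_def[of y] by linarith
    qed
    also have "\<dots> = N x + N y * (m * N x * \<epsilon> y)"
      by (simp add: sum.distrib N_def[of x] m_def)
    also have "\<dots> \<le> N x + N y * (1 / 2)"
      using elim(1) N0 by (intro add_left_mono mult_left_mono) auto
    finally show ?case by simp
  qed
  have "\<forall>\<^sub>F y in at x. norm (p b d y - p b d x) \<le> 2 * N x * \<epsilon> y * N x"
    using bound near
  proof eventually_elim
    case (elim y)
    have "N y * \<epsilon> y * N x \<le> 2 * N x * \<epsilon> y * N x"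
      using elim(1) N0 \<epsilon>0 by (intro mult_right_mono) auto
    then show ?case using diff[OF elim(2) bd] by simp
  qed
  moreover have "((\<lambda>y. 2 * N x * \<epsilon> y * N x) \<longlongrightarrow> 0) (at x)"
    using tendsto_mult[OF tendsto_mult[OF tendsto_const[of "2 * N x"] \<epsilon>] tendsto_const[of "N x"]] by simp
  ultimately have "((\<lambda>y. p b d y - p b d x) \<longlongrightarrow> 0) (at x)"
    by (rule Lim_null_comparison)
  then show ?thesis by (simp add: LIM_zero_iff)
qed

lemma has_derivative_inverse_matrix:
  assumes x: "x \<in> S" and bd: "b \<in> I" "d \<in> I"
    and w: "\<And>c e. c \<in> I \<Longrightarrow> e \<in> I \<Longrightarrow> w c e differentiable at x"
  shows "(p b d has_derivative (\<lambda>v. \<Sum>c\<in>I. \<Sum>e\<in>I. - 1 * (p b c x * frechet_derivative (w c e) (at x) v * p e d x))) (at x)"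
proof -
  have p: "(p b c \<longlongrightarrow> p b c x) (at x)" if "c \<in> I" for c
    using w that bd x
    by (intro tendsto_inverse_matrix) (auto simp: isCont_def[symmetric] differentiable_imp_continuous_within)
  have "((\<lambda>y. p b d x + (\<Sum>c\<in>I. \<Sum>e\<in>I. p b c y * (w c e x - w c e y) * p e d x)) has_derivative
      (\<lambda>v. 0 + (\<Sum>c\<in>I. \<Sum>e\<in>I. p b c x * (0 - frechet_derivative (w c e) (at x) v) * p e d x))) (at x)"
    by (intro has_derivative_add has_derivative_const has_derivative_sum has_derivative_mult_left
        has_derivative_mult_vanishing p has_derivative_diff differentiable_has_derivative w) auto
  then have "((\<lambda>y. p b d x + (\<Sum>c\<in>I. \<Sum>e\<in>I. p b c y * (w c e x - w c e y) * p e d x)) has_derivative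
      (\<lambda>v. (\<Sum>c\<in>I. \<Sum>e\<in>I. - 1 * (p b c x * frechet_derivative (w c e) (at x) v * p e d x)))) (at x)"
    by simp
  from has_derivative_transform_within_open[OF this open_S x] show ?thesis
    using resolvent_identity[OF x _ bd] by simp
qed

text \<open>The derivative \<open>- P (D W) P\<close> of the inverse is a polynomial in \<open>P\<close> and the derivatives of \<open>W\<close>, so
  the differentiability class of \<open>P\<close> can be raised one step at a time.\<close>

lemma Ck_on_inverse_matrix:
  assumes "\<And>c e. c \<in> I \<Longrightarrow> e \<in> I \<Longrightarrow> Ck_on k S (w c e)" "b \<in> I" "d \<in> I"
  shows "Ck_on k S (p b d)"
  using assms
proof (induction k arbitrary: b d)
  case 0
  have "isCont (p b d) x" if "x \<in> S" for x
    unfolding isCont_def using 0 that open_S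
    by (intro tendsto_inverse_matrix)
      (auto simp: isCont_def[symmetric] intro: continuous_on_interior[of S] simp: interior_open)
  then show ?case by (simp add: continuous_at_imp_continuous_on)
next
  case (Suc k)
  have wd: "w c e differentiable at x" if "c \<in> I" "e \<in> I" "x \<in> S" for c e x
    using Suc.prems(1)[OF that(1,2)] that(3) by auto
  have wk: "Ck_on k S (\<lambda>x. frechet_derivative (w c e) (at x) v)" if "c \<in> I" "e \<in> I" for c e v
    using Suc.prems(1)[OF that] by auto
  have D: "(p b d has_derivative (\<lambda>v. \<Sum>c\<in>I. \<Sum>e\<in>I. - 1 * (p b c x * frechet_derivative (w c e) (at x) v * p e d x))) (at x)"
    if "x \<in> S" for x
    using has_derivative_inverse_matrix[OF that Suc.prems(2,3) wd[OF _ _ that]] .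
  have p: "Ck_on k S (p b d)" if "b \<in> I" "d \<in> I" for b d
    by (rule Suc.IH[OF Ck_on_Suc_imp[OF Suc.prems(1)] that])
  have "Ck_on k S (\<lambda>x. \<Sum>c\<in>I. \<Sum>e\<in>I. - 1 * (p b c x * frechet_derivative (w c e) (at x) v * p e d x))" for v
  proof (rule Ck_on_sum[OF open_S], rule Ck_on_sum[OF open_S])
    fix c e assume "c \<in> I" "e \<in> I"
    then show "Ck_on k S (\<lambda>x. - 1 * (p b c x * frechet_derivative (w c e) (at x) v * p e d x))"
      using Ck_on_mult[OF open_S Ck_on_const[of k S "- 1"] Ck_on_mult[OF open_S Ck_on_mult[OF open_S
          p[OF Suc.prems(2)] wk] p[OF _ Suc.prems(3)]]] by blast
  qed
  then have "Ck_on k S (\<lambda>x. frechet_derivative (p b d) (at x) v)" for v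
    by (rule Ck_on_cong[OF open_S, rotated]) (simp add: frechet_derivative_eqI[OF D])
  moreover have "p b d differentiable at x" if "x \<in> S" for x
    using D[OF that] unfolding differentiable_def by blast
  ultimately show ?case by simp
qed

lemma smooth_on_inverse_matrix:
  assumes "\<And>c e. c \<in> I \<Longrightarrow> e \<in> I \<Longrightarrow> smooth_on S (w c e)" "b \<in> I" "d \<in> I"
  shows "smooth_on S (p b d)"
  using assms Ck_on_inverse_matrix unfolding smooth_on_def by blast

end

section \<open>Contraction with the dual bivector\<close>

definition nondegenerate_alt :: "('v::real_vector list \<Rightarrow> real) \<Rightarrow> bool" where
  "nondegenerate_alt w \<longleftrightarrow> alternating_form 2 w \<and> (\<forall>u. (\<forall>v. w [u, v] = 0) \<longrightarrow> u = 0)"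

lemma alternating_form_2D:
  assumes "alternating_form 2 w"
  shows "linear (\<lambda>u. w [u, v])" "linear (\<lambda>u. w [v, u])" "w [u, v] = - w [v, u]" "w [u, u] = 0"
  using alternating_form_linear_hd[OF assms, of "[v]"] alternating_form_swap[OF assms, of u v "[]"]
    alternating_formD(2)[OF assms, of "[v, v]" 1] alternating_formD(3)[OF assms, of "[u, u]"]
  by simp_all

lemma alternating_form_2I:
  fixes f :: "'a::real_vector list \<Rightarrow> real"
  assumes "\<And>v. linear (\<lambda>u. f [u, v])" "\<And>u v. f [u, v] = - f [v, u]" "\<And>vs. length vs \<noteq> 2 \<Longrightarrow> f vs = 0"
  shows "alternating_form 2 f"
  unfolding alternating_form_def
proof (intro conjI allI impI)
  have l2: "linear (\<lambda>u. f [v, u])" for v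
    using linear_compose_neg[OF assms(1)[of v]] assms(2)[of v] by simp
  fix vs :: "'a list" and i :: nat assume "length vs = 2 \<and> i < 2"
  moreover from this obtain a b where "vs = [a, b]"
    by (metis (no_types, lifting) One_nat_def Suc_1 length_0_conv length_Suc_conv)
  ultimately show "linear (\<lambda>v. f (vs[i := v]))" using assms(1) l2 by (cases i) (auto simp: less_Suc_eq)
next
  fix vs :: "'a list" assume "length vs = 2 \<and> \<not> distinct vs"
  moreover from this obtain a b where "vs = [a, b]"
    by (metis (no_types, lifting) One_nat_def Suc_1 length_0_conv length_Suc_conv)
  ultimately show "f vs = 0" using assms(2)[of a a] by simp
qed (use assms(3) in auto)

text \<open>The matrix \<open>p b c = P (b*, c*)\<close> of the bivector \<open>P\<close> with \<open>P (flat u, flat v) = w (u, v)\<close>. If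
  \<open>b* = flat u\<close>, the defining equation becomes \<open>P (b*, flat v) = b* v\<close>.\<close>

definition inverse_bivector :: "('e::euclidean_space list \<Rightarrow> real) \<Rightarrow> ('e \<Rightarrow> 'e \<Rightarrow> real) \<Rightarrow> bool" where
  "inverse_bivector w p \<longleftrightarrow> (\<forall>b\<in>Basis. \<forall>v. (\<Sum>c\<in>Basis. p b c * w [v, c]) = v \<bullet> b)
     \<and> (\<forall>b c. p b c = - p c b)"

lemma inverse_bivectorD:
  assumes "inverse_bivector w p"
  shows "b \<in> Basis \<Longrightarrow> (\<Sum>c\<in>Basis. p b c * w [v, c]) = v \<bullet> b" "p b c = - p c b"
  using assms unfolding inverse_bivector_def by blast+

text \<open>Contraction with the bivector that has the matrix \<open>p\<close>.\<close>

definition matrix_contract :: "('e::euclidean_space \<Rightarrow> 'e \<Rightarrow> real) \<Rightarrow> ('e list \<Rightarrow> real) \<Rightarrow> 'e list \<Rightarrow> real" where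
  "matrix_contract p f = (1/2) *\<^sub>R (\<Sum>b\<in>Basis. \<Sum>c\<in>Basis. p b c *\<^sub>R ins c (ins b f))"

lemma contract2_eq_matrix_contract:
  "contract2 P f = matrix_contract (\<lambda>b c. P [blinfun_inner_left b, blinfun_inner_left c]) f"
  by (simp add: contract2_def matrix_contract_def fun_eq_iff sum_fun_apply ins_def)

lemma linear_matrix_contract: "linear (matrix_contract p)"
  unfolding matrix_contract_def
  by (rule linearI)
    (simp_all add: sum.distrib scaleR_add_right scaleR_sum_right mult.commute mult.left_commute)

lemma alternating_form_matrix_contract:
  assumes "alternating_form (k + 2) f"
  shows "alternating_form k (matrix_contract p f)"
proof -
  have "alternating_form k (ins c (ins b f))" for b c
    by (intro alternating_form_ins) (use assms in simp)
  then show ?thesis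
    unfolding matrix_contract_def by (intro alternating_form_scale alternating_form_sum) auto
qed

lemma matrix_contract_low_degree:
  assumes "alternating_form k f" "k < 2"
  shows "matrix_contract p f = 0"
proof -
  have "ins c (ins b f) = 0" for b c
    using assms by (auto simp: ins_def fun_eq_iff intro!: alternating_formD(1)[OF assms(1)])
  then show ?thesis by (simp add: matrix_contract_def)
qed

lemma alternating_form_Basis_expand2:
  fixes f :: "'e::euclidean_space list \<Rightarrow> real"
  assumes "alternating_form k f"
  shows "f (u # v # vs) = (\<Sum>d\<in>Basis. \<Sum>e\<in>Basis. (u \<bullet> d) * (v \<bullet> e) * f (d # e # vs))"
proof (cases k)
  case 0
  then show ?thesis using alternating_formD(1)[OF assms] by simp
next
  case (Suc j)
  have "f (d # v # vs) = (\<Sum>e\<in>Basis. (v \<bullet> e) * f (d # e # vs))" for d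
    using alternating_form_Basis_expand[OF alternating_form_ins[of j f d], of v vs] assms Suc
    by (simp add: ins_def)
  then show ?thesis
    unfolding alternating_form_Basis_expand[OF assms, of u] by (simp add: sum_distrib_left mult.assoc)
qed

lemma nondegenerate_matrix_cancel:
  fixes w :: "'e::euclidean_space list \<Rightarrow> real"
  assumes w: "nondegenerate_alt w" and eq: "\<And>v. (\<Sum>c\<in>Basis. q c * w [v, c]) = (\<Sum>c\<in>Basis. q' c * w [v, c])"
    and c: "c \<in> Basis"
  shows "q c = q' c"
proof -
  have alt: "alternating_form 2 w" using w by (simp add: nondegenerate_alt_def)
  define y where "y = (\<Sum>c\<in>Basis. (q c - q' c) *\<^sub>R c)"
  have "w [v, y] = 0" for v
    using eq[of v] by (simp add: y_def linear_sum[OF alternating_form_2D(2)[OF alt]]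
        linear_scale[OF alternating_form_2D(2)[OF alt]] left_diff_distrib sum_subtractf)
  then have "w [y, v] = 0" for v using alternating_form_2D(3)[OF alt, of y v] by simp
  then have "y = 0" using w by (auto simp: nondegenerate_alt_def)
  then have "y \<bullet> c = 0" by simp
  then show ?thesis using c by (simp add: y_def inner_sum_left inner_Basis if_distrib sum.If_cases cong: if_cong)
qed

text \<open>The push-forward of \<open>p\<close> along \<open>T\<close> satisfies the equation that defines \<open>p'\<close>, and a nondegenerate form
  leaves only one solution. Nondegeneracy of the pullback \<open>w\<close> forces \<open>T\<close> to be injective, hence
  surjective, so every vector at which the equation has to be tested is of the form \<open>T u\<close>.\<close>

lemma matrix_contract_pullback:
  fixes w w' f :: "'e::euclidean_space list \<Rightarrow> real" and T :: "'e \<Rightarrow> 'e"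
  assumes w: "nondegenerate_alt w" and w': "nondegenerate_alt w'"
    and T: "linear T" and pull: "\<And>u v. w [u, v] = w' [T u, T v]"
    and p: "inverse_bivector w p" and p': "inverse_bivector w' p'" and f: "alternating_form k f"
  shows "matrix_contract p (\<lambda>us. f (map T us)) vs = matrix_contract p' f (map T vs)"
proof -
  have alt': "alternating_form 2 w'" using w' by (simp add: nondegenerate_alt_def)
  note lin' = alternating_form_2D(2)[OF alt']
  have "inj T"
  proof (subst linear_injective_0[OF T], intro allI impI)
    fix u assume "T u = 0"
    then have "w [u, v] = 0" for v
      using pull[of u v] linear_0[OF alternating_form_2D(1)[OF alt']] by simp
    then show "u = 0" using w by (auto simp: nondegenerate_alt_def)
  qed
  then have surj: "surj T" using T linear_injective_imp_surjective by blast
  define q where "q d e = (\<Sum>b\<in>Basis. \<Sum>c\<in>Basis. p b c * (T b \<bullet> d) * (T c \<bullet> e))" for d e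
  have q: "(\<Sum>e\<in>Basis. q d e * w' [v', e]) = v' \<bullet> d" if "d \<in> Basis" for d v'
  proof -
    obtain u where u: "v' = T u" using surj by blast
    have "w' [T u, T c] = (\<Sum>e\<in>Basis. (T c \<bullet> e) * w' [T u, e])" for c
    proof -
      have "w' [T u, T c] = w' [T u, \<Sum>e\<in>Basis. (T c \<bullet> e) *\<^sub>R e]" by (simp add: euclidean_representation)
      then show ?thesis by (simp add: linear_sum[OF lin'] linear_scale[OF lin'])
    qed
    then have wc: "(\<Sum>e\<in>Basis. (T c \<bullet> e) * w' [T u, e]) = w [u, c]" for c using pull by simp
    have "(\<Sum>e\<in>Basis. q d e * w' [v', e]) =
       (\<Sum>e\<in>Basis. \<Sum>b\<in>Basis. \<Sum>c\<in>Basis. (T b \<bullet> d) * (p b c * ((T c \<bullet> e) * w' [T u, e])))"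
      by (simp add: q_def u sum_distrib_left sum_distrib_right mult_ac)
    also have "\<dots> = (\<Sum>b\<in>Basis. \<Sum>e\<in>Basis. \<Sum>c\<in>Basis. (T b \<bullet> d) * (p b c * ((T c \<bullet> e) * w' [T u, e])))"
      by (rule sum.swap)
    also have "\<dots> = (\<Sum>b\<in>Basis. \<Sum>c\<in>Basis. \<Sum>e\<in>Basis. (T b \<bullet> d) * (p b c * ((T c \<bullet> e) * w' [T u, e])))"
      by (intro sum.cong refl sum.swap)
    also have "\<dots> = (\<Sum>b\<in>Basis. (T b \<bullet> d) * (\<Sum>c\<in>Basis. p b c * w [u, c]))"
      by (simp add: sum_distrib_left[symmetric] wc)
    also have "\<dots> = (\<Sum>b\<in>Basis. (T b \<bullet> d) * (u \<bullet> b))"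
      by (intro sum.cong refl) (simp add: inverse_bivectorD(1)[OF p])
    also have "\<dots> = T (\<Sum>b\<in>Basis. (u \<bullet> b) *\<^sub>R b) \<bullet> d"
      by (simp only: linear_sum[OF T] linear_scale[OF T] inner_sum_left inner_scaleR_left mult.commute)
    also have "\<dots> = v' \<bullet> d" by (simp add: u euclidean_representation)
    finally show ?thesis .
  qed
  have qp: "q d e = p' d e" if "d \<in> Basis" "e \<in> Basis" for d e
    using nondegenerate_matrix_cancel[OF w', of "q d" "p' d" e] q[OF that(1)]
      inverse_bivectorD(1)[OF p' that(1)] that(2) by simp
  have "(\<Sum>b\<in>Basis. \<Sum>c\<in>Basis. p b c * f (T b # T c # map T vs)) =
     (\<Sum>b\<in>Basis. \<Sum>c\<in>Basis. \<Sum>d\<in>Basis. \<Sum>e\<in>Basis.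
        p b c * (T b \<bullet> d) * (T c \<bullet> e) * f (d # e # map T vs))"
    unfolding alternating_form_Basis_expand2[OF f, of "T _"]
    by (simp add: sum_distrib_left mult.assoc)
  also have "\<dots> = (\<Sum>b\<in>Basis. \<Sum>d\<in>Basis. \<Sum>c\<in>Basis. \<Sum>e\<in>Basis.
        p b c * (T b \<bullet> d) * (T c \<bullet> e) * f (d # e # map T vs))"
    by (intro sum.cong refl sum.swap)
  also have "\<dots> = (\<Sum>d\<in>Basis. \<Sum>b\<in>Basis. \<Sum>e\<in>Basis. \<Sum>c\<in>Basis.
        p b c * (T b \<bullet> d) * (T c \<bullet> e) * f (d # e # map T vs))"
    by (subst sum.swap) (intro sum.cong refl sum.swap)
  also have "\<dots> = (\<Sum>d\<in>Basis. \<Sum>e\<in>Basis. \<Sum>b\<in>Basis. \<Sum>c\<in>Basis.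
        p b c * (T b \<bullet> d) * (T c \<bullet> e) * f (d # e # map T vs))"
    by (intro sum.cong refl sum.swap)
  also have "\<dots> = (\<Sum>d\<in>Basis. \<Sum>e\<in>Basis. p' d e * f (d # e # map T vs))"
    by (simp add: qp[symmetric] q_def sum_distrib_right)
  finally show ?thesis by (simp add: matrix_contract_def sum_fun_apply ins_def)
qed

text \<open>The 1-form \<open>b*\<close>.\<close>

definition covector :: "'e::real_inner \<Rightarrow> 'e list \<Rightarrow> real" where
  "covector b vs = (case vs of [u] \<Rightarrow> u \<bullet> b | _ \<Rightarrow> 0)"

lemma ins_covector: "ins v (covector b) = (v \<bullet> b) *\<^sub>R unit_alt"
  by (auto simp: ins_def covector_def unit_alt_def fun_eq_iff split: list.split)

text \<open>The sum is \<open>\<Sum>\<^sub>b b* \<and> \<iota>\<^sub>b f\<close>; the sign from exchanging the factors is the one of \<open>parity\<close>. Applying \<open>\<iota>\<^sub>v\<close>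
  yields the same expression for \<open>\<iota>\<^sub>v f\<close> plus \<open>\<iota>\<^sub>v f\<close> itself, so the eigenvalue increases by one with
  each degree.\<close>

lemma Euler_identity:
  fixes f :: "'e::euclidean_space list \<Rightarrow> real"
  assumes "alternating_form k f"
  shows "(\<Sum>b\<in>Basis. wedge_alt (parity (ins b f)) (covector b)) = real k *\<^sub>R f"
  using assms
proof (induction k arbitrary: f)
  case 0
  then have "ins b f = 0" for b by (simp add: alternating_form_0_iff)
  then show ?case by (simp only: parity_simps wedge_alt_simps sum.neutral_const of_nat_0 scaleR_zero_left)
next
  case (Suc k)
  show ?case
  proof (rule list_fun_eqI)
    show "(\<Sum>b\<in>Basis. wedge_alt (parity (ins b f)) (covector b)) [] = (real (Suc k) *\<^sub>R f) []"
      using alternating_formD(1)[OF Suc.prems, of "[]"]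
      by (simp add: sum_fun_apply wedge_alt_Nil covector_def)
  next
    fix v
    have f_v: "ins v f = (\<Sum>b\<in>Basis. (v \<bullet> b) *\<^sub>R ins b f)"
      using alternating_form_Basis_expand[OF Suc.prems, of v] by (simp add: fun_eq_iff ins_def sum_fun_apply)
    have "ins v (\<Sum>b\<in>Basis. wedge_alt (parity (ins b f)) (covector b)) =
       (\<Sum>b\<in>Basis. - wedge_alt (parity (ins v (ins b f))) (covector b) + (v \<bullet> b) *\<^sub>R ins b f)"
      by (simp add: linear_sum[OF linear_ins] ins_wedge_alt ins_covector wedge_alt_unit)
    also have "\<dots> = (\<Sum>b\<in>Basis. wedge_alt (parity (ins b (ins v f))) (covector b)) + ins v f"
      unfolding alternating_form_twice(2)[OF Suc.prems, of v] by (simp add: sum.distrib f_v[symmetric])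
    also have "\<dots> = real k *\<^sub>R ins v f + ins v f"
      by (simp only: Suc.IH[OF alternating_form_ins[OF Suc.prems]])
    also have "\<dots> = ins v (real (Suc k) *\<^sub>R f)"
      by (simp add: scaleR_add_left)
    finally show "ins v (\<Sum>b\<in>Basis. wedge_alt (parity (ins b f)) (covector b)) = ins v (real (Suc k) *\<^sub>R f)" .
  qed
qed

text \<open>Moving \<open>\<iota>\<^sub>c \<iota>\<^sub>b\<close> past \<open>w\<close> leaves three corrections: two mixed ones with \<open>\<iota>\<^sub>c w\<close> and \<open>\<iota>\<^sub>b w\<close>, which agree
  by antisymmetry of \<open>p\<close>, and the scalar \<open>w (b, c)\<close>. As \<open>\<Sum>\<^sub>c p\<^sub>b\<^sub>c \<iota>\<^sub>c w = - b*\<close>, the mixed ones add up to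
  \<open>- k f\<close> by the Euler identity, while the scalars add up to half the trace of the identity.\<close>

lemma matrix_contract_wedge_commutator:
  fixes w f :: "'e::euclidean_space list \<Rightarrow> real"
  assumes w: "alternating_form 2 w" and p: "inverse_bivector w p" and f: "alternating_form k f"
  shows "matrix_contract p (wedge_alt f w) = wedge_alt (matrix_contract p f) w + (real DIM('e) / 2 - real k) *\<^sub>R f"
proof -
  define E where "E v g = wedge_alt (parity g) (ins v w)" for v g
  have lin_E: "linear (E v)" for v
    unfolding E_def by (rule linearI) simp_all
  note inv = inverse_bivectorD(1)[OF p] and antisym = inverse_bivectorD(2)[OF p]
  have ww: "ins c (ins b w) = w [b, c] *\<^sub>R unit_alt" for b c
    using alternating_formD(1)[OF w] by (auto simp: ins_def unit_alt_def fun_eq_iff)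
  have insE: "ins c (E b f) = w [b, c] *\<^sub>R f - E b (ins c f)" for b c
    by (simp add: E_def ins_wedge_alt ww wedge_alt_unit)
  have step: "ins c (ins b (wedge_alt f w)) =
      wedge_alt (ins c (ins b f)) w + E c (ins b f) - E b (ins c f) + w [b, c] *\<^sub>R f" for b c
    by (simp add: ins_wedge_alt E_def[symmetric] insE)
  have swap: "(\<Sum>b\<in>Basis. \<Sum>c\<in>Basis. p b c *\<^sub>R E b (ins c f)) =
      - (\<Sum>b\<in>Basis. \<Sum>c\<in>Basis. p b c *\<^sub>R E c (ins b f))"
  proof -
    have "(\<Sum>b\<in>Basis. \<Sum>c\<in>Basis. p b c *\<^sub>R E b (ins c f)) = (\<Sum>c\<in>Basis. \<Sum>b\<in>Basis. p b c *\<^sub>R E b (ins c f))"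
      by (rule sum.swap)
    also have "\<dots> = (\<Sum>c\<in>Basis. \<Sum>b\<in>Basis. - (p c b *\<^sub>R E b (ins c f)))"
      by (intro sum.cong refl) (metis antisym scaleR_minus_left)
    finally show ?thesis by (simp add: sum_negf)
  qed
  have cov: "(\<Sum>c\<in>Basis. p b c *\<^sub>R ins c w) = - covector b" if b: "b \<in> Basis" for b
  proof
    fix vs
    show "(\<Sum>c\<in>Basis. p b c *\<^sub>R ins c w) vs = (- covector b) vs"
    proof (cases "length vs = 1")
      case True
      then obtain u where vs: "vs = [u]" by (auto simp: length_Suc_conv)
      have "(\<Sum>c\<in>Basis. p b c * w [c, u]) = (\<Sum>c\<in>Basis. - (p b c * w [u, c]))"
        by (intro sum.cong refl) (use alternating_form_2D(3)[OF w] in \<open>metis mult_minus_right\<close>)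
      then show ?thesis using inv[OF b, of u] by (simp add: vs covector_def sum_fun_apply ins_def sum_negf)
    next
      case False
      then show ?thesis
        using alternating_formD(1)[OF w] by (auto simp: covector_def sum_fun_apply ins_def split: list.split)
    qed
  qed
  have "(\<Sum>b\<in>Basis. \<Sum>c\<in>Basis. p b c *\<^sub>R E c (ins b f)) =
      (\<Sum>b\<in>Basis. wedge_alt (parity (ins b f)) (\<Sum>c\<in>Basis. p b c *\<^sub>R ins c w))"
    by (simp add: E_def linear_sum[OF linear_wedge_right])
  also have "\<dots> = (\<Sum>b\<in>Basis. - wedge_alt (parity (ins b f)) (covector b))"
    by (intro sum.cong refl) (simp add: cov)
  also have "\<dots> = - (real k *\<^sub>R f)" by (simp add: sum_negf Euler_identity[OF f])
  finally have E_sum: "(\<Sum>b\<in>Basis. \<Sum>c\<in>Basis. p b c *\<^sub>R E c (ins b f)) = - (real k *\<^sub>R f)" .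
  have trace: "(\<Sum>b\<in>Basis. \<Sum>c\<in>Basis. p b c * w [b, c]) = real DIM('e)"
    using inv by simp
  have "matrix_contract p (wedge_alt f w) = (1/2) *\<^sub>R (\<Sum>b\<in>Basis. \<Sum>c\<in>Basis.
      wedge_alt (p b c *\<^sub>R ins c (ins b f)) w + p b c *\<^sub>R E c (ins b f) - p b c *\<^sub>R E b (ins c f)
        + (p b c * w [b, c]) *\<^sub>R f)"
    unfolding matrix_contract_def step by (simp add: scaleR_add_right scaleR_diff_right)
  also have "\<dots> = (1/2) *\<^sub>R (\<Sum>b\<in>Basis. \<Sum>c\<in>Basis. wedge_alt (p b c *\<^sub>R ins c (ins b f)) w)
      + (1/2) *\<^sub>R ((\<Sum>b\<in>Basis. \<Sum>c\<in>Basis. p b c *\<^sub>R E c (ins b f)) -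
          (\<Sum>b\<in>Basis. \<Sum>c\<in>Basis. p b c *\<^sub>R E b (ins c f)))
      + (1/2) *\<^sub>R ((\<Sum>b\<in>Basis. \<Sum>c\<in>Basis. p b c * w [b, c]) *\<^sub>R f)"
    by (simp only: sum.distrib sum_subtractf scaleR_sum_left scaleR_add_right scaleR_diff_right)
      (simp add: algebra_simps)
  also have "(1/2) *\<^sub>R (\<Sum>b\<in>Basis. \<Sum>c\<in>Basis. wedge_alt (p b c *\<^sub>R ins c (ins b f)) w) =
      wedge_alt (matrix_contract p f) w"
    by (simp only: matrix_contract_def linear_scale[OF linear_wedge_left] linear_sum[OF linear_wedge_left])
  finally show ?thesis
    unfolding swap E_sum trace by (simp add: fun_eq_iff algebra_simps)
qed

lemma flat_apply:
  assumes "alternating_form 2 w"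
  shows "blinfun_apply (flat w X) u = w [X, u]"
proof -
  have "bounded_linear (\<lambda>u. w [X, u])"
    using alternating_form_2D(2)[OF assms] linear_conv_bounded_linear by blast
  then show ?thesis unfolding flat_def by (simp add: bounded_linear_Blinfun_apply)
qed

lemma flat_bij:
  assumes w: "nondegenerate_alt w"
  shows "linear (flat w)" "bij (flat w)"
proof -
  have alt: "alternating_form 2 w" using w by (simp add: nondegenerate_alt_def)
  note fl = flat_apply[OF alt]
  show lin: "linear (flat w)"
    by (rule linearI; rule blinfun_eqI)
      (simp_all add: fl blinfun.add_left blinfun.scaleR_left linear_add[OF alternating_form_2D(1)[OF alt]]
        linear_scale[OF alternating_form_2D(1)[OF alt]])
  have inj: "inj (flat w)"
  proof (subst linear_injective_0[OF lin], intro allI impI)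
    fix u assume "flat w u = 0"
    then have "w [u, v] = 0" for v using fl[of u v] by simp
    then show "u = 0" using w by (auto simp: nondegenerate_alt_def)
  qed
  define h where "h u = (\<Sum>b\<in>Basis. w [u, b] *\<^sub>R b)" for u
  have h_inner: "h u \<bullet> v = w [u, v]" for u v
  proof -
    have "w [u, v] = w [u, \<Sum>b\<in>Basis. (v \<bullet> b) *\<^sub>R b]" by (simp add: euclidean_representation)
    also have "\<dots> = (\<Sum>b\<in>Basis. (v \<bullet> b) * w [u, b])"
      by (simp add: linear_sum[OF alternating_form_2D(2)[OF alt]] linear_scale[OF alternating_form_2D(2)[OF alt]])
    finally show ?thesis by (simp add: h_def inner_sum_left inner_commute[of v] mult.commute)
  qed
  have lin_h: "linear h"
    unfolding h_def by (rule linearI)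
      (simp_all add: linear_add[OF alternating_form_2D(1)[OF alt]] linear_scale[OF alternating_form_2D(1)[OF alt]]
        scaleR_add_left sum.distrib scaleR_sum_right)
  have "inj h"
  proof (subst linear_injective_0[OF lin_h], intro allI impI)
    fix u assume "h u = 0"
    then have "w [u, v] = 0" for v using h_inner[of u v] by simp
    then show "u = 0" using w by (auto simp: nondegenerate_alt_def)
  qed
  then have "surj h" using lin_h linear_injective_imp_surjective by blast
  have "\<exists>u. flat w u = \<zeta>" for \<zeta>
  proof -
    obtain u where u: "h u = (\<Sum>b\<in>Basis. blinfun_apply \<zeta> b *\<^sub>R b)" using \<open>surj h\<close> by (metis surjD)
    have "flat w u = \<zeta>"
      by (rule blinfun_euclidean_eqI)
        (simp add: fl h_inner[symmetric] u inner_sum_left inner_Basis if_distrib sum.If_cases cong: if_cong)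
    then show ?thesis ..
  qed
  then have "surj (flat w)" by (metis surjI surj_def)
  with inj show "bij (flat w)" by (simp add: bij_def)
qed

text \<open>The bivector exists because \<open>flat w\<close> is an isomorphism: it is \<open>w\<close> transported along the inverse
  of \<open>flat w\<close>. The sign in \<open>flat_ext\<close> is \<open>+1\<close> in degree 2.\<close>

lemma flat_ext_inverse:
  assumes w: "nondegenerate_alt w"
  defines "P \<equiv> inv_into {P. alternating_form 2 P} (flat_ext w) w"
  shows "alternating_form 2 P" "P [flat w u, flat w v] = w [u, v]"
proof -
  have alt: "alternating_form 2 w" using w by (simp add: nondegenerate_alt_def)
  define s where "s = inv (flat w)"
  note fb = flat_bij[OF w]
  have s: "s (flat w u) = u" for u using fb(2) by (simp add: s_def bij_is_inj)
  have fs: "flat w (s \<zeta>) = \<zeta>" for \<zeta> using fb(2) by (simp add: s_def bij_is_surj surj_f_inv_f)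
  have lin_s: "linear s"
    by (rule linearI) (metis s fs linear_add[OF fb(1)], metis s fs linear_scale[OF fb(1)])
  define Q where "Q \<zeta>s = w (map s \<zeta>s)" for \<zeta>s
  have "alternating_form 2 Q"
  proof (rule alternating_form_2I)
    show "linear (\<lambda>\<zeta>. Q [\<zeta>, \<eta>])" for \<eta>
      using linear_compose[OF lin_s alternating_form_2D(1)[OF alt, of "s \<eta>"]] by (simp add: Q_def o_def)
    show "Q [\<zeta>, \<eta>] = - Q [\<eta>, \<zeta>]" for \<zeta> \<eta>
      using alternating_form_2D(3)[OF alt, of "s \<zeta>" "s \<eta>"] by (simp add: Q_def)
    show "Q \<zeta>s = 0" if "length \<zeta>s \<noteq> 2" for \<zeta>s
      using alternating_formD(1)[OF alt] that by (simp add: Q_def)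
  qed
  moreover have "flat_ext w Q = w"
  proof
    fix vs show "flat_ext w Q vs = w vs"
      using alternating_formD(1)[OF alt, of vs] by (cases "length vs = 2") (auto simp: flat_ext_def Q_def s o_def)
  qed
  ultimately have mem: "w \<in> flat_ext w ` {P. alternating_form 2 P}" by (metis imageI mem_Collect_eq)
  show "alternating_form 2 P" unfolding P_def using inv_into_into[OF mem] by simp
  have "flat_ext w P [u, v] = w [u, v]" unfolding P_def using f_inv_into_f[OF mem] by simp
  then show "P [flat w u, flat w v] = w [u, v]" by (simp add: flat_ext_def)
qed

lemma inverse_bivector_flat_ext:
  fixes w :: "'e::euclidean_space list \<Rightarrow> real"
  assumes w: "nondegenerate_alt w"
  defines "P \<equiv> inv_into {P. alternating_form 2 P} (flat_ext w) w"
  shows "inverse_bivector w (\<lambda>b c. P [blinfun_inner_left b, blinfun_inner_left c])"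
  unfolding inverse_bivector_def
proof (intro conjI ballI allI)
  note P = flat_ext_inverse[OF w, folded P_def]
  have alt: "alternating_form 2 w" using w by (simp add: nondegenerate_alt_def)
  show "P [blinfun_inner_left b, blinfun_inner_left c] = - P [blinfun_inner_left c, blinfun_inner_left b]" for b c
    by (rule alternating_form_2D(3)[OF P(1)])
  fix b v :: 'e assume "b \<in> Basis"
  obtain u where u: "flat w u = blinfun_inner_left b" using flat_bij(2)[OF w] by (metis bij_pointE)
  have fl: "flat w v = (\<Sum>c\<in>Basis. w [v, c] *\<^sub>R blinfun_inner_left c)"
    by (rule blinfun_euclidean_eqI)
      (simp add: flat_apply[OF alt] blinfun.sum_left blinfun.scaleR_left inner_Basis if_distrib sum.If_cases cong: if_cong)
  note lin = alternating_form_2D(2)[OF P(1)]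
  have "(\<Sum>c\<in>Basis. P [blinfun_inner_left b, blinfun_inner_left c] * w [v, c]) =
      P [blinfun_inner_left b, flat w v]"
    unfolding fl linear_sum[OF lin] linear_scale[OF lin] by (simp add: mult.commute)
  also have "\<dots> = w [u, v]" unfolding u[symmetric] by (rule P(2))
  also have "\<dots> = v \<bullet> b" using flat_apply[OF alt, of u v] u by (simp add: inner_commute)
  finally show "(\<Sum>c\<in>Basis. P [blinfun_inner_left b, blinfun_inner_left c] * w [v, c]) = v \<bullet> b" .
qed

section \<open>The exterior derivative in a chart\<close>

abbreviation omit :: "nat \<Rightarrow> 'v list \<Rightarrow> 'v list" where
  "omit i vs \<equiv> take i vs @ drop (Suc i) vs"

definition dirD :: "'e::euclidean_space \<Rightarrow> ('e \<Rightarrow> 'v list \<Rightarrow> real) \<Rightarrow> 'e \<Rightarrow> 'v list \<Rightarrow> real" where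
  "dirD v F x us = frechet_derivative (\<lambda>y. F y us) (at x) v"

definition local_d :: "('e::euclidean_space \<Rightarrow> 'e list \<Rightarrow> real) \<Rightarrow> 'e \<Rightarrow> 'e list \<Rightarrow> real" where
  "local_d F x vs = (\<Sum>i<length vs. (- 1) ^ i * dirD (vs ! i) F x (omit i vs))"

text \<open>Differentiability is demanded for each fixed list of arguments, so that no topology
  on the space of functions on lists is involved.\<close>

definition differentiable_family :: "('e::euclidean_space \<Rightarrow> 'v list \<Rightarrow> real) \<Rightarrow> 'e \<Rightarrow> bool" where
  "differentiable_family F x \<longleftrightarrow> (\<forall>us. (\<lambda>y. F y us) differentiable at x)"

lemma local_d_Nil: "local_d F x [] = 0"
  by (simp add: local_d_def)

text \<open>Cartan's formula \<open>\<iota>\<^sub>v d = D\<^sub>v - d \<iota>\<^sub>v\<close> for the constant vector field \<open>v\<close>, whose Lie derivative is the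
  directional derivative. It makes \<open>d\<close> accessible to induction on the argument list.\<close>

lemma local_d_Cons: "local_d F x (v # vs) = dirD v F x vs - local_d (\<lambda>y. ins v (F y)) x vs"
  by (simp add: local_d_def sum.lessThan_Suc_shift dirD_def ins_def sum_negf del: sum.lessThan_Suc)

lemma ins_local_d: "ins v (local_d F x) = dirD v F x - local_d (\<lambda>y. ins v (F y)) x"
  by (simp add: fun_eq_iff ins_def[of v "local_d F x"] local_d_Cons)

lemma ins_dirD: "ins u (dirD v F x) = dirD v (\<lambda>y. ins u (F y)) x"
  by (simp add: fun_eq_iff ins_def dirD_def)

lemma dirD_has_derivative:
  "differentiable_family F x \<Longrightarrow> ((\<lambda>y. F y us) has_derivative (\<lambda>v. dirD v F x us)) (at x)"
  unfolding differentiable_family_def dirD_def by (simp add: differentiable_has_derivative)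

lemma dirD_eqI: "((\<lambda>y. F y us) has_derivative f') (at x) \<Longrightarrow> dirD v F x us = f' v"
  unfolding dirD_def by (rule frechet_derivative_eqI)

lemma differentiable_familyI:
  "(\<And>us. ((\<lambda>y. F y us) has_derivative f' us) (at x)) \<Longrightarrow> differentiable_family F x"
  unfolding differentiable_family_def differentiable_def by blast

lemma differentiable_family_ins: "differentiable_family F x \<Longrightarrow> differentiable_family (\<lambda>y. ins v (F y)) x"
  by (simp add: differentiable_family_def ins_def)

lemma has_derivative_family_add:
  "differentiable_family F x \<Longrightarrow> differentiable_family G x \<Longrightarrow>
    ((\<lambda>y. (F y + G y) us) has_derivative (\<lambda>v. dirD v F x us + dirD v G x us)) (at x)"
  by (simp add: has_derivative_add dirD_has_derivative)

lemma has_derivative_family_scale: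
  "differentiable_family F x \<Longrightarrow> ((\<lambda>y. (r *\<^sub>R F y) us) has_derivative (\<lambda>v. r * dirD v F x us)) (at x)"
  by (simp add: has_derivative_mult_right dirD_has_derivative)

lemma local_d_add:
  assumes "differentiable_family F x" "differentiable_family G x"
  shows "local_d (\<lambda>y. F y + G y) x = local_d F x + local_d G x"
proof
  fix vs
  have "dirD v (\<lambda>y. F y + G y) x us = dirD v F x us + dirD v G x us" for v us
    by (rule dirD_eqI[OF has_derivative_family_add[OF assms]])
  then show "local_d (\<lambda>y. F y + G y) x vs = (local_d F x + local_d G x) vs"
    by (simp add: local_d_def ring_distribs sum.distrib)
qed

lemma local_d_scale:
  assumes "differentiable_family F x"
  shows "local_d (\<lambda>y. r *\<^sub>R F y) x = r *\<^sub>R local_d F x"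
proof
  fix vs
  have "dirD v (\<lambda>y. r *\<^sub>R F y) x us = r * dirD v F x us" for v us
    by (rule dirD_eqI[OF has_derivative_family_scale[OF assms]])
  then show "local_d (\<lambda>y. r *\<^sub>R F y) x vs = (r *\<^sub>R local_d F x) vs"
    by (simp add: local_d_def sum_distrib_left mult.left_commute)
qed

lemma differentiable_family_scale:
  "differentiable_family F x \<Longrightarrow> differentiable_family (\<lambda>y. r *\<^sub>R F y) x"
  by (rule differentiable_familyI[OF has_derivative_family_scale])

lemma local_d_diff:
  assumes "differentiable_family F x" "differentiable_family G x"
  shows "local_d (\<lambda>y. F y - G y) x = local_d F x - local_d G x"
  using local_d_add[OF assms(1) differentiable_family_scale[OF assms(2), of "-1"]]
    local_d_scale[OF assms(2), of "-1"] by simp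

lemma local_d_cong:
  assumes "open S" "x \<in> S" "\<And>y. y \<in> S \<Longrightarrow> F y = G y"
  shows "local_d F x = local_d G x"
proof -
  have "dirD v F x us = dirD v G x us" for v us
    unfolding dirD_def using frechet_derivative_cong_open[OF assms(1,2), of "\<lambda>y. F y us" "\<lambda>y. G y us"] assms(3)
    by simp
  then show ?thesis by (simp add: local_d_def fun_eq_iff)
qed

lemma local_d_zero: "local_d (\<lambda>y. 0) x = 0"
  by (simp add: local_d_def dirD_def fun_eq_iff)

lemma parity_has_derivative:
  "differentiable_family F x \<Longrightarrow>
    ((\<lambda>y. parity (F y) us) has_derivative (\<lambda>v. parity (dirD v F x) us)) (at x)"
  unfolding parity_def by (intro has_derivative_mult_right dirD_has_derivative)

lemma differentiable_family_parity: "differentiable_family F x \<Longrightarrow> differentiable_family (\<lambda>y. parity (F y)) x"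
  by (rule differentiable_familyI[OF parity_has_derivative])

lemma local_d_parity:
  assumes "differentiable_family F x"
  shows "local_d (\<lambda>y. parity (F y)) x = - parity (local_d F x)"
proof
  fix vs :: "'a list"
  have "dirD v (\<lambda>y. parity (F y)) x us = (- 1) ^ length us * dirD v F x us" for v us
    using dirD_eqI[where F = "\<lambda>y. parity (F y)", OF parity_has_derivative[OF assms]] by (simp add: parity_def)
  moreover have "length (omit i vs) = length vs - 1" if "i < length vs" for i using that by simp
  ultimately have "local_d (\<lambda>y. parity (F y)) x vs =
      (\<Sum>i<length vs. (- 1) ^ i * ((- 1) ^ (length vs - 1) * dirD (vs ! i) F x (omit i vs)))"
    unfolding local_d_def by (intro sum.cong refl) simp
  also have "\<dots> = - parity (local_d F x) vs"
    by (cases vs) (simp_all add: local_d_def parity_def sum_distrib_left mult.left_commute sum_negf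
        del: sum.lessThan_Suc)
  finally show "local_d (\<lambda>y. parity (F y)) x vs = (- parity (local_d F x)) vs" by simp
qed

lemma wedge_has_derivative:
  assumes "differentiable_family F x" "differentiable_family G x"
  shows "((\<lambda>y. wedge_alt (F y) (G y) us) has_derivative
    (\<lambda>v. (wedge_alt (dirD v F x) (G x) + wedge_alt (F x) (dirD v G x)) us)) (at x)"
proof -
  have "((\<lambda>y. wedge_alt (F y) (G y) us) has_derivative
    (\<lambda>v. \<Sum>I\<in>Pow {..<length us}.
      shuffle_sign (length us) I * F x (nths us I) * dirD v G x (nths us (- I)) +
      shuffle_sign (length us) I * dirD v F x (nths us I) * G x (nths us (- I)))) (at x)"
    unfolding wedge_alt_def
    by (intro has_derivative_sum has_derivative_mult has_derivative_mult_right dirD_has_derivative assms)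
  then show ?thesis by (simp add: wedge_alt_def sum.distrib add.commute)
qed

lemma differentiable_family_wedge:
  "differentiable_family F x \<Longrightarrow> differentiable_family G x \<Longrightarrow>
    differentiable_family (\<lambda>y. wedge_alt (F y) (G y)) x"
  by (rule differentiable_familyI[OF wedge_has_derivative])

lemma local_d_wedge:
  assumes "differentiable_family F x" "differentiable_family G x"
  shows "local_d (\<lambda>y. wedge_alt (F y) (G y)) x =
    wedge_alt (local_d F x) (G x) + wedge_alt (parity (F x)) (local_d G x)"
proof
  fix vs
  show "local_d (\<lambda>y. wedge_alt (F y) (G y)) x vs =
    (wedge_alt (local_d F x) (G x) + wedge_alt (parity (F x)) (local_d G x)) vs"
    using assms
  proof (induction vs arbitrary: F G)
    case Nil
    show ?case by (simp add: local_d_Nil wedge_alt_Nil)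
  next
    case (Cons v vs)
    note dif = Cons.prems Cons.prems[THEN differentiable_family_ins, of v] differentiable_family_parity[OF Cons.prems(1)]
    have "local_d (\<lambda>y. wedge_alt (F y) (G y)) x (v # vs) =
      dirD v (\<lambda>y. wedge_alt (F y) (G y)) x vs -
      local_d (\<lambda>y. wedge_alt (ins v (F y)) (G y) + wedge_alt (parity (F y)) (ins v (G y))) x vs"
      by (simp add: local_d_Cons ins_wedge_alt)
    also have "dirD v (\<lambda>y. wedge_alt (F y) (G y)) x vs =
      (wedge_alt (dirD v F x) (G x) + wedge_alt (F x) (dirD v G x)) vs"
      by (rule dirD_eqI[OF wedge_has_derivative[OF Cons.prems]])
    also have "local_d (\<lambda>y. wedge_alt (ins v (F y)) (G y) + wedge_alt (parity (F y)) (ins v (G y))) x vs =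
      local_d (\<lambda>y. wedge_alt (ins v (F y)) (G y)) x vs + local_d (\<lambda>y. wedge_alt (parity (F y)) (ins v (G y))) x vs"
      by (subst local_d_add) (simp_all add: differentiable_family_wedge dif)
    also have "local_d (\<lambda>y. wedge_alt (ins v (F y)) (G y)) x vs =
      (wedge_alt (local_d (\<lambda>y. ins v (F y)) x) (G x) + wedge_alt (parity (ins v (F x))) (local_d G x)) vs"
      by (rule Cons.IH[OF dif(3) dif(2)])
    also have "local_d (\<lambda>y. wedge_alt (parity (F y)) (ins v (G y))) x vs =
      (wedge_alt (- parity (local_d F x)) (ins v (G x)) + wedge_alt (F x) (local_d (\<lambda>y. ins v (G y)) x)) vs"
      using Cons.IH[OF dif(5) dif(4)] by (simp only: local_d_parity[OF dif(1)] parity_parity)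
    finally show ?case by (simp add: wedge_alt_Cons ins_local_d)
  qed
qed

lemma linear_frechet_derivative_param:
  assumes S: "open S" "x \<in> S" and lin: "\<And>y. y \<in> S \<Longrightarrow> linear (g y)"
    and dif: "\<And>u. (\<lambda>y. g y u) differentiable at x"
  shows "linear (\<lambda>u. frechet_derivative (\<lambda>y. g y u) (at x) h :: real)"
proof (rule linearI)
  note D = differentiable_has_derivative[OF dif]
  fix u v :: 'b and r :: real
  have "frechet_derivative (\<lambda>y. g y (u + v)) (at x) = frechet_derivative (\<lambda>y. g y u + g y v) (at x)"
    by (intro frechet_derivative_cong_open[OF S] linear_add lin)
  then show "frechet_derivative (\<lambda>y. g y (u + v)) (at x) h =
      frechet_derivative (\<lambda>y. g y u) (at x) h + frechet_derivative (\<lambda>y. g y v) (at x) h"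
    using frechet_derivative_eqI[OF has_derivative_add[OF D D]] by simp
  have "frechet_derivative (\<lambda>y. g y (r *\<^sub>R u)) (at x) = frechet_derivative (\<lambda>y. r *\<^sub>R g y u) (at x)"
    by (intro frechet_derivative_cong_open[OF S] linear_scale lin)
  then show "frechet_derivative (\<lambda>y. g y (r *\<^sub>R u)) (at x) h = r *\<^sub>R frechet_derivative (\<lambda>y. g y u) (at x) h"
    using frechet_derivative_eqI[OF has_derivative_scaleR_right[OF D]] by simp
qed

lemma alternating_form_dirD:
  assumes S: "open S" "x \<in> S" and alt: "\<And>y. y \<in> S \<Longrightarrow> alternating_form k (F y)"
    and dif: "differentiable_family F x"
  shows "alternating_form k (dirD v F x)"
proof -
  have zero: "dirD v F x us = 0" if "\<And>y. y \<in> S \<Longrightarrow> F y us = 0" for us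
    unfolding dirD_def using frechet_derivative_cong_open[OF S, of "\<lambda>y. F y us" "\<lambda>y. 0"] that by simp
  show ?thesis
    unfolding alternating_form_def
  proof (intro conjI allI impI)
    fix vs :: "'b list" and i assume "length vs = k \<and> i < k"
    then show "linear (\<lambda>u. dirD v F x (vs[i := u]))"
      unfolding dirD_def using dif alternating_formD(2)[OF alt]
      by (intro linear_frechet_derivative_param[OF S]) (auto simp: differentiable_family_def)
  qed (use alternating_formD(1,3)[OF alt] zero in auto)
qed

text \<open>By Cartan's formula \<open>\<iota>\<^sub>v \<iota>\<^sub>v d F = d (\<iota>\<^sub>v \<iota>\<^sub>v F)\<close>, which is zero, and \<open>\<iota>\<^sub>v d F\<close> is alternating by induction.\<close>

lemma alternating_form_local_d:
  assumes S: "open S" "x \<in> S" and "\<And>y. y \<in> S \<Longrightarrow> alternating_form k (F y)"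
    and "differentiable_family F x"
  shows "alternating_form (Suc k) (local_d F x)"
  using assms(3,4)
proof (induction k arbitrary: F)
  case (0 F)
  then have "ins v (F y) = 0" if "y \<in> S" for v y using that alternating_form_0_iff by blast
  then have "local_d (\<lambda>y. ins v (F y)) x = 0" for v
    using local_d_cong[OF S, of "\<lambda>y. ins v (F y)" "\<lambda>y. 0"] local_d_zero by simp
  then have "ins v (local_d F x) = dirD v F x" for v by (simp add: ins_local_d)
  moreover have "linear (\<lambda>v. dirD v F x vs)" for vs
    using has_derivative_linear[OF dirD_has_derivative[OF 0(2)]] .
  moreover have "alternating_form 0 (dirD v F x)" for v using 0 by (intro alternating_form_dirD[OF S]) auto
  moreover from this have "ins v (dirD v F x) = 0" for v using alternating_form_0_iff by blast
  moreover have "local_d F x (v # vs) = dirD v F x vs" for v vs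
    using \<open>\<And>v. local_d (\<lambda>y. ins v (F y)) x = 0\<close> by (simp add: local_d_Cons)
  ultimately show ?case by (intro alternating_form_SucI) (simp_all add: local_d_Nil)
next
  case (Suc k)
  show ?case
  proof (rule alternating_form_SucI)
    fix v
    have "alternating_form (Suc k) (local_d (\<lambda>y. ins v (F y)) x)"
      using Suc.prems by (intro Suc.IH alternating_form_ins differentiable_family_ins) auto
    moreover have "alternating_form (Suc k) (dirD v F x)"
      using Suc.prems by (intro alternating_form_dirD[OF S])
    ultimately show "alternating_form (Suc k) (ins v (local_d F x))"
      unfolding ins_local_d by (intro alternating_form_diff)
    have "ins v (ins v (F y)) = 0" if "y \<in> S" for y using Suc.prems(1) that alternating_form_twice(1) by blast
    then have "local_d (\<lambda>y. ins v (ins v (F y))) x = 0"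
      using local_d_cong[OF S, of "\<lambda>y. ins v (ins v (F y))" "\<lambda>y. 0"] local_d_zero by simp
    then show "ins v (ins v (local_d F x)) = 0" by (simp add: ins_local_d ins_dirD)
  next
    fix vs
    have "linear (\<lambda>v. dirD v F x vs)"
      using has_derivative_linear[OF dirD_has_derivative[OF Suc.prems(2)]] .
    moreover have "linear (\<lambda>v. local_d (\<lambda>y. ins v (F y)) x vs)"
      unfolding local_d_def dirD_def ins_def
    proof (intro linear_compose_sum ballI)
      fix i
      have "linear (\<lambda>v. frechet_derivative (\<lambda>y. F y (v # omit i vs)) (at x) (vs ! i))"
        using Suc.prems by (intro linear_frechet_derivative_param[OF S] alternating_form_linear_hd)
          (auto simp: differentiable_family_def)
      then show "linear (\<lambda>v. (- 1) ^ i * frechet_derivative (\<lambda>y. F y (v # omit i vs)) (at x) (vs ! i))"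
        using linear_compose_scale_right[where 'b = real, unfolded real_scaleR_def] by blast
    qed
    ultimately show "linear (\<lambda>v. local_d F x (v # vs))"
      unfolding local_d_Cons by (rule linear_compose_sub)
  qed (rule local_d_Nil)
qed

definition smooth_family :: "'e::euclidean_space set \<Rightarrow> ('e \<Rightarrow> 'v list \<Rightarrow> real) \<Rightarrow> bool" where
  "smooth_family S F \<longleftrightarrow> (\<forall>us. smooth_on S (\<lambda>y. F y us))"

lemma smooth_family_differentiable: "smooth_family S F \<Longrightarrow> x \<in> S \<Longrightarrow> differentiable_family F x"
  unfolding smooth_family_def differentiable_family_def using smooth_onD_differentiable by blast

lemma smooth_family_dirD: "smooth_family S F \<Longrightarrow> smooth_family S (dirD v F)"
  by (simp add: smooth_family_def dirD_def smooth_on_derivative)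

lemma smooth_family_ins: "smooth_family S F \<Longrightarrow> smooth_family S (\<lambda>y. ins v (F y))"
  by (simp add: smooth_family_def ins_def)

lemma smooth_family_local_d:
  assumes "open S" "smooth_family S F"
  shows "smooth_family S (local_d F)"
  unfolding smooth_family_def local_d_def
  using smooth_family_dirD[OF assms(2)] assms(1)
  by (intro allI smooth_on_sum smooth_on_mult smooth_on_const) (auto simp: smooth_family_def)

lemma dirD_local_d:
  assumes S: "open S" "x \<in> S" and F: "smooth_family S F"
  shows "dirD v (local_d F) x = local_d (dirD v F) x"
proof
  fix vs
  note D = smooth_family_differentiable[OF smooth_family_dirD[OF F] S(2), THEN dirD_has_derivative]
  have "((\<lambda>y. local_d F y vs) has_derivative
      (\<lambda>h. \<Sum>i<length vs. (- 1) ^ i * dirD h (dirD (vs ! i) F) x (omit i vs))) (at x)"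
    unfolding local_d_def by (intro has_derivative_sum has_derivative_mult_right D)
  then have "dirD v (local_d F) x vs = (\<Sum>i<length vs. (- 1) ^ i * dirD v (dirD (vs ! i) F) x (omit i vs))"
    by (rule dirD_eqI)
  also have "\<dots> = local_d (dirD v F) x vs"
    unfolding local_d_def
  proof (intro sum.cong refl)
    fix i
    have "dirD v (dirD (vs ! i) F) x (omit i vs) = dirD (vs ! i) (dirD v F) x (omit i vs)"
      unfolding dirD_def using F unfolding smooth_family_def
      by (intro symmetric_second_derivative[OF S]) blast
    then show "(- 1) ^ i * dirD v (dirD (vs ! i) F) x (omit i vs) = (- 1) ^ i * dirD (vs ! i) (dirD v F) x (omit i vs)"
      by simp
  qed
  finally show "dirD v (local_d F) x vs = local_d (dirD v F) x vs" .
qed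

text \<open>By Cartan's formula \<open>\<iota>\<^sub>v d d F = D\<^sub>v d F - d D\<^sub>v F + d d (\<iota>\<^sub>v F)\<close>; the first two terms cancel because
  directional derivatives commute.\<close>

lemma local_d_local_d:
  assumes S: "open S" "x \<in> S" and "smooth_family S F"
  shows "local_d (local_d F) x = 0"
proof
  fix vs show "local_d (local_d F) x vs = 0 vs"
    using assms(3)
  proof (induction vs arbitrary: F)
    case (Cons v vs)
    have dif: "differentiable_family (dirD v F) x" "differentiable_family (local_d (\<lambda>y. ins v (F y))) x"
      using Cons.prems S
      by (auto intro!: smooth_family_differentiable[of S] smooth_family_dirD smooth_family_local_d smooth_family_ins)
    have "local_d (local_d F) x (v # vs) = dirD v (local_d F) x vs -
        local_d (\<lambda>y. dirD v F y - local_d (\<lambda>y. ins v (F y)) y) x vs"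
      by (simp add: local_d_Cons ins_local_d)
    also have "\<dots> = local_d (local_d (\<lambda>y. ins v (F y))) x vs"
      by (simp add: dirD_local_d[OF S Cons.prems] local_d_diff[OF dif])
    also have "\<dots> = 0" using Cons.IH[OF smooth_family_ins[OF Cons.prems]] by simp
    finally show ?case by simp
  qed (simp add: local_d_Nil)
qed

section \<open>Naturality of the exterior derivative\<close>

lemma alternating_form_ins_pred: "alternating_form k f \<Longrightarrow> alternating_form (k - 1) (ins v f)"
  by (cases k) (auto simp: alternating_form_ins alternating_form_0_iff)

text \<open>Expanding the moving argument in the basis turns the expression into a sum of products of
  scalar functions with \<open>B y\<close> at fixed arguments.\<close>

lemma has_derivative_moving_argument:
  fixes B :: "'e::euclidean_space \<Rightarrow> 'f::euclidean_space list \<Rightarrow> real"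
  assumes S: "open S" "x \<in> S" and alt: "\<And>y. y \<in> S \<Longrightarrow> alternating_form k (B y)"
    and dif: "differentiable_family B x" and u: "(u has_derivative u') (at x)"
  shows "((\<lambda>y. B y (u y # us)) has_derivative (\<lambda>h. dirD h B x (u x # us) + B x (u' h # us))) (at x)"
proof -
  have "((\<lambda>y. \<Sum>b\<in>Basis. (u y \<bullet> b) * B y (b # us)) has_derivative
    (\<lambda>h. \<Sum>b\<in>Basis. (u x \<bullet> b) * dirD h B x (b # us) + (u' h \<bullet> b) * B x (b # us))) (at x)"
    by (intro has_derivative_sum has_derivative_mult dirD_has_derivative dif
        bounded_linear.has_derivative[OF bounded_linear_inner_left u])
  moreover have "(\<Sum>b\<in>Basis. (u x \<bullet> b) * dirD h B x (b # us) + (u' h \<bullet> b) * B x (b # us)) =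
      dirD h B x (u x # us) + B x (u' h # us)" for h
    using alternating_form_Basis_expand[OF alternating_form_dirD[OF S alt dif], where v="u x" and vs = us]
      alternating_form_Basis_expand[OF alt[OF S(2)], where v="u' h" and vs = us]
    by (simp add: sum.distrib)
  ultimately have "((\<lambda>y. \<Sum>b\<in>Basis. (u y \<bullet> b) * B y (b # us)) has_derivative
    (\<lambda>h. dirD h B x (u x # us) + B x (u' h # us))) (at x)" by simp
  then show ?thesis
    by (rule has_derivative_transform_within_open[OF _ S])
      (simp add: alternating_form_Basis_expand[OF alt, symmetric])
qed

text \<open>\<open>J y\<close> stands for the derivative of a map at \<open>y\<close>, and \<open>H\<close> for its second derivative at \<open>x\<close>.
  The pullback of a family \<open>B\<close> evaluates \<open>B y\<close> at \<open>J y v\<^sub>1, \<dots>, J y v\<^sub>k\<close>. Allowing \<open>B\<close> to depend on the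
  source point makes the class of pullbacks closed under \<open>\<iota>\<^sub>v\<close>: this replaces \<open>B y\<close> by \<open>\<iota>\<^bsub>J y v\<^esub> (B y)\<close>.\<close>

locale moving_frame =
  fixes S :: "'e::euclidean_space set" and x :: 'e and J :: "'e \<Rightarrow> 'e \<Rightarrow> 'e" and H :: "'e \<Rightarrow> 'e \<Rightarrow> 'e"
  assumes S: "open S" "x \<in> S"
    and J_has_derivative: "\<And>v. ((\<lambda>y. J y v) has_derivative (\<lambda>h. H h v)) (at x)"
    and H_symmetric: "H u v = H v u"
begin

lemma moving_ins:
  assumes alt: "\<And>y. y \<in> S \<Longrightarrow> alternating_form k (B y)" and dif: "differentiable_family B x"
  shows "\<And>y. y \<in> S \<Longrightarrow> alternating_form (k - 1) (ins (J y v) (B y))"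
    and "differentiable_family (\<lambda>y. ins (J y v) (B y)) x"
    and "dirD h (\<lambda>y. ins (J y v) (B y)) x us = dirD h B x (J x v # us) + B x (H h v # us)"
proof -
  have D: "((\<lambda>y. ins (J y v) (B y) us) has_derivative
      (\<lambda>h. dirD h B x (J x v # us) + B x (H h v # us))) (at x)" for us
    unfolding ins_def by (rule has_derivative_moving_argument[OF S alt dif J_has_derivative])
  show "differentiable_family (\<lambda>y. ins (J y v) (B y)) x" by (rule differentiable_familyI[OF D])
  show "dirD h (\<lambda>y. ins (J y v) (B y)) x us = dirD h B x (J x v # us) + B x (H h v # us)"
    by (rule dirD_eqI[OF D])
qed (use alt alternating_form_ins_pred in blast)

text \<open>By the product rule each argument contributes the term in which \<open>J x v\<^sub>i\<close> is replaced by \<open>H h v\<^sub>i\<close>;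
  moving that argument to the front costs the sign \<open>(-1)\<^sup>i\<close>.\<close>

lemma has_derivative_pullback:
  assumes "\<And>y. y \<in> S \<Longrightarrow> alternating_form k (B y)" "differentiable_family B x"
  shows "((\<lambda>y. B y (map (J y) vs)) has_derivative (\<lambda>h. dirD h B x (map (J x) vs) +
    (\<Sum>i<length vs. (- 1) ^ i * B x (H h (vs ! i) # map (J x) (omit i vs))))) (at x)"
  using assms
proof (induction vs arbitrary: B k)
  case Nil
  then show ?case using dirD_has_derivative[of B x "[]"] by simp
next
  case (Cons v vs)
  note m = moving_ins[OF Cons.prems, where v = v]
  have sw: "B x (J x v # w # us) = - B x (w # J x v # us)" for w us
    by (rule alternating_form_swap[OF Cons.prems(1)[OF S(2)]])
  have "((\<lambda>y. ins (J y v) (B y) (map (J y) vs)) has_derivative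
    (\<lambda>h. dirD h B x (map (J x) (v # vs)) +
    (\<Sum>i<length (v # vs). (- 1) ^ i * B x (H h ((v # vs) ! i) # map (J x) (omit i (v # vs)))))) (at x)"
    by (rule has_derivative_eq_rhs[OF Cons.IH[OF m(1,2)]])
      (simp_all add: m(3) sum.lessThan_Suc_shift ins_def[of _ "B x"] sw sum_negf fun_eq_iff del: sum.lessThan_Suc)
  then show ?case by (simp add: ins_def)
qed

text \<open>In Cartan's formula the second derivatives occur once in \<open>D\<^sub>v\<close> of the pullback, as \<open>H v v\<^sub>i\<close>, and once
  in \<open>d \<iota>\<^sub>v\<close> of it, as \<open>H v\<^sub>i v\<close>, with the same sign \<open>(-1)\<^sup>i\<close>. By symmetry they cancel.\<close>

lemma local_d_pullback:
  assumes "\<And>y. y \<in> S \<Longrightarrow> alternating_form k (B y)" "differentiable_family B x"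
  shows "local_d (\<lambda>y us. B y (map (J y) us)) x vs =
    (\<Sum>i<length vs. (- 1) ^ i * dirD (vs ! i) B x (map (J x) (omit i vs)))"
  using assms
proof (induction vs arbitrary: B k)
  case Nil
  show ?case by (simp add: local_d_Nil)
next
  case (Cons v vs)
  note m = moving_ins[OF Cons.prems, where v = v]
  have "local_d (\<lambda>y us. B y (map (J y) us)) x (v # vs) =
     dirD v (\<lambda>y us. B y (map (J y) us)) x vs - local_d (\<lambda>y us. ins (J y v) (B y) (map (J y) us)) x vs"
    by (simp add: local_d_Cons ins_def[abs_def])
  also have "dirD v (\<lambda>y us. B y (map (J y) us)) x vs = dirD v B x (map (J x) vs) +
    (\<Sum>i<length vs. (- 1) ^ i * B x (H v (vs ! i) # map (J x) (omit i vs)))"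
    by (rule dirD_eqI[OF has_derivative_pullback[OF Cons.prems]])
  also have "local_d (\<lambda>y us. ins (J y v) (B y) (map (J y) us)) x vs =
    (\<Sum>i<length vs. (- 1) ^ i * dirD (vs ! i) (\<lambda>y. ins (J y v) (B y)) x (map (J x) (omit i vs)))"
    by (rule Cons.IH[OF m(1,2)])
  also have "\<dots> =
    (\<Sum>i<length vs. (- 1) ^ i * dirD (vs ! i) B x (J x v # map (J x) (omit i vs))) +
    (\<Sum>i<length vs. (- 1) ^ i * B x (H v (vs ! i) # map (J x) (omit i vs)))"
    by (simp add: m(3) H_symmetric[of "vs ! _" v] ring_distribs sum.distrib)
  finally show ?case by (simp add: sum.lessThan_Suc_shift sum_negf del: sum.lessThan_Suc)
qed

end

lemma local_d_natural:
  fixes T :: "'e::euclidean_space \<Rightarrow> 'e"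
  assumes S: "open S" "x \<in> S" and T: "smooth_on S T"
    and alt: "\<And>y. y \<in> S \<Longrightarrow> alternating_form k (\<beta> (T y))" and dif: "differentiable_family \<beta> (T x)"
  shows "local_d (\<lambda>y us. \<beta> (T y) (map (frechet_derivative T (at y)) us)) x vs =
    local_d \<beta> (T x) (map (frechet_derivative T (at x)) vs)"
proof -
  let ?J = "\<lambda>y. frechet_derivative T (at y)"
  interpret moving_frame S x ?J "\<lambda>h v. frechet_derivative (\<lambda>y. ?J y v) (at x) h"
  proof
    show "((\<lambda>y. ?J y v) has_derivative (\<lambda>h. frechet_derivative (\<lambda>y. ?J y v) (at x) h)) (at x)" for v
      using smooth_onD_differentiable[OF smooth_on_derivative[OF T] S(2)] by (rule differentiable_has_derivative)
    show "frechet_derivative (\<lambda>y. ?J y v) (at x) u = frechet_derivative (\<lambda>y. ?J y u) (at x) v" for u v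
      by (rule symmetric_second_derivative[OF S T])
  qed (use S in auto)
  have TD: "(T has_derivative ?J x) (at x)"
    using smooth_onD_differentiable[OF T S(2)] by (rule differentiable_has_derivative)
  have D: "((\<lambda>y. \<beta> (T y) us) has_derivative (\<lambda>h. dirD (?J x h) \<beta> (T x) us)) (at x)" for us
    by (rule has_derivative_compose[OF TD dirD_has_derivative[OF dif]])
  have "local_d (\<lambda>y us. \<beta> (T y) (map (?J y) us)) x vs =
    (\<Sum>i<length vs. (- 1) ^ i * dirD (vs ! i) (\<lambda>y. \<beta> (T y)) x (map (?J x) (omit i vs)))"
    by (rule local_d_pullback[OF alt differentiable_familyI[OF D]])
  also have "\<dots> = local_d \<beta> (T x) (map (?J x) vs)"
    unfolding local_d_def length_map
    by (intro sum.cong refl) (simp add: dirD_eqI[where F = "\<lambda>y. \<beta> (T y)", OF D] take_map drop_map)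
  finally show ?thesis .
qed

section \<open>Differential forms on a manifold\<close>

lemma zero_form_eq: "zero_form = 0"
  by (simp add: zero_form_def fun_eq_iff)

lemma diff_form_eq: "diff_form \<alpha> \<beta> = \<alpha> - \<beta>"
  by (simp add: diff_form_def fun_eq_iff)

lemma formsI:
  assumes "\<And>c x. \<not> in_domain A c x \<Longrightarrow> \<alpha> c x = 0"
    and "\<And>c x. in_domain A c x \<Longrightarrow> alternating_form k (\<alpha> c x)"
    and "\<And>c. c \<in> A \<Longrightarrow> smooth_family (chart_image c) (\<alpha> c)"
    and "\<And>c c' x vs. c \<in> A \<Longrightarrow> c' \<in> A \<Longrightarrow> x \<in> overlap c c' \<Longrightarrow>
      \<alpha> c x vs = \<alpha> c' (transition c c' x) (map (frechet_derivative (transition c c') (at x)) vs)"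
  shows "\<alpha> \<in> forms A k"
  unfolding forms_def
proof (intro CollectI conjI allI ballI impI)
  show "\<alpha> c x vs = 0" if "\<not> in_domain A c x" for c x vs using assms(1)[OF that] by simp
  show "smooth_on (chart_image c) (\<lambda>x. \<alpha> c x vs)" if "c \<in> A" for c vs
    using assms(3)[OF that] by (simp add: smooth_family_def)
qed (use assms(2,4) in blast)+

lemma formsD:
  assumes "\<alpha> \<in> forms A k"
  shows "\<not> in_domain A c x \<Longrightarrow> \<alpha> c x = 0"
    and "in_domain A c x \<Longrightarrow> alternating_form k (\<alpha> c x)"
    and "c \<in> A \<Longrightarrow> smooth_family (chart_image c) (\<alpha> c)"
    and "c \<in> A \<Longrightarrow> c' \<in> A \<Longrightarrow> x \<in> overlap c c' \<Longrightarrow>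
      \<alpha> c x vs = \<alpha> c' (transition c c' x) (map (frechet_derivative (transition c c') (at x)) vs)"
proof -
  note * = assms[unfolded forms_def mem_Collect_eq]
  show "\<alpha> c x = 0" if "\<not> in_domain A c x"
    using * that by (intro ext) (simp only: zero_fun_apply, blast)
  show "in_domain A c x \<Longrightarrow> alternating_form k (\<alpha> c x)"
    "c \<in> A \<Longrightarrow> smooth_family (chart_image c) (\<alpha> c)"
    "c \<in> A \<Longrightarrow> c' \<in> A \<Longrightarrow> x \<in> overlap c c' \<Longrightarrow>
      \<alpha> c x vs = \<alpha> c' (transition c c' x) (map (frechet_derivative (transition c c') (at x)) vs)"
    using * unfolding smooth_family_def by blast+
qed

locale smooth_atlas =
  fixes M :: "'a topology" and A :: "('a, 'e::euclidean_space) chart set"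
  assumes manifold: "smooth_manifold M A"
begin

lemma is_chart: "c \<in> A \<Longrightarrow> is_chart M c"
  using manifold by (simp add: smooth_manifold_def)

lemma open_chart_image: "c \<in> A \<Longrightarrow> open (chart_image c)"
  using is_chart by (simp add: is_chart_def)

lemma topspace_chart: "c \<in> A \<Longrightarrow> topspace (subtopology M (fst c)) = fst c"
  using is_chart[of c] openin_subset[of M "fst c"] by (auto simp: is_chart_def)

lemma chart_inj: "c \<in> A \<Longrightarrow> inj_on (snd c) (fst c)"
  using homeomorphic_imp_injective_map is_chart[of c] topspace_chart[of c] by (metis is_chart_def)

lemma open_overlap:
  assumes "c \<in> A" "c' \<in> A"
  shows "open (overlap c c')"
proof -
  have "openin (subtopology M (fst c)) (fst c \<inter> fst c')"
    using is_chart[OF assms(2)] by (auto simp: is_chart_def intro: openin_subtopology_Int2)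
  moreover have "open_map (subtopology M (fst c)) (top_of_set (chart_image c)) (snd c)"
    using is_chart[OF assms(1)] homeomorphic_imp_open_map by (auto simp: is_chart_def)
  ultimately have "openin (top_of_set (chart_image c)) (overlap c c')"
    by (simp add: open_map_def overlap_def)
  then show ?thesis using open_chart_image[OF assms(1)] openin_open_eq by blast
qed

lemma overlap_subset: "overlap c c' \<subseteq> chart_image c"
  by (auto simp: overlap_def chart_image_def)

lemma transition_in: "c \<in> A \<Longrightarrow> x \<in> overlap c c' \<Longrightarrow> transition c c' x \<in> chart_image c'"
  using chart_inj[of c] by (auto simp: overlap_def chart_image_def transition_def)

lemma in_domain_overlap:
  assumes "c \<in> A" "c' \<in> A" "x \<in> overlap c c'"
  shows "in_domain A c x" "in_domain A c' (transition c c' x)"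
  unfolding in_domain_def using assms transition_in[OF assms(1,3)] overlap_subset[of c c'] by - blast+

lemma smooth_transition: "c \<in> A \<Longrightarrow> c' \<in> A \<Longrightarrow> smooth_on (overlap c c') (transition c c')"
  using manifold by (simp add: smooth_manifold_def)

lemma linear_transition_derivative:
  assumes "c \<in> A" "c' \<in> A" "x \<in> overlap c c'"
  shows "linear (frechet_derivative (transition c c') (at x))"
  using smooth_onD_differentiable[OF smooth_transition[OF assms(1,2)] assms(3)] by (rule linear_frechet_derivative)

lemma form_differentiable:
  assumes "\<alpha> \<in> forms A k" "in_domain A c x"
  shows "differentiable_family (\<alpha> c) x"
  using assms formsD(3)[OF assms(1), of c] by (auto simp: in_domain_def intro: smooth_family_differentiable)

lemma smooth_family_add:
  "open S \<Longrightarrow> smooth_family S F \<Longrightarrow> smooth_family S G \<Longrightarrow> smooth_family S (F + G)"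
  by (simp add: smooth_family_def smooth_on_add)

lemma smooth_family_scale: "open S \<Longrightarrow> smooth_family S F \<Longrightarrow> smooth_family S (r *\<^sub>R F)"
  by (simp add: smooth_family_def smooth_on_mult smooth_on_const)

lemma smooth_family_0: "smooth_family S 0"
  by (simp add: smooth_family_def smooth_on_const)

lemma subspace_forms: "subspace (forms A k)"
  unfolding subspace_def
proof (intro conjI ballI allI)
  show "0 \<in> forms A k"
    by (rule formsI) (simp_all add: alternating_form_0 smooth_family_0)
  fix \<alpha> assume \<alpha>: "\<alpha> \<in> forms A k"
  show "\<alpha> + \<beta> \<in> forms A k" if \<beta>: "\<beta> \<in> forms A k" for \<beta>
    by (rule formsI)
      (simp_all add: formsD[OF \<alpha>] formsD[OF \<beta>] alternating_form_add smooth_family_add open_chart_image)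
  show "r *\<^sub>R \<alpha> \<in> forms A k" for r
    by (rule formsI) (simp_all add: formsD[OF \<alpha>] alternating_form_scale smooth_family_scale open_chart_image)
qed

lemma wedge_forms:
  assumes \<alpha>: "\<alpha> \<in> forms A p" and \<beta>: "\<beta> \<in> forms A q"
  shows "wedge \<alpha> \<beta> \<in> forms A (p + q)"
proof (rule formsI)
  show "wedge \<alpha> \<beta> c x = 0" if "\<not> in_domain A c x" for c x
    using formsD(1)[OF \<alpha> that] by (simp add: wedge_def)
  show "alternating_form (p + q) (wedge \<alpha> \<beta> c x)" if "in_domain A c x" for c x
    using formsD(2)[OF \<alpha> that] formsD(2)[OF \<beta> that] by (simp add: wedge_def alternating_form_wedge)
  show "smooth_family (chart_image c) (wedge \<alpha> \<beta> c)" if "c \<in> A" for c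
    unfolding smooth_family_def wedge_def wedge_alt_def
    using formsD(3)[OF \<alpha> that] formsD(3)[OF \<beta> that] open_chart_image[OF that]
    by (intro allI smooth_on_sum smooth_on_mult smooth_on_const) (simp_all add: smooth_family_def)
  show "wedge \<alpha> \<beta> c x vs = wedge \<alpha> \<beta> c' (transition c c' x) (map (frechet_derivative (transition c c') (at x)) vs)"
    if "c \<in> A" "c' \<in> A" "x \<in> overlap c c'" for c c' x vs
    unfolding wedge_def wedge_alt_map
    by (simp add: formsD(4)[OF \<alpha> that, symmetric] formsD(4)[OF \<beta> that, symmetric])
qed

lemma ext_d_eq: "ext_d A \<alpha> c x = (if in_domain A c x then local_d (\<alpha> c) x else 0)"
  by (simp add: ext_d_def local_d_def dirD_def fun_eq_iff)

lemma ext_d_forms: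
  assumes \<alpha>: "\<alpha> \<in> forms A k"
  shows "ext_d A \<alpha> \<in> forms A (k + 1)"
proof (rule formsI)
  show "alternating_form (k + 1) (ext_d A \<alpha> c x)" if "in_domain A c x" for c x
  proof -
    have cx: "c \<in> A" "x \<in> chart_image c" using that by (auto simp: in_domain_def)
    have "alternating_form k (\<alpha> c y)" if "y \<in> chart_image c" for y
      using formsD(2)[OF \<alpha>] that cx by (simp add: in_domain_def)
    from alternating_form_local_d[OF open_chart_image[OF cx(1)] cx(2) this form_differentiable[OF \<alpha> that]]
    show ?thesis using that by (simp add: ext_d_eq)
  qed
  show "smooth_family (chart_image c) (ext_d A \<alpha> c)" if "c \<in> A" for c
  proof -
    have "smooth_family (chart_image c) (local_d (\<alpha> c))"
      using formsD(3)[OF \<alpha> that] open_chart_image[OF that] by (intro smooth_family_local_d)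
    then show ?thesis
      unfolding smooth_family_def
      using smooth_on_cong[OF open_chart_image[OF that], of "\<lambda>y. local_d (\<alpha> c) y _" "\<lambda>y. ext_d A \<alpha> c y _"] that
      by (auto simp: ext_d_eq in_domain_def)
  qed
  show "ext_d A \<alpha> c x vs = ext_d A \<alpha> c' (transition c c' x) (map (frechet_derivative (transition c c') (at x)) vs)"
    if cc: "c \<in> A" "c' \<in> A" and x: "x \<in> overlap c c'" for c c' x vs
  proof -
    let ?T = "transition c c'"
    note dom = in_domain_overlap[OF cc]
    have "ext_d A \<alpha> c x vs = local_d (\<alpha> c) x vs" using dom(1)[OF x] by (simp add: ext_d_eq)
    also have "local_d (\<alpha> c) x = local_d (\<lambda>y us. \<alpha> c' (?T y) (map (frechet_derivative ?T (at y)) us)) x"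
      using formsD(4)[OF \<alpha> cc] by (intro local_d_cong[OF open_overlap[OF cc] x]) (simp add: fun_eq_iff)
    also have "\<dots> vs = local_d (\<alpha> c') (?T x) (map (frechet_derivative ?T (at x)) vs)"
      using formsD(2)[OF \<alpha>] dom form_differentiable[OF \<alpha>] x
      by (intro local_d_natural[OF open_overlap[OF cc] x smooth_transition[OF cc]]) blast+
    finally show ?thesis using dom(2)[OF x] by (simp add: ext_d_eq)
  qed
qed (simp add: ext_d_eq)

lemma ext_d_add:
  assumes "\<alpha> \<in> forms A k" "\<beta> \<in> forms A k"
  shows "ext_d A (\<alpha> + \<beta>) = ext_d A \<alpha> + ext_d A \<beta>"
proof (intro ext)
  fix c x vs
  show "ext_d A (\<alpha> + \<beta>) c x vs = (ext_d A \<alpha> + ext_d A \<beta>) c x vs"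
    using local_d_add[of "\<alpha> c" x "\<beta> c"] form_differentiable[OF assms(1)] form_differentiable[OF assms(2)]
    by (simp add: ext_d_eq plus_fun_def)
qed

lemma ext_d_scale:
  assumes "\<alpha> \<in> forms A k"
  shows "ext_d A (r *\<^sub>R \<alpha>) = r *\<^sub>R ext_d A \<alpha>"
proof (intro ext)
  fix c x vs
  have "(r *\<^sub>R \<alpha>) c = (\<lambda>y. r *\<^sub>R \<alpha> c y)" by (simp add: fun_eq_iff)
  then show "ext_d A (r *\<^sub>R \<alpha>) c x vs = (r *\<^sub>R ext_d A \<alpha>) c x vs"
    using local_d_scale[of "\<alpha> c" x r] form_differentiable[OF assms(1)] by (simp add: ext_d_eq)
qed

lemma ext_d_ext_d:
  assumes \<alpha>: "\<alpha> \<in> forms A k"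
  shows "ext_d A (ext_d A \<alpha>) = 0"
proof (rule ext, rule ext)
  fix c x
  show "ext_d A (ext_d A \<alpha>) c x = 0 c x"
  proof (cases "in_domain A c x")
    case True
    then have cx: "c \<in> A" "x \<in> chart_image c" by (auto simp: in_domain_def)
    have "local_d (ext_d A \<alpha> c) x = local_d (local_d (\<alpha> c)) x"
      using cx by (intro local_d_cong[OF open_chart_image]) (auto simp: ext_d_eq in_domain_def)
    also have "\<dots> = 0" by (rule local_d_local_d[OF open_chart_image[OF cx(1)] cx(2) formsD(3)[OF \<alpha> cx(1)]])
    finally show ?thesis using True by (simp add: ext_d_eq)
  qed (simp add: ext_d_eq)
qed

lemma ext_d_wedge_closed:
  assumes \<alpha>: "\<alpha> \<in> forms A k" and \<omega>: "\<omega> \<in> closed_forms A q"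
  shows "ext_d A (wedge \<alpha> \<omega>) = wedge (ext_d A \<alpha>) \<omega>"
proof (rule ext, rule ext)
  fix c x
  have \<omega>f: "\<omega> \<in> forms A q" and d\<omega>: "ext_d A \<omega> c x = 0"
    using \<omega> by (auto simp: closed_forms_def zero_form_eq)
  show "ext_d A (wedge \<alpha> \<omega>) c x = wedge (ext_d A \<alpha>) \<omega> c x"
  proof (cases "in_domain A c x")
    case True
    then have "local_d (\<omega> c) x = 0" using d\<omega> by (simp add: ext_d_eq)
    then show ?thesis
      using local_d_wedge[OF form_differentiable[OF \<alpha> True] form_differentiable[OF \<omega>f True]] True
      by (simp add: ext_d_eq wedge_def)
  qed (simp add: ext_d_eq wedge_def)
qed

end

section \<open>Lefschetz operators of a symplectic manifold\<close>

locale symplectic =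
  fixes M :: "'a topology" and A :: "('a, 'e::euclidean_space) chart set" and \<omega> :: "('a, 'e) form" and n :: nat
  assumes symplectic: "symplectic_manifold M A \<omega>" and dim: "DIM('e) = 2 * n"
begin

sublocale smooth_atlas M A
  using symplectic by unfold_locales (simp add: symplectic_manifold_def)

lemma closed_\<omega>: "\<omega> \<in> closed_forms A 2"
  using symplectic by (simp add: symplectic_manifold_def)

lemma \<omega>_forms: "\<omega> \<in> forms A 2"
  using closed_\<omega> by (simp add: closed_forms_def)

lemma nondegenerate_\<omega>: "in_domain A c x \<Longrightarrow> nondegenerate_alt (\<omega> c x)"
  using symplectic formsD(2)[OF \<omega>_forms]
  unfolding symplectic_manifold_def nondegenerate_def nondegenerate_alt_def by blast

definition lefschetz_op :: "('a, 'e) form \<Rightarrow> ('a, 'e) form" where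
  "lefschetz_op \<alpha> = wedge \<alpha> \<omega>"

text \<open>The sign makes the commutator with the Lefschetz operator equal to \<open>n - k\<close>, because \<open>G\<close> is
  \<open>- flat\<^sup>-\<^sup>1(\<omega>)\<close>.\<close>

definition dual_lefschetz_op :: "('a, 'e) form \<Rightarrow> ('a, 'e) form" where
  "dual_lefschetz_op \<alpha> = - contract_G \<omega> \<alpha>"

definition dual_matrix :: "('a, 'e) chart \<Rightarrow> 'e \<Rightarrow> 'e \<Rightarrow> 'e \<Rightarrow> real" where
  "dual_matrix c x a b =
     inv_into {P. alternating_form 2 P} (flat_ext (\<omega> c x)) (\<omega> c x) [blinfun_inner_left a, blinfun_inner_left b]"

lemma inverse_bivector_dual_matrix: "in_domain A c x \<Longrightarrow> inverse_bivector (\<omega> c x) (dual_matrix c x)"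
  unfolding dual_matrix_def by (intro inverse_bivector_flat_ext nondegenerate_\<omega>)

lemma dual_lefschetz_op_eq: "dual_lefschetz_op \<alpha> c x = matrix_contract (dual_matrix c x) (\<alpha> c x)"
  by (simp add: dual_lefschetz_op_def contract_G_def contract2_eq_matrix_contract matrix_contract_def dual_bivector_def
      dual_matrix_def fun_eq_iff sum_fun_apply sum_negf)

lemma smooth_dual_matrix:
  assumes c: "c \<in> A" and ab: "a \<in> Basis" "b \<in> Basis"
  shows "smooth_on (chart_image c) (\<lambda>x. dual_matrix c x a b)"
proof -
  have dom: "in_domain A c x" if "x \<in> chart_image c" for x using that c by (simp add: in_domain_def)
  note inv = inverse_bivectorD[OF inverse_bivector_dual_matrix[OF dom]]
  have alt: "alternating_form 2 (\<omega> c x)" if "x \<in> chart_image c" for x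
    using formsD(2)[OF \<omega>_forms dom[OF that]] .
  \<comment> \<open>The matrix of \<open>\<omega>\<close> is transposed here to match the order of the indices in a matrix product.\<close>
  interpret inverse_matrix_family "chart_image c" Basis "\<lambda>a b x. \<omega> c x [b, a]" "\<lambda>a b x. dual_matrix c x a b"
  proof
    show "open (chart_image c)" by (rule open_chart_image[OF c])
    fix x :: 'e and b d :: 'e assume x: "x \<in> chart_image c" and bd: "b \<in> Basis" "d \<in> Basis"
    show "(\<Sum>c'\<in>Basis. dual_matrix c x b c' * \<omega> c x [d, c']) = (if b = d then 1 else 0)"
      using inv(1)[OF x bd(1), of d] bd by (simp add: inner_Basis eq_commute)
    have "(\<Sum>c'\<in>Basis. \<omega> c x [c', b] * dual_matrix c x c' d) = (\<Sum>c'\<in>Basis. dual_matrix c x d c' * \<omega> c x [b, c'])"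
    proof (intro sum.cong refl)
      fix c'
      show "\<omega> c x [c', b] * dual_matrix c x c' d = dual_matrix c x d c' * \<omega> c x [b, c']"
        using inv(2)[OF x, of c' d] alternating_form_2D(3)[OF alt[OF x], of c' b] by simp
    qed
    then show "(\<Sum>c'\<in>Basis. \<omega> c x [c', b] * dual_matrix c x c' d) = (if b = d then 1 else 0)"
      using inv(1)[OF x bd(2), of b] bd by (simp add: inner_Basis)
  qed simp
  show ?thesis
    using formsD(3)[OF \<omega>_forms c] ab by (intro smooth_on_inverse_matrix) (simp_all add: smooth_family_def)
qed

lemma dual_lefschetz_op_forms:
  assumes \<alpha>: "\<alpha> \<in> forms A (k + 2)"
  shows "dual_lefschetz_op \<alpha> \<in> forms A k"
proof (rule formsI)
  show "dual_lefschetz_op \<alpha> c x = 0" if "\<not> in_domain A c x" for c x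
    using formsD(1)[OF \<alpha> that] by (simp add: dual_lefschetz_op_eq linear_0[OF linear_matrix_contract])
  show "alternating_form k (dual_lefschetz_op \<alpha> c x)" if "in_domain A c x" for c x
    using formsD(2)[OF \<alpha> that] unfolding dual_lefschetz_op_eq by (rule alternating_form_matrix_contract)
  show "smooth_family (chart_image c) (dual_lefschetz_op \<alpha> c)" if "c \<in> A" for c
  proof -
    have "smooth_on (chart_image c) (\<lambda>x. (1/2) * (\<Sum>a\<in>Basis. \<Sum>b\<in>Basis. dual_matrix c x a b * \<alpha> c x (a # b # vs)))" for vs
      using formsD(3)[OF \<alpha> that]
      by (intro smooth_on_mult smooth_on_sum smooth_on_const smooth_dual_matrix open_chart_image that)
        (simp_all add: smooth_family_def)
    then show ?thesis
      by (simp add: smooth_family_def dual_lefschetz_op_eq matrix_contract_def sum_fun_apply ins_def)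
  qed
  show "dual_lefschetz_op \<alpha> c x vs =
    dual_lefschetz_op \<alpha> c' (transition c c' x) (map (frechet_derivative (transition c c') (at x)) vs)"
    if cc: "c \<in> A" "c' \<in> A" "x \<in> overlap c c'" for c c' x vs
  proof -
    let ?T = "frechet_derivative (transition c c') (at x)"
    note dom = in_domain_overlap[OF cc]
    have "\<alpha> c x = (\<lambda>us. \<alpha> c' (transition c c' x) (map ?T us))" using formsD(4)[OF \<alpha> cc] by blast
    then show ?thesis
      unfolding dual_lefschetz_op_eq
      using matrix_contract_pullback[OF nondegenerate_\<omega>[OF dom(1)] nondegenerate_\<omega>[OF dom(2)]
          linear_transition_derivative[OF cc] _ inverse_bivector_dual_matrix[OF dom(1)]
          inverse_bivector_dual_matrix[OF dom(2)] formsD(2)[OF \<alpha> dom(2)], of vs]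
        formsD(4)[OF \<omega>_forms cc] by simp
  qed
qed

sublocale lefschetz_complex "forms A" lefschetz_op dual_lefschetz_op n "ext_d A"
proof (intro lefschetz_complex.intro lefschetz_module.intro lefschetz_complex_axioms.intro)
  show "subspace (forms A k)" for k by (rule subspace_forms)
  show "linear lefschetz_op"
    by (rule linearI) (simp_all add: lefschetz_op_def wedge_def fun_eq_iff)
  show "linear dual_lefschetz_op"
    by (rule linearI)
      (simp_all add: fun_eq_iff dual_lefschetz_op_eq linear_add[OF linear_matrix_contract] linear_scale[OF linear_matrix_contract])
  fix \<alpha> k assume \<alpha>: "\<alpha> \<in> forms A k"
  show "lefschetz_op \<alpha> \<in> forms A (k + 2)"
    unfolding lefschetz_op_def by (rule wedge_forms[OF \<alpha> \<omega>_forms])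
  show "dual_lefschetz_op \<alpha> = 0" if "k < 2"
  proof (rule ext, rule ext)
    fix c x
    show "dual_lefschetz_op \<alpha> c x = 0 c x"
      unfolding dual_lefschetz_op_eq
      using matrix_contract_low_degree[OF formsD(2)[OF \<alpha>] that, of c x] formsD(1)[OF \<alpha>, of c x]
      by (cases "in_domain A c x") (simp_all add: linear_0[OF linear_matrix_contract])
  qed
  show "\<alpha> = 0" if "2 * n < k"
  proof (rule ext, rule ext)
    fix c x
    show "\<alpha> c x = 0 c x"
      using alternating_form_top[OF formsD(2)[OF \<alpha>]] formsD(1)[OF \<alpha>] that dim
      by (cases "in_domain A c x") simp_all
  qed
  show "dual_lefschetz_op (lefschetz_op \<alpha>) = lefschetz_op (dual_lefschetz_op \<alpha>) + (real n - real k) *\<^sub>R \<alpha>"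
  proof (rule ext, rule ext)
    fix c x
    show "dual_lefschetz_op (lefschetz_op \<alpha>) c x =
        (lefschetz_op (dual_lefschetz_op \<alpha>) + (real n - real k) *\<^sub>R \<alpha>) c x"
    proof (cases "in_domain A c x")
      case True
      from matrix_contract_wedge_commutator[OF formsD(2)[OF \<omega>_forms True] inverse_bivector_dual_matrix[OF True] formsD(2)[OF \<alpha> True]]
      show ?thesis by (simp add: dual_lefschetz_op_eq lefschetz_op_def wedge_def dim)
    next
      case False
      then show ?thesis
        using formsD(1)[OF \<alpha> False]
        by (simp add: linear_0[OF linear_matrix_contract] dual_lefschetz_op_eq lefschetz_op_def wedge_def)
    qed
  qed
  show "ext_d A \<alpha> \<in> forms A (k + 1)" by (rule ext_d_forms[OF \<alpha>])
  show "ext_d A (r *\<^sub>R \<alpha>) = r *\<^sub>R ext_d A \<alpha>" for r by (rule ext_d_scale[OF \<alpha>])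
  show "ext_d A (ext_d A \<alpha>) = 0" by (rule ext_d_ext_d[OF \<alpha>])
  show "ext_d A (lefschetz_op \<alpha>) = lefschetz_op (ext_d A \<alpha>)"
    unfolding lefschetz_op_def by (rule ext_d_wedge_closed[OF \<alpha> closed_\<omega>])
  show "ext_d A (\<alpha> + \<beta>) = ext_d A \<alpha> + ext_d A \<beta>" if "\<beta> \<in> forms A k" for \<beta>
    by (rule ext_d_add[OF \<alpha> that])
next
  fix \<alpha> k assume "\<alpha> \<in> forms A (k + 2)"
  then show "dual_lefschetz_op \<alpha> \<in> forms A k" by (rule dual_lefschetz_op_forms)
qed

section \<open>Cohomology classes\<close>

lemma closed_forms_eq: "closed_forms A k = cocycles k"
  by (simp add: closed_forms_def cocycles_def zero_form_eq)

lemma exact_forms_eq: "exact_forms A k = coboundaries k"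
  by (cases k) (simp_all add: coboundaries_def zero_form_eq)

lemma de_Rham_class_eq:
  "\<alpha> \<in> cocycles k \<Longrightarrow> de_Rham_class A k \<alpha> = {\<beta> \<in> cocycles k. \<alpha> - \<beta> \<in> coboundaries k}"
  by (auto simp: de_Rham_class_def cohomologous_def closed_forms_eq exact_forms_eq diff_form_eq)

lemma de_Rham_eq: "de_Rham A k = de_Rham_class A k ` cocycles k"
  by (auto simp: de_Rham_def de_Rham_class_def quotient_def closed_forms_eq)

lemma de_Rham_class_eq_iff:
  assumes "\<alpha> \<in> cocycles k" "\<beta> \<in> cocycles k"
  shows "de_Rham_class A k \<alpha> = de_Rham_class A k \<beta> \<longleftrightarrow> \<alpha> - \<beta> \<in> coboundaries k"
proof
  assume eq: "de_Rham_class A k \<alpha> = de_Rham_class A k \<beta>"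
  have "\<beta> \<in> de_Rham_class A k \<beta>"
    using assms subspace_0[OF subspace_coboundaries] by (simp add: de_Rham_class_eq)
  then have "\<beta> \<in> de_Rham_class A k \<alpha>" unfolding eq .
  then show "\<alpha> - \<beta> \<in> coboundaries k" using assms by (simp add: de_Rham_class_eq)
next
  assume B: "\<alpha> - \<beta> \<in> coboundaries k"
  have "\<alpha> - \<gamma> \<in> coboundaries k \<longleftrightarrow> \<beta> - \<gamma> \<in> coboundaries k" for \<gamma>
    using subspace_add[OF subspace_coboundaries B, of "\<beta> - \<gamma>"]
      subspace_diff[OF subspace_coboundaries _ B, of "\<alpha> - \<gamma>"] by auto
  then show "de_Rham_class A k \<alpha> = de_Rham_class A k \<beta>" using assms by (simp add: de_Rham_class_eq)
qed

text \<open>Associativity turns the product with \<open>\<omega>\<^sup>m\<close> into \<open>m\<close> products with \<open>\<omega>\<close>.\<close>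

lemma wedge_wedge_power:
  assumes "\<alpha> \<in> forms A k"
  shows "wedge \<alpha> (wedge_power A \<omega> m) = (lefschetz_op ^^ m) \<alpha>"
proof (induction m)
  case 0
  show ?case
  proof (rule ext, rule ext)
    fix c x
    show "wedge \<alpha> (wedge_power A \<omega> 0) c x = (lefschetz_op ^^ 0) \<alpha> c x"
    proof (cases "in_domain A c x")
      case True
      then have "unit_form A c x = unit_alt" by (simp add: unit_form_def unit_alt_def fun_eq_iff)
      then show ?thesis by (simp add: wedge_def wedge_alt_unit)
    qed (simp add: wedge_def formsD(1)[OF assms])
  qed
next
  case (Suc m)
  have "wedge \<alpha> (wedge_power A \<omega> (Suc m)) = lefschetz_op (wedge \<alpha> (wedge_power A \<omega> m))"
    by (simp add: lefschetz_op_def wedge_def wedge_alt_assoc)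
  then show ?case using Suc by simp
qed

text \<open>On closed forms \<open>\<delta> = \<iota>\<^sub>G d - d \<iota>\<^sub>G\<close> reduces to \<open>- d \<iota>\<^sub>G = d \<Lambda>\<close>.\<close>

lemma harmonic_iff:
  assumes "\<alpha> \<in> cocycles k"
  shows "harmonic A \<omega> \<alpha> \<longleftrightarrow> ext_d A (dual_lefschetz_op \<alpha>) = 0"
proof -
  have \<alpha>: "\<alpha> \<in> forms A k" "ext_d A \<alpha> = 0" using assms by (auto simp: cocycles_def)
  have G: "contract_G \<omega> \<beta> = (- 1) *\<^sub>R dual_lefschetz_op \<beta>" for \<beta> by (simp add: dual_lefschetz_op_def)
  obtain j where "dual_lefschetz_op \<alpha> \<in> forms A j"
  proof (cases "k < 2")
    case True
    then show thesis using that Lam_low[OF \<alpha>(1)] subspace_0[OF subspace_V] by simp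
  next
    case False
    then have "k = k - 2 + 2" by simp
    then show thesis using that Lam_V \<alpha>(1) by metis
  qed
  then have "koszul_d A \<omega> \<alpha> = ext_d A (dual_lefschetz_op \<alpha>)"
    using d_scale[of "dual_lefschetz_op \<alpha>" j "- 1"]
    by (simp add: koszul_d_def diff_form_eq \<alpha>(2) G Lam_simps)
  then show ?thesis by (simp add: harmonic_def zero_form_eq \<alpha>(2))
qed

lemma de_Rham_hr_iff: "de_Rham_hr A \<omega> k = de_Rham A k \<longleftrightarrow> harmonic_representable k"
proof -
  have "de_Rham_hr A \<omega> k = de_Rham A k \<longleftrightarrow> (\<forall>C\<in>de_Rham A k. \<exists>\<alpha>\<in>C. harmonic A \<omega> \<alpha>)"
    by (auto simp: de_Rham_hr_def)
  also have "\<dots> \<longleftrightarrow> (\<forall>x\<in>cocycles k. \<exists>y\<in>cocycles k. x - y \<in> coboundaries k \<and> harmonic A \<omega> y)"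
    unfolding de_Rham_eq by (auto simp: de_Rham_class_eq Bex_def conj_assoc)
  also have "\<dots> \<longleftrightarrow> harmonic_representable k"
    unfolding harmonic_representable_def using harmonic_iff by blast
  finally show ?thesis .
qed

lemma Lefschetz_map_class:
  assumes \<alpha>: "\<alpha> \<in> cocycles k" and k: "k \<le> n"
  shows "Lefschetz_map A \<omega> n k (de_Rham_class A k \<alpha>) =
    de_Rham_class A (2 * n - k) ((lefschetz_op ^^ (n - k)) \<alpha>)"
proof -
  have deg: "k + 2 * (n - k) = 2 * n - k" using k by simp
  have "de_Rham_class A (2 * n - k) (wedge \<beta> (wedge_power A \<omega> (n - k))) =
      de_Rham_class A (2 * n - k) ((lefschetz_op ^^ (n - k)) \<alpha>)" if "\<beta> \<in> de_Rham_class A k \<alpha>" for \<beta>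
  proof -
    have \<beta>: "\<beta> \<in> cocycles k" "\<alpha> - \<beta> \<in> coboundaries k" using that \<alpha> by (auto simp: de_Rham_class_eq)
    have "wedge \<beta> (wedge_power A \<omega> (n - k)) = (lefschetz_op ^^ (n - k)) \<beta>"
      using \<beta>(1) by (intro wedge_wedge_power[of _ k]) (simp add: cocycles_def)
    moreover have "(lefschetz_op ^^ (n - k)) \<alpha> - (lefschetz_op ^^ (n - k)) \<beta> \<in> coboundaries (2 * n - k)"
      using L_pow_coboundaries[OF \<beta>(2), of "n - k"] deg by (simp add: L_pow_simps)
    moreover have "(lefschetz_op ^^ (n - k)) \<alpha> \<in> cocycles (2 * n - k)" "(lefschetz_op ^^ (n - k)) \<beta> \<in> cocycles (2 * n - k)"
      using L_pow_cocycles[OF \<alpha>, of "n - k"] L_pow_cocycles[OF \<beta>(1), of "n - k"] deg by simp_all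
    ultimately show ?thesis using de_Rham_class_eq_iff by metis
  qed
  moreover have "\<alpha> \<in> de_Rham_class A k \<alpha>"
    using \<alpha> subspace_0[OF subspace_coboundaries] by (simp add: de_Rham_class_eq)
  ultimately show ?thesis unfolding Lefschetz_map_def by blast
qed

lemma Lefschetz_iff:
  assumes "s + 1 \<le> n"
  shows "Lefschetz A \<omega> n s \<longleftrightarrow> hard_Lefschetz_upto s"
proof -
  have "Lefschetz_map A \<omega> n k ` de_Rham A k = de_Rham A (2 * n - k) \<longleftrightarrow>
     (\<forall>y\<in>cocycles (2 * n - k). \<exists>x\<in>cocycles k. y - (lefschetz_op ^^ (n - k)) x \<in> coboundaries (2 * n - k))"
    if "k \<le> s" for k
  proof -
    have k: "k \<le> n" "k + 2 * (n - k) = 2 * n - k" using that assms by auto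
    let ?cl = "de_Rham_class A (2 * n - k)" and ?L = "lefschetz_op ^^ (n - k)"
    have L: "?L x \<in> cocycles (2 * n - k)" if "x \<in> cocycles k" for x
      using L_pow_cocycles[OF that, of "n - k"] k by simp
    have "Lefschetz_map A \<omega> n k ` de_Rham A k = (\<lambda>x. ?cl (?L x)) ` cocycles k"
      unfolding de_Rham_eq image_image using Lefschetz_map_class[OF _ k(1)] by (intro image_cong) auto
    moreover have "(\<lambda>x. ?cl (?L x)) ` cocycles k \<subseteq> de_Rham A (2 * n - k)"
      using L by (auto simp: de_Rham_eq)
    ultimately have "Lefschetz_map A \<omega> n k ` de_Rham A k = de_Rham A (2 * n - k) \<longleftrightarrow>
      de_Rham A (2 * n - k) \<subseteq> (\<lambda>x. ?cl (?L x)) ` cocycles k" by auto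
    also have "\<dots> \<longleftrightarrow> (\<forall>y\<in>cocycles (2 * n - k). \<exists>x\<in>cocycles k. ?cl y = ?cl (?L x))"
      unfolding de_Rham_eq image_subset_iff by (simp only: image_iff)
    finally show ?thesis using de_Rham_class_eq_iff L by simp
  qed
  then show ?thesis by (simp add: Lefschetz_def hard_Lefschetz_upto_def)
qed

end

theorem proposition2p6:
  fixes M :: "'a topology"
    and A :: "('a, 'e::euclidean_space) chart set"
    and \<omega> :: "('a, 'e) form"
    and n s :: nat
  assumes "symplectic_manifold M A \<omega>"
    and "DIM('e) = 2 * n"
    and "s + 1 \<le> n"
  shows
    "(Lefschetz A \<omega> n s \<longleftrightarrow>
       (\<forall>k\<le>s + 2. de_Rham_hr A \<omega> k = de_Rham A k) \<and>
       (\<forall>k\<le>s. de_Rham_hr A \<omega> (2 * n - k) = de_Rham A (2 * n - k))) \<and>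
     ((\<forall>k\<le>s + 2. de_Rham_hr A \<omega> k = de_Rham A k) \<and>
       (\<forall>k\<le>s. de_Rham_hr A \<omega> (2 * n - k) = de_Rham A (2 * n - k)) \<longleftrightarrow>
      (\<forall>k\<le>s. de_Rham_hr A \<omega> (2 * n - k) = de_Rham A (2 * n - k)))"
proof -
  interpret symplectic M A \<omega> n
    using assms by unfold_locales
  show ?thesis
    unfolding de_Rham_hr_iff Lefschetz_iff[OF assms(3)]
    using Lefschetz_iff_harmonic_representable[OF assms(3)] by blast
qed

end
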